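(* Let $p,q$ be coprime nonzero integers. The $\mathbf{k}\oplus\mathbf{p}$ sub-Riemannian structure $(\Delta,\langle\cdot,\cdot\rangle)$ on $SU(2)$ induces a $2$-dimensional sub-Riemannian structure on $L(p,q)=SU(2)/_\sim$ via the quotient map $\Pi:SU(2)\to L(p,q)$, $x\mapsto[x]$, i.e.: - the map $\widetilde\Delta:[g]\mapsto\Pi_*(\Delta(h))\subset T_{[g]}L(p,q)$ with $h\in[g]$ is a (well-defined) $2$-dimensional smooth distribution on $L(p,q)$ that is Lie bracket generating; - $\tilde{\mathbf{g}}_{[g]}(v_*,w_* )=\langle v_*,w_*\rangle_{[g]}:=\langle v,w\rangle_h$ with $h\in[g]$, $v,w\in T_hSU(2)$, $\Pi_*(v)=v_*$, $\Pi_*(w)=w_*$ (for $v_*,w_*\in\widetilde\Delta([g])$) is a (well-defined) smooth positive definite scalar product on $\widetilde\Delta$.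
   Context: $SU(2)$ is identified with $\{(\alpha,\beta)^T\in\mathbb{C}^2:|\alpha|^2+|\beta|^2=1\}$ via $\begin{pmatrix}\alpha&\beta\\-\bar\beta&\bar\alpha\end{pmatrix}\mapsto\begin{pmatrix}\alpha\\\beta\end{pmatrix}$. In $su(2)$ let $p_1=\frac12\begin{pmatrix}0&1\\-1&0\end{pmatrix}$, $p_2=\frac12\begin{pmatrix}0&i\\i&0\end{pmatrix}$, $\mathbf{p}=\mathrm{span}\{p_1,p_2\}$. The $\mathbf{k}\oplus\mathbf{p}$ sub-Riemannian structure on $SU(2)$ has distribution $\Delta(g)=g\mathbf{p}$ and metric $\langle v,w\rangle_g=\langle g^{-1}v,g^{-1}w\rangle$ for $v,w\in\Delta(g)$, where $\langle\cdot,\cdot\rangle$ is the inner product on $\mathbf{p}$ with $\{p_1,p_2\}$ orthonormal. The lens space $L(p,q)$ is the quotient of $SU(2)$ by $(\alpha_1,\beta_1)^T\sim(\alpha_2,\beta_2)^T$ iff $(\alpha_2,\beta_2)^T=(\omega\alpha_1,\omega^q\beta_1)^T$ for some $p$-th root of unity $\omega$; its smooth structure is the one for which $\Pi$ is a local diffeomorphism. A distribution is Lie bracket generating if iterated Lie brackets of smooth vector fields tangent to it span the whole tangent space at every point. *)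

theory Defs
  imports "HOL-Analysis.Analysis" "HOL-Library.Function_Algebras"
begin

section \<open>Smooth maps between open subsets of normed spaces\<close>

text \<open>Intended for open \<open>S\<close> and finite-dimensional domains, where \<open>smooth_on\<close> is \<open>C\<^sup>\<infinity>\<close>.\<close>

primrec Ck_on :: "nat \<Rightarrow> 'a::real_normed_vector set \<Rightarrow> ('a \<Rightarrow> 'b::real_normed_vector) \<Rightarrow> bool" where
  "Ck_on 0 S f \<longleftrightarrow> continuous_on S f"
| "Ck_on (Suc k) S f \<longleftrightarrow>
     (\<forall>x\<in>S. f differentiable (at x)) \<and> (\<forall>v. Ck_on k S (\<lambda>x. frechet_derivative f (at x) v))"

definition smooth_on :: "'a::real_normed_vector set \<Rightarrow> ('a \<Rightarrow> 'b::real_normed_vector) \<Rightarrow> bool" where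
  "smooth_on S f \<longleftrightarrow> (\<forall>k. Ck_on k S f)"


section \<open>Smooth manifolds\<close>

type_synonym ('a, 'e) chart = "'a set \<times> ('a \<Rightarrow> 'e)"

record ('a, 'e) manifold =
  mtop :: "'a topology"
  charts :: "('a, 'e) chart set"

text \<open>A chart \<open>(U, \<phi>)\<close> only matters through the values of \<open>\<phi>\<close> on \<open>U\<close>; \<open>in_chart f c\<close> is
  \<open>f \<circ> \<phi>\<^sup>-\<^sup>1\<close>, meaningful on \<open>\<phi> ` U\<close>.\<close>

definition in_chart :: "('a \<Rightarrow> 'b) \<Rightarrow> ('a, 'e) chart \<Rightarrow> 'e \<Rightarrow> 'b" where
  "in_chart f c = f \<circ> inv_into (fst c) (snd c)"

definition charts_at :: "('a, 'e) manifold \<Rightarrow> 'a \<Rightarrow> ('a, 'e) chart set" where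
  "charts_at M x = {c \<in> charts M. x \<in> fst c}"

definition smooth_manifold :: "('a, 'e::euclidean_space) manifold \<Rightarrow> bool" where
  "smooth_manifold M \<longleftrightarrow>
     Hausdorff_space (mtop M) \<and>
     (\<exists>B. countable B \<and> openin (mtop M) = arbitrary union_of (\<lambda>U. U \<in> B)) \<and>
     (\<forall>(U, \<phi>)\<in>charts M.
        openin (mtop M) U \<and> open (\<phi> ` U) \<and>
        homeomorphic_map (subtopology (mtop M) U) (top_of_set (\<phi> ` U)) \<phi>) \<and>
     \<Union> (fst ` charts M) = topspace (mtop M) \<and>
     (\<forall>c\<in>charts M. \<forall>d\<in>charts M. smooth_on (snd c ` (fst c \<inter> fst d)) (in_chart (snd d) c))"

definition smooth_fun_on ::
    "('a, 'e::euclidean_space) manifold \<Rightarrow> 'a set \<Rightarrow> ('a \<Rightarrow> 'b::real_normed_vector) \<Rightarrow> bool" where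
  "smooth_fun_on M U f \<longleftrightarrow> (\<forall>c\<in>charts M. smooth_on (snd c ` (U \<inter> fst c)) (in_chart f c))"

definition smooth_map_on ::
    "('a, 'e::euclidean_space) manifold \<Rightarrow> 'a set \<Rightarrow> ('b, 'f::euclidean_space) manifold
       \<Rightarrow> ('a \<Rightarrow> 'b) \<Rightarrow> bool" where
  "smooth_map_on M U N F \<longleftrightarrow>
     continuous_map (subtopology (mtop M) U) (mtop N) F \<and>
     (\<forall>c\<in>charts M. \<forall>d\<in>charts N.
        smooth_on (snd c ` {x \<in> U \<inter> fst c. F x \<in> fst d}) (in_chart (snd d \<circ> F) c))"

definition local_diffeomorphism ::
    "('a, 'e::euclidean_space) manifold \<Rightarrow> ('b, 'f::euclidean_space) manifold
       \<Rightarrow> ('a \<Rightarrow> 'b) \<Rightarrow> bool" where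
  "local_diffeomorphism M N F \<longleftrightarrow>
     (\<forall>x\<in>topspace (mtop M). \<exists>U. openin (mtop M) U \<and> x \<in> U \<and> openin (mtop N) (F ` U) \<and>
        inj_on F U \<and> smooth_map_on M U N F \<and> smooth_map_on N (F ` U) M (inv_into U F))"


section \<open>Tangent vectors, vector fields, Lie brackets\<close>

instantiation "fun" :: (type, real_vector) real_vector
begin
definition scaleR_fun :: "real \<Rightarrow> ('a \<Rightarrow> 'b) \<Rightarrow> 'a \<Rightarrow> 'b" where
  "scaleR_fun r f = (\<lambda>x. r *\<^sub>R f x)"
instance
  by standard (auto simp: scaleR_fun_def fun_eq_iff scaleR_add_right scaleR_add_left)
end

text \<open>A tangent vector at \<open>x\<close> is the family of its coordinate vectors in all charts around \<open>x\<close>,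
  related by the derivatives of the transition maps (and \<open>0\<close> at all other arguments).
  The vector space operations are pointwise.\<close>

type_synonym ('a, 'e) tvec = "('a, 'e) chart \<Rightarrow> 'e"

definition tangent_space :: "('a, 'e::euclidean_space) manifold \<Rightarrow> 'a \<Rightarrow> ('a, 'e) tvec set" where
  "tangent_space M x =
     {v. (\<forall>c. c \<notin> charts_at M x \<longrightarrow> v c = 0) \<and>
         (\<forall>c\<in>charts_at M x. \<forall>d\<in>charts_at M x.
            v d = frechet_derivative (in_chart (snd d) c) (at (snd c x)) (v c))}"

text \<open>The differentials of a vector-valued function and of a map between manifolds. By the chain
  rule the value does not depend on the chart selected around \<open>x\<close>.\<close>

definition differential ::
    "('a, 'e::euclidean_space) manifold \<Rightarrow> ('a \<Rightarrow> 'b::real_normed_vector) \<Rightarrow> 'a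
       \<Rightarrow> ('a, 'e) tvec \<Rightarrow> 'b" where
  "differential M f x v =
     (let c = (SOME c. c \<in> charts_at M x)
      in frechet_derivative (in_chart f c) (at (snd c x)) (v c))"

definition pushforward ::
    "('a, 'e::euclidean_space) manifold \<Rightarrow> ('b, 'f::euclidean_space) manifold \<Rightarrow> ('a \<Rightarrow> 'b)
       \<Rightarrow> 'a \<Rightarrow> ('a, 'e) tvec \<Rightarrow> ('b, 'f) tvec" where
  "pushforward M N F x v =
     (\<lambda>d. if d \<in> charts_at N (F x) then differential M (snd d \<circ> F) x v else 0)"

type_synonym ('a, 'e) vfield = "'a \<Rightarrow> ('a, 'e) tvec"

definition vf_coord :: "('a, 'e) vfield \<Rightarrow> ('a, 'e) chart \<Rightarrow> 'e \<Rightarrow> 'e" where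
  "vf_coord X c = in_chart (\<lambda>x. X x c) c"

definition smooth_vf_on ::
    "('a, 'e::euclidean_space) manifold \<Rightarrow> 'a set \<Rightarrow> ('a, 'e) vfield \<Rightarrow> bool" where
  "smooth_vf_on M U X \<longleftrightarrow>
     (\<forall>x\<in>U. X x \<in> tangent_space M x) \<and>
     (\<forall>c\<in>charts M. smooth_on (snd c ` (U \<inter> fst c)) (vf_coord X c))"

text \<open>In coordinates, \<open>[X, Y] = DY(X) - DX(Y)\<close>.\<close>

definition lie_bracket ::
    "('a, 'e::euclidean_space) manifold \<Rightarrow> ('a, 'e) vfield \<Rightarrow> ('a, 'e) vfield
       \<Rightarrow> ('a, 'e) vfield" where
  "lie_bracket M X Y x =
     (\<lambda>c. if c \<in> charts_at M x
          then frechet_derivative (vf_coord Y c) (at (snd c x)) (X x c)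
             - frechet_derivative (vf_coord X c) (at (snd c x)) (Y x c)
          else 0)"


section \<open>Sub-Riemannian structures\<close>

type_synonym ('a, 'e) distribution = "'a \<Rightarrow> ('a, 'e) tvec set"
type_synonym ('a, 'e) metric = "'a \<Rightarrow> ('a, 'e) tvec \<Rightarrow> ('a, 'e) tvec \<Rightarrow> real"

definition smooth_distribution ::
    "('a, 'e::euclidean_space) manifold \<Rightarrow> nat \<Rightarrow> ('a, 'e) distribution \<Rightarrow> bool" where
  "smooth_distribution M k D \<longleftrightarrow>
     (\<forall>x\<in>topspace (mtop M). subspace (D x) \<and> D x \<subseteq> tangent_space M x \<and> dim (D x) = k) \<and>
     (\<forall>x\<in>topspace (mtop M). \<exists>U X. openin (mtop M) U \<and> x \<in> U \<and>
        (\<forall>i<k. smooth_vf_on M U (X i)) \<and> (\<forall>y\<in>U. D y = span ((\<lambda>i. X i y) ` {..<k})))"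

definition tangent_vfields ::
    "('a, 'e::euclidean_space) manifold \<Rightarrow> ('a, 'e) distribution \<Rightarrow> 'a set
       \<Rightarrow> ('a, 'e) vfield set" where
  "tangent_vfields M D U = {X. smooth_vf_on M U X \<and> (\<forall>x\<in>U. X x \<in> D x)}"

inductive_set iterated_brackets ::
    "('a, 'e::euclidean_space) manifold \<Rightarrow> ('a, 'e) distribution \<Rightarrow> ('a, 'e) vfield set"
  for M D where
  base: "X \<in> tangent_vfields M D (topspace (mtop M)) \<Longrightarrow> X \<in> iterated_brackets M D"
| bracket: "\<lbrakk>X \<in> iterated_brackets M D; Y \<in> iterated_brackets M D\<rbrakk>
    \<Longrightarrow> lie_bracket M X Y \<in> iterated_brackets M D"

definition bracket_generating ::
    "('a, 'e::euclidean_space) manifold \<Rightarrow> ('a, 'e) distribution \<Rightarrow> bool" where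
  "bracket_generating M D \<longleftrightarrow>
     (\<forall>x\<in>topspace (mtop M). span ((\<lambda>Z. Z x) ` iterated_brackets M D) = tangent_space M x)"

definition smooth_metric ::
    "('a, 'e::euclidean_space) manifold \<Rightarrow> ('a, 'e) distribution \<Rightarrow> ('a, 'e) metric \<Rightarrow> bool" where
  "smooth_metric M D g \<longleftrightarrow>
     (\<forall>x\<in>topspace (mtop M).
        (\<forall>u\<in>D x. \<forall>v\<in>D x. g x u v = g x v u) \<and>
        (\<forall>u\<in>D x. \<forall>v\<in>D x. \<forall>w\<in>D x. \<forall>a b. g x (a *\<^sub>R u + b *\<^sub>R v) w = a * g x u w + b * g x v w) \<and>
        (\<forall>v\<in>D x. v \<noteq> 0 \<longrightarrow> g x v v > 0)) \<and>
     (\<forall>U. openin (mtop M) U \<longrightarrow>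
        (\<forall>X\<in>tangent_vfields M D U. \<forall>Y\<in>tangent_vfields M D U.
           smooth_fun_on M U (\<lambda>x. g x (X x) (Y x))))"

definition sub_riemannian_structure ::
    "('a, 'e::euclidean_space) manifold \<Rightarrow> nat \<Rightarrow> ('a, 'e) distribution \<Rightarrow> ('a, 'e) metric
       \<Rightarrow> bool" where
  "sub_riemannian_structure M k D g \<longleftrightarrow>
     smooth_manifold M \<and> smooth_distribution M k D \<and> bracket_generating M D \<and> smooth_metric M D g"


section \<open>Submanifolds and quotient manifolds\<close>

text \<open>The structure of a smooth submanifold \<open>S\<close> of a Euclidean space: all charts that extend
  locally to smooth functions on the ambient space and have a smooth inverse.\<close>

definition submanifold ::
    "'a::euclidean_space set \<Rightarrow> ('a, 'e::euclidean_space) manifold" where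
  "submanifold S =
     \<lparr>mtop = top_of_set S,
      charts = {(U, \<phi>). openin (top_of_set S) U \<and> inj_on \<phi> U \<and> open (\<phi> ` U) \<and>
        smooth_on (\<phi> ` U) (inv_into U \<phi>) \<and>
        (\<forall>x\<in>U. \<exists>W f. open W \<and> x \<in> W \<and> smooth_on W f \<and> (\<forall>y\<in>W \<inter> U. f y = \<phi> y))}\<rparr>"

definition quotient_top :: "'a topology \<Rightarrow> ('a \<Rightarrow> 'b) \<Rightarrow> 'b topology" where
  "quotient_top T f =
     topology (\<lambda>V. V \<subseteq> f ` topspace T \<and> openin T {x \<in> topspace T. f x \<in> V})"

lemma openin_quotient_top:
  "openin (quotient_top T f) V \<longleftrightarrow>
     V \<subseteq> f ` topspace T \<and> openin T {x \<in> topspace T. f x \<in> V}"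
proof -
  let ?P = "\<lambda>V. V \<subseteq> f ` topspace T \<and> openin T {x \<in> topspace T. f x \<in> V}"
  have "?P (V \<inter> W)" if "?P V" "?P W" for V W
  proof -
    have "{x \<in> topspace T. f x \<in> V \<inter> W} = {x \<in> topspace T. f x \<in> V} \<inter> {x \<in> topspace T. f x \<in> W}"
      by auto
    then show ?thesis using that by auto
  qed
  moreover have "?P (\<Union>K)" if "\<forall>V\<in>K. ?P V" for K
  proof -
    have "{x \<in> topspace T. f x \<in> \<Union>K} = (\<Union>V\<in>K. {x \<in> topspace T. f x \<in> V})"
      by auto
    then show ?thesis using that by auto
  qed
  ultimately have "istopology ?P"
    unfolding istopology_def by blast
  then show ?thesis
    unfolding quotient_top_def by (simp add: topology_inverse')
qed

lemma quotient_map_quotient_top: "quotient_map T (quotient_top T f) f"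
proof -
  have "{x \<in> topspace T. f x \<in> f ` topspace T} = topspace T"
    by auto
  then have "openin (quotient_top T f) (f ` topspace T)"
    unfolding openin_quotient_top by simp
  then have "topspace (quotient_top T f) = f ` topspace T"
    by (meson openin_quotient_top openin_subset openin_topspace subset_antisym)
  then show ?thesis
    unfolding quotient_map_def openin_quotient_top by auto
qed

text \<open>The charts are the \<open>\<phi> \<circ> (\<pi>|\<^sub>U)\<^sup>-\<^sup>1\<close> for charts \<open>(U, \<phi>)\<close> on whose domain \<open>\<pi>\<close> is injective.
  They form the smooth structure making \<open>\<pi>\<close> a local diffeomorphism whenever \<open>\<pi>\<close> is
  the orbit map of a free smooth action of a finite group.\<close>

definition quotient_manifold :: "('a, 'e) manifold \<Rightarrow> ('a \<Rightarrow> 'b) \<Rightarrow> ('b, 'e) manifold" where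
  "quotient_manifold M \<pi> =
     \<lparr>mtop = quotient_top (mtop M) \<pi>,
      charts = {(\<pi> ` U, \<phi> \<circ> inv_into U \<pi>) | U \<phi>. (U, \<phi>) \<in> charts M \<and> inj_on \<pi> U}\<rparr>"


section \<open>The sub-Riemannian structure on SU(2)\<close>

type_synonym C2 = "complex \<times> complex"

definition SU2 :: "C2 set" where
  "SU2 = {(\<alpha>, \<beta>). (cmod \<alpha>)\<^sup>2 + (cmod \<beta>)\<^sup>2 = 1}"

text \<open>The identification of \<open>SU2\<close> with the matrix group, extended real-linearly to \<open>\<complex>\<^sup>2\<close>.\<close>

definition su2_mat :: "C2 \<Rightarrow> complex^2^2" where
  "su2_mat = (\<lambda>(\<alpha>, \<beta>). vector [vector [\<alpha>, \<beta>], vector [- cnj \<beta>, cnj \<alpha>]])"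

definition p1 :: "complex^2^2" where
  "p1 = (1/2) *\<^sub>R vector [vector [0, 1], vector [-1, 0]]"

definition p2 :: "complex^2^2" where
  "p2 = (1/2) *\<^sub>R vector [vector [0, \<i>], vector [\<i>, 0]]"

definition p_space :: "(complex^2^2) set" where
  "p_space = span {p1, p2}"

text \<open>The inner product on \<open>p_space\<close> for which \<open>p1, p2\<close> is an orthonormal basis.\<close>

definition p_inner :: "complex^2^2 \<Rightarrow> complex^2^2 \<Rightarrow> real" where
  "p_inner x y = (\<Sum>e\<in>{p1, p2}. representation {p1, p2} x e * representation {p1, p2} y e)"

definition SU2_mfd :: "(C2, real^3) manifold" where
  "SU2_mfd = submanifold SU2"

text \<open>The matrix of a tangent vector: the differential of the embedding into matrices.\<close>

definition tvec_mat :: "C2 \<Rightarrow> (C2, real^3) tvec \<Rightarrow> complex^2^2" where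
  "tvec_mat h v = differential SU2_mfd su2_mat h v"

definition SU2_dist :: "(C2, real^3) distribution" where
  "SU2_dist h =
     {v \<in> tangent_space SU2_mfd h. tvec_mat h v \<in> (\<lambda>a. su2_mat h ** a) ` p_space}"

definition SU2_metric :: "(C2, real^3) metric" where
  "SU2_metric h v w =
     p_inner (matrix_inv (su2_mat h) ** tvec_mat h v) (matrix_inv (su2_mat h) ** tvec_mat h w)"


section \<open>Lens spaces\<close>

definition lens_rel :: "int \<Rightarrow> int \<Rightarrow> (C2 \<times> C2) set" where
  "lens_rel p q =
     {((\<alpha>1, \<beta>1), (\<alpha>2, \<beta>2)). (\<alpha>1, \<beta>1) \<in> SU2 \<and> (\<alpha>2, \<beta>2) \<in> SU2 \<and>
        (\<exists>\<omega>. \<omega> powi p = 1 \<and> \<alpha>2 = \<omega> * \<alpha>1 \<and> \<beta>2 = \<omega> powi q * \<beta>1)}"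

definition lens_proj :: "int \<Rightarrow> int \<Rightarrow> C2 \<Rightarrow> C2 set" where
  "lens_proj p q x = lens_rel p q `` {x}"

definition lens_space :: "int \<Rightarrow> int \<Rightarrow> (C2 set, real^3) manifold" where
  "lens_space p q = quotient_manifold SU2_mfd (lens_proj p q)"

lemma topspace_lens_space: "topspace (mtop (lens_space p q)) = SU2 // lens_rel p q"
proof -
  have "topspace (mtop (lens_space p q)) = lens_proj p q ` SU2"
    using quotient_map_quotient_top[of "mtop SU2_mfd" "lens_proj p q"]
    by (simp add: quotient_map_def lens_space_def quotient_manifold_def SU2_mfd_def submanifold_def)
  then show ?thesis
    by (auto simp: quotient_def lens_proj_def)
qed

definition lens_push :: "int \<Rightarrow> int \<Rightarrow> C2 \<Rightarrow> (C2, real^3) tvec \<Rightarrow> (C2 set, real^3) tvec" where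
  "lens_push p q h = pushforward SU2_mfd (lens_space p q) (lens_proj p q) h"

end

theory Submission
  imports Defs
begin

text \<open>
  Every chart of the lens space lifts locally to a smooth map into SU(2), so a tangent vector at
  \<open>[h]\<close> is the same thing as an ambient vector orthogonal to \<open>h\<close>, up to the action
  \<open>(\<alpha>, \<beta>) \<mapsto> (\<omega> \<alpha>, \<omega>\<^sup>q \<beta>)\<close>. At \<open>h = (\<alpha>, \<beta>)\<close> the distribution consists of the vectors
  \<open>A_F = (- \<beta> cnj F, \<alpha> F)\<close> with \<open>F\<close> complex, and the metric is four times the ambient inner product.
  Both are invariant under the action, hence descend. The left-invariant fields \<open>p1, p2\<close> themselves do
  not descend, but \<open>A_F\<close> does for every function \<open>F\<close> with \<open>F (\<omega> \<cdot> h) = \<omega>\<^sup>q\<^sup>-\<^sup>1 F h\<close>. Suitable powers of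
  \<open>\<alpha>\<close> and of \<open>\<beta>\<close> have this property, and at each point one of them does not vanish. Where
  \<open>F \<noteq> 0\<close>, the fields \<open>A_F\<close> and \<open>A_iF\<close> span the distribution, and their bracket is
  \<open>2 |F|\<^sup>2 (i \<alpha>, - i \<beta>)\<close> up to a horizontal vector, which gives the missing direction.
\<close>

section \<open>Calculus of smooth maps\<close>

text \<open>Tangent vectors are coordinate families over all charts, and in general
  \<open>\<pi>\<close> has no global section, so direct work on the quotient would drown in chart
  changes. The locale \<open>covered_manifold\<close> treats SU(2) (with \<open>id\<close>) and the
  lens space (with \<open>\<pi>\<close>) alike. In both, \<open>emb h\<close> turns tangent vectors
  into ambient ones, and there the pushforward becomes the identity. The weight q - 1 is forced by
  the conjugate: \<omega>^q \<beta> cnj F' = \<omega> \<beta> cnj F requires F' = \<omega>^(q-1) F,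
  and the second coordinate then agrees. Coprimality enters twice: for freeness of the action where
  \<alpha> = 0, and to invert q modulo p so that a power of \<beta> has this weight.
  \<open>iterated_brackets\<close> starts from fields on the whole manifold, so a local frame cannot
  be fed into it directly; the powers of \<alpha> and \<beta> give global fields that may vanish
  elsewhere. The factor four of the metric reflects that p1 and p2 belong to F = 1/2 and F = \<i>/2,
  of ambient length 1/2.\<close>

abbreviation fder :: "('a::real_normed_vector \<Rightarrow> 'b::real_normed_vector) \<Rightarrow> 'a \<Rightarrow> 'a \<Rightarrow> 'b" where
  "fder f x \<equiv> frechet_derivative f (at x)"

lemma fder_eq: "(f has_derivative f') (at x) \<Longrightarrow> fder f x = f'"
  using frechet_derivative_at by metis

lemma has_derivative_fder: "f differentiable (at x) \<Longrightarrow> (f has_derivative fder f x) (at x)"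
  using frechet_derivative_works by blast

lemma fder_cong_open:
  assumes "open S" "x \<in> S" "\<And>y. y \<in> S \<Longrightarrow> f y = g y"
  shows "fder f x = fder g x"
proof -
  have "(f has_derivative f') (at x) \<longleftrightarrow> (g has_derivative f') (at x)" for f'
    using has_derivative_transform_within_open[OF _ assms(1,2), of f f' UNIV g]
      has_derivative_transform_within_open[OF _ assms(1,2), of g f' UNIV f] assms(3) by auto
  then show ?thesis unfolding frechet_derivative_def by presburger
qed

lemma differentiable_cong_open:
  assumes "open S" "x \<in> S" "\<And>y. y \<in> S \<Longrightarrow> f y = g y"
  shows "f differentiable (at x) \<longleftrightarrow> g differentiable (at x)"
  using has_derivative_transform_within_open[OF _ assms(1,2), of f _ UNIV g]
    has_derivative_transform_within_open[OF _ assms(1,2), of g _ UNIV f] assms(3)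
  unfolding differentiable_def by auto

lemma Ck_on_cong:
  assumes "open S" "\<And>x. x \<in> S \<Longrightarrow> f x = g x"
  shows "Ck_on k S f \<longleftrightarrow> Ck_on k S g"
  using assms
proof (induction k arbitrary: f g)
  case 0
  then show ?case by (simp cong: continuous_on_cong)
next
  case (Suc k)
  have "Ck_on k S (\<lambda>x. fder f x v) \<longleftrightarrow> Ck_on k S (\<lambda>x. fder g x v)" for v
    using Suc.prems fder_cong_open[of S _ f g] by (intro Suc.IH) simp_all
  moreover have "f differentiable (at x) \<longleftrightarrow> g differentiable (at x)" if "x \<in> S" for x
    using differentiable_cong_open[OF Suc.prems(1) that] Suc.prems(2) by blast
  ultimately show ?case by simp
qed

lemma Ck_on_subset: "Ck_on k S f \<Longrightarrow> T \<subseteq> S \<Longrightarrow> Ck_on k T f"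
  by (induction k arbitrary: f) (auto intro: continuous_on_subset)

lemma Ck_on_SucD: "Ck_on (Suc k) S f \<Longrightarrow> Ck_on k S f"
proof (induction k arbitrary: f)
  case 0
  then show ?case
    by (auto intro!: continuous_at_imp_continuous_on differentiable_imp_continuous_within)
qed auto

lemma Ck_on_local:
  "(\<And>x. x \<in> S \<Longrightarrow> \<exists>T. open T \<and> x \<in> T \<and> Ck_on k T f) \<Longrightarrow> Ck_on k S f"
proof (induction k arbitrary: f)
  case 0
  then show ?case
    using continuous_on_eq_continuous_at continuous_at_imp_continuous_on by (metis Ck_on.simps(1))
next
  case (Suc k)
  then show ?case by (simp, metis)
qed

lemma Ck_on_const: "Ck_on k S (\<lambda>x. c)"
  by (induction k arbitrary: c) auto

lemma Ck_on_bounded_linear: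
  assumes "bounded_linear f" shows "Ck_on k S f"
proof (cases k)
  case 0
  then show ?thesis using linear_continuous_on[OF assms] by simp
next
  case (Suc m)
  have "fder f x = f" for x
    by (rule fder_eq) (rule bounded_linear_imp_has_derivative[OF assms])
  then show ?thesis
    using Suc assms bounded_linear_imp_differentiable by (auto simp: Ck_on_const)
qed

lemma Ck_on_add: "open S \<Longrightarrow> Ck_on k S u \<Longrightarrow> Ck_on k S v \<Longrightarrow> Ck_on k S (\<lambda>x. u x + v x)"
proof (induction k arbitrary: u v)
  case 0
  then show ?case by (auto intro: continuous_on_add)
next
  case (Suc k)
  have hd: "((\<lambda>x. u x + v x) has_derivative (\<lambda>h. fder u x h + fder v x h)) (at x)" if "x \<in> S" for x
    using Suc.prems that by (intro has_derivative_add has_derivative_fder) auto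
  have "Ck_on k S (\<lambda>x. fder (\<lambda>x. u x + v x) x h)" for h
    using Suc by (subst Ck_on_cong[OF Suc.prems(1), where g="\<lambda>x. fder u x h + fder v x h"])
      (auto simp: fder_eq[OF hd])
  then show ?case using Suc.prems by auto
qed

text \<open>The Leibniz rule gives two terms of the same shape, each with one factor differentiated.
  The induction hypothesis applies because the other factor is also C^k, by
  \<open>Ck_on_SucD\<close>.\<close>

lemma Ck_on_bilinear:
  assumes b: "bounded_bilinear b" and "open S" "Ck_on k S f" "Ck_on k S g"
  shows "Ck_on k S (\<lambda>x. b (f x) (g x))"
  using assms(2-)
  proof (induction k arbitrary: f g)
    case 0
    then show ?case using bounded_bilinear.continuous_on[OF b] by auto
  next
    case (Suc k)
    have hd: "((\<lambda>x. b (f x) (g x)) has_derivative (\<lambda>h. b (f x) (fder g x h) + b (fder f x h) (g x))) (at x)"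
      if "x \<in> S" for x
      using Suc.prems that by (intro bounded_bilinear.FDERIV[OF b] has_derivative_fder) auto
    have "Ck_on k S (\<lambda>x. b (f x) (fder g x h) + b (fder f x h) (g x))" for h
      using Suc.prems Ck_on_SucD[OF Suc.prems(2)] Ck_on_SucD[OF Suc.prems(3)]
      by (intro Ck_on_add Suc.IH) auto
    then have "Ck_on k S (\<lambda>x. fder (\<lambda>x. b (f x) (g x)) x h)" for h
      by (subst Ck_on_cong[OF Suc.prems(1), where g="\<lambda>x. b (f x) (fder g x h) + b (fder f x h) (g x)"])
        (simp_all add: fder_eq[OF hd])
    then show ?case using hd by (auto simp: differentiable_def)
qed

lemma Ck_on_sum:
  assumes "open S" "\<And>i. i \<in> I \<Longrightarrow> Ck_on k S (f i)"
  shows "Ck_on k S (\<lambda>x. \<Sum>i\<in>I. f i x)"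
  using assms(2)
  by (induction I rule: infinite_finite_induct) (auto intro!: Ck_on_const Ck_on_add assms(1))

lemma linear_eq_sum_Basis:
  fixes L :: "'a::euclidean_space \<Rightarrow> 'b::real_normed_vector"
  assumes "linear L" shows "L v = (\<Sum>b\<in>Basis. (v \<bullet> b) *\<^sub>R L b)"
proof -
  have "L v = L (\<Sum>b\<in>Basis. (v \<bullet> b) *\<^sub>R b)" by (simp add: euclidean_representation)
  then show ?thesis using assms by (simp add: linear_sum linear_scale)
qed

text \<open>The chain rule produces \<open>fder g (f x) (fder f x h)\<close>, whose direction moves
  with x, whereas \<open>Ck_on\<close> speaks of fixed directions. Expansion over
  \<open>Basis\<close> leaves scalar coefficients times the maps \<open>fder g (f x) b\<close>, to
  which the induction hypothesis applies.\<close>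

lemma Ck_on_compose:
  fixes f :: "'a::real_normed_vector \<Rightarrow> 'b::euclidean_space"
  assumes "open S" "open T" "Ck_on k S f" "Ck_on k T g" "f ` S \<subseteq> T"
  shows "Ck_on k S (\<lambda>x. g (f x))"
  using assms
proof (induction k arbitrary: g)
  case 0
  then show ?case by (auto intro: continuous_on_compose2)
next
  case (Suc k)
  have hd: "((\<lambda>x. g (f x)) has_derivative (\<lambda>h. fder g (f x) (fder f x h))) (at x)" if "x \<in> S" for x
    using Suc.prems that by (intro has_derivative_compose[where f=f and g=g] has_derivative_fder) auto
  have "fder g (f x) (fder f x h) = (\<Sum>b\<in>Basis. (fder f x h \<bullet> b) *\<^sub>R fder g (f x) b)" if "x \<in> S" for x h
    using Suc.prems that by (intro linear_eq_sum_Basis linear_frechet_derivative) auto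
  then have eq: "fder (\<lambda>x. g (f x)) x h = (\<Sum>b\<in>Basis. (fder f x h \<bullet> b) *\<^sub>R fder g (f x) b)" if "x \<in> S" for x h
    using fder_eq[OF hd] that by simp
  have "Ck_on k S f" using Suc.prems(3) by (rule Ck_on_SucD)
  then have "Ck_on k S (\<lambda>x. \<Sum>b\<in>Basis. (fder f x h \<bullet> b) *\<^sub>R fder g (f x) b)" for h
    using Suc.prems
    by (intro Ck_on_sum Ck_on_bilinear[OF bounded_bilinear_scaleR] Ck_on_bilinear[OF bounded_bilinear_inner]
        Ck_on_const Suc.IH) auto
  then have "Ck_on k S (\<lambda>x. fder (\<lambda>x. g (f x)) x h)" for h
    by (subst Ck_on_cong[OF Suc.prems(1),
          where g="\<lambda>x. \<Sum>b\<in>Basis. (fder f x h \<bullet> b) *\<^sub>R fder g (f x) b"]) (simp_all add: eq)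
  then show ?case using hd by (auto simp: differentiable_def)
qed

lemma smooth_on_cong:
  "open S \<Longrightarrow> (\<And>x. x \<in> S \<Longrightarrow> f x = g x) \<Longrightarrow> smooth_on S f \<longleftrightarrow> smooth_on S g"
  unfolding smooth_on_def using Ck_on_cong by blast

lemma smooth_on_subset: "smooth_on S f \<Longrightarrow> T \<subseteq> S \<Longrightarrow> smooth_on T f"
  unfolding smooth_on_def using Ck_on_subset by blast

lemma smooth_on_local:
  "(\<And>x. x \<in> S \<Longrightarrow> \<exists>T. open T \<and> x \<in> T \<and> smooth_on T f) \<Longrightarrow> smooth_on S f"
  unfolding smooth_on_def by (metis Ck_on_local)

lemma smooth_on_const [simp]: "smooth_on S (\<lambda>x. c)"
  by (simp add: smooth_on_def Ck_on_const)

lemma smooth_on_bounded_linear: "bounded_linear f \<Longrightarrow> smooth_on S f"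
  by (simp add: smooth_on_def Ck_on_bounded_linear)

lemma smooth_on_bilinear:
  "bounded_bilinear b \<Longrightarrow> open S \<Longrightarrow> smooth_on S f \<Longrightarrow> smooth_on S g \<Longrightarrow> smooth_on S (\<lambda>x. b (f x) (g x))"
  by (simp add: smooth_on_def Ck_on_bilinear)

lemmas smooth_on_mult = smooth_on_bilinear[OF bounded_bilinear_mult]
lemmas smooth_on_scaleR = smooth_on_bilinear[OF bounded_bilinear_scaleR]
lemmas smooth_on_inner = smooth_on_bilinear[OF bounded_bilinear_inner]

lemma smooth_on_add:
  "open S \<Longrightarrow> smooth_on S f \<Longrightarrow> smooth_on S g \<Longrightarrow> smooth_on S (\<lambda>x. f x + g x)"
  by (simp add: smooth_on_def Ck_on_add)

lemma smooth_on_sum: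
  "open S \<Longrightarrow> (\<And>i. i \<in> I \<Longrightarrow> smooth_on S (f i)) \<Longrightarrow> smooth_on S (\<lambda>x. \<Sum>i\<in>I. f i x)"
  by (simp add: smooth_on_def Ck_on_sum)

lemma smooth_on_compose:
  fixes f :: "'a::real_normed_vector \<Rightarrow> 'b::euclidean_space"
  assumes "open S" "open T" "smooth_on S f" "smooth_on T g" "f ` S \<subseteq> T"
  shows "smooth_on S (\<lambda>x. g (f x))"
  using assms Ck_on_compose unfolding smooth_on_def by blast

lemma smooth_on_linear_compose:
  fixes f :: "'a::real_normed_vector \<Rightarrow> 'b::euclidean_space"
  assumes "bounded_linear l" "open S" "smooth_on S f"
  shows "smooth_on S (\<lambda>x. l (f x))"
  using smooth_on_compose[OF assms(2) open_UNIV assms(3) smooth_on_bounded_linear[OF assms(1)]] by simp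

lemma smooth_on_diff:
  fixes f g :: "'a::real_normed_vector \<Rightarrow> 'b::euclidean_space"
  assumes "open S" "smooth_on S f" "smooth_on S g"
  shows "smooth_on S (\<lambda>x. f x - g x)"
  using smooth_on_add[OF assms(1,2), of "\<lambda>x. - g x"]
    smooth_on_linear_compose[OF bounded_linear_minus[OF bounded_linear_ident] assms(1,3)] by simp

lemma smooth_on_power:
  fixes f :: "'a::real_normed_vector \<Rightarrow> 'b::real_normed_field"
  assumes "open S" "smooth_on S f" shows "smooth_on S (\<lambda>x. f x ^ n)"
  by (induction n) (auto intro!: smooth_on_mult assms)

lemma smooth_on_differentiable: "smooth_on S f \<Longrightarrow> x \<in> S \<Longrightarrow> f differentiable (at x)"
  unfolding smooth_on_def using Ck_on.simps(2) by blast

lemma smooth_on_has_derivative: "smooth_on S f \<Longrightarrow> x \<in> S \<Longrightarrow> (f has_derivative fder f x) (at x)"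
  by (intro has_derivative_fder smooth_on_differentiable)

lemma smooth_on_continuous_on: "smooth_on S f \<Longrightarrow> continuous_on S f"
  unfolding smooth_on_def using Ck_on.simps(1) by blast

lemma smooth_on_fder: "smooth_on S f \<Longrightarrow> smooth_on S (\<lambda>x. fder f x v)"
  unfolding smooth_on_def using Ck_on.simps(2) by blast

lemma smooth_on_linear_fder: "smooth_on S f \<Longrightarrow> x \<in> S \<Longrightarrow> linear (fder f x)"
  by (intro linear_frechet_derivative smooth_on_differentiable)

text \<open>As for compositions, the moving direction \<open>X x\<close> is expanded over
  \<open>Basis\<close> to reduce to derivatives in fixed directions.\<close>

lemma smooth_on_fder_apply:
  fixes f :: "'a::euclidean_space \<Rightarrow> 'b::real_normed_vector"
  assumes "open S" "smooth_on S f" "smooth_on S X"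
  shows "smooth_on S (\<lambda>x. fder f x (X x))"
proof -
  have "smooth_on S (\<lambda>x. \<Sum>b\<in>Basis. (X x \<bullet> b) *\<^sub>R fder f x b)"
    using assms by (intro smooth_on_sum smooth_on_scaleR smooth_on_inner smooth_on_const smooth_on_fder)
  then show ?thesis
    by (subst smooth_on_cong[OF assms(1), where g="\<lambda>x. \<Sum>b\<in>Basis. (X x \<bullet> b) *\<^sub>R fder f x b"])
      (auto intro: linear_eq_sum_Basis smooth_on_linear_fder[OF assms(2)])
qed

text \<open>The derivative of \<open>inverse\<close> is a constant times two factors
  \<open>inverse\<close>, so differentiability to order k yields order k + 1.\<close>

lemma smooth_on_inverse_real: "smooth_on {x::real. x \<noteq> 0} inverse"
proof -
  let ?S = "{x::real. x \<noteq> 0}"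
  have op: "open ?S" by (simp add: open_Collect_neq)
  have hd: "(inverse has_derivative (\<lambda>h. - (inverse x * h * inverse x))) (at x)" if "x \<in> ?S" for x
    using that has_derivative_inverse'[of x UNIV] by simp
  have "Ck_on k ?S inverse" for k
  proof (induction k)
    case 0
    then show ?case by (auto intro!: continuous_intros)
  next
    case (Suc k)
    have "Ck_on k ?S (\<lambda>x. inverse x * (- v * inverse x))" for v
      using Suc op by (intro Ck_on_bilinear[OF bounded_bilinear_mult] Ck_on_const) auto
    then have "Ck_on k ?S (\<lambda>x. fder inverse x v)" for v
      by (subst Ck_on_cong[OF op, where g="\<lambda>x. inverse x * (- v * inverse x)"])
         (auto simp: fder_eq[OF hd])
    then show ?case using hd by (auto simp: differentiable_def)
  qed
  then show ?thesis by (simp add: smooth_on_def)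
qed

section \<open>Symmetry of second derivatives\<close>

lemma second_difference_mean_value:
  fixes f :: "'a::real_normed_vector \<Rightarrow> real"
  assumes "0 < t" "smooth_on S f"
    and S: "\<And>a b. 0 \<le> a \<Longrightarrow> a \<le> t \<Longrightarrow> 0 \<le> b \<Longrightarrow> b \<le> t \<Longrightarrow> x + a *\<^sub>R v + b *\<^sub>R w \<in> S"
  obtains a b where "0 < a" "a < t" "0 < b" "b < t"
    "f (x + t *\<^sub>R v + t *\<^sub>R w) - f (x + t *\<^sub>R v) - f (x + t *\<^sub>R w) + f x
      = t * t * fder (\<lambda>y. fder f y v) (x + a *\<^sub>R v + b *\<^sub>R w) w"
proof -
  \<comment> \<open>The second difference is \<open>\<phi> t - \<phi> 0\<close>. A mean value step
    in the direction v produces a; a second one, in the direction w at this a, produces b.\<close>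
  define \<phi> where "\<phi> a = f (x + a *\<^sub>R v + t *\<^sub>R w) - f (x + a *\<^sub>R v)" for a
  have hd1: "((\<lambda>a. f (x + a *\<^sub>R v + b *\<^sub>R w)) has_derivative (\<lambda>h. h * fder f (x + a *\<^sub>R v + b *\<^sub>R w) v)) (at a)"
    if "0 \<le> a" "a \<le> t" "0 \<le> b" "b \<le> t" for a b
  proof -
    have "(f has_derivative fder f (x + a *\<^sub>R v + b *\<^sub>R w)) (at (x + a *\<^sub>R v + b *\<^sub>R w))"
      using smooth_on_has_derivative[OF assms(2) S] that by blast
    moreover have "((\<lambda>a. x + a *\<^sub>R v + b *\<^sub>R w) has_derivative (\<lambda>h. h *\<^sub>R v)) (at a)"
      by (auto intro!: derivative_eq_intros)
    moreover have "linear (fder f (x + a *\<^sub>R v + b *\<^sub>R w))"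
      using smooth_on_linear_fder[OF assms(2) S] that by blast
    ultimately show ?thesis
      using has_derivative_compose[of "\<lambda>a. x + a *\<^sub>R v + b *\<^sub>R w" "\<lambda>h. h *\<^sub>R v" a UNIV f
          "fder f (x + a *\<^sub>R v + b *\<^sub>R w)"] linear_scale[of "fder f (x + a *\<^sub>R v + b *\<^sub>R w)"]
      by simp
  qed
  have d\<phi>: "(\<phi> has_derivative (\<lambda>h. h * (fder f (x + a *\<^sub>R v + t *\<^sub>R w) v - fder f (x + a *\<^sub>R v) v))) (at a)"
    if "0 \<le> a" "a \<le> t" for a
    unfolding \<phi>_def right_diff_distrib using hd1[OF that, of t] hd1[OF that, of 0] assms(1)
    by (intro has_derivative_diff) auto
  obtain a where a: "0 < a" "a < t"
    "\<phi> t - \<phi> 0 = t * (fder f (x + a *\<^sub>R v + t *\<^sub>R w) v - fder f (x + a *\<^sub>R v) v)"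
    using mvt_simple[OF assms(1), of \<phi>
      "\<lambda>a h. h * (fder f (x + a *\<^sub>R v + t *\<^sub>R w) v - fder f (x + a *\<^sub>R v) v)", OF has_derivative_at_withinI[OF d\<phi>]]
    by auto
  let ?\<psi> = "\<lambda>b. fder f (x + a *\<^sub>R v + b *\<^sub>R w) v"
  have d\<psi>: "(?\<psi> has_derivative (\<lambda>h. h * fder (\<lambda>y. fder f y v) (x + a *\<^sub>R v + b *\<^sub>R w) w)) (at b)"
    if "0 \<le> b" "b \<le> t" for b
  proof -
    note sm = smooth_on_fder[OF assms(2), of v]
    have "((\<lambda>y. fder f y v) has_derivative fder (\<lambda>y. fder f y v) (x + a *\<^sub>R v + b *\<^sub>R w)) (at (x + a *\<^sub>R v + b *\<^sub>R w))"
      using smooth_on_has_derivative[OF sm S] that a by simp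
    moreover have "((\<lambda>b. x + a *\<^sub>R v + b *\<^sub>R w) has_derivative (\<lambda>h. h *\<^sub>R w)) (at b)"
      by (auto intro!: derivative_eq_intros)
    moreover have "linear (fder (\<lambda>y. fder f y v) (x + a *\<^sub>R v + b *\<^sub>R w))"
      using smooth_on_linear_fder[OF sm S] that a by simp
    ultimately show ?thesis
      using has_derivative_compose[of "\<lambda>b. x + a *\<^sub>R v + b *\<^sub>R w" "\<lambda>h. h *\<^sub>R w" b UNIV "\<lambda>y. fder f y v"
          "fder (\<lambda>y. fder f y v) (x + a *\<^sub>R v + b *\<^sub>R w)"] linear_scale[of "fder (\<lambda>y. fder f y v) (x + a *\<^sub>R v + b *\<^sub>R w)"]
      by simp
  qed
  obtain b where b: "0 < b" "b < t"
    "?\<psi> t - ?\<psi> 0 = t * fder (\<lambda>y. fder f y v) (x + a *\<^sub>R v + b *\<^sub>R w) w"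
    using mvt_simple[OF assms(1), of ?\<psi>
      "\<lambda>b h. h * fder (\<lambda>y. fder f y v) (x + a *\<^sub>R v + b *\<^sub>R w) w", OF has_derivative_at_withinI[OF d\<psi>]]
    by auto
  show thesis
    by (rule that[of a b]) (use a b in \<open>auto simp: \<phi>_def algebra_simps\<close>)
qed

text \<open>Schwarz's theorem: the second difference over a small parallelogram is symmetric in v
  and w, yet equals \<open>t * t\<close> times either mixed derivative at some point near x.
  Continuity of both then excludes different values at x.\<close>

lemma fder_symmetric_real:
  fixes f :: "'a::real_normed_vector \<Rightarrow> real"
  assumes "open S" "smooth_on S f" "x \<in> S"
  shows "fder (\<lambda>y. fder f y v) x w = fder (\<lambda>y. fder f y w) x v"
proof (rule ccontr)
  let ?A = "\<lambda>y. fder (\<lambda>y. fder f y v) y w" and ?B = "\<lambda>y. fder (\<lambda>y. fder f y w) y v"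
  assume ne: "?A x \<noteq> ?B x"
  \<comment> \<open>Half the gap: two numbers closer than e to \<open>?A x\<close> and to
    \<open>?B x\<close> respectively cannot coincide.\<close>
  define e where "e = \<bar>?A x - ?B x\<bar> / 2"
  have e: "e > 0" using ne by (simp add: e_def)
  have "continuous_on S ?A" "continuous_on S ?B"
    using assms(2) by (auto intro!: smooth_on_continuous_on smooth_on_fder)
  then have "isCont ?A x" "isCont ?B x"
    using assms(1,3) continuous_on_eq_continuous_at by blast+
  then have "\<exists>d>0. \<forall>y. dist y x < d \<longrightarrow> dist (?A y) (?A x) < e" "\<exists>d>0. \<forall>y. dist y x < d \<longrightarrow> dist (?B y) (?B x) < e"
    using e unfolding continuous_at_eps_delta by simp_all
  then obtain d1 d2 where d: "d1 > 0" "d2 > 0"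
    "\<And>y. dist y x < d1 \<Longrightarrow> dist (?A y) (?A x) < e" "\<And>y. dist y x < d2 \<Longrightarrow> dist (?B y) (?B x) < e"
    by blast
  obtain d3 where d3: "d3 > 0" "ball x d3 \<subseteq> S" using assms(1,3) openE by blast
  define d where "d = min d1 (min d2 d3)"
  \<comment> \<open>The denominator is positive even for v = w = 0, and the parallelogram with sides
    \<open>t *\<^sub>R v\<close> and \<open>t *\<^sub>R w\<close> stays within distance d of
    x.\<close>
  define t where "t = d / (2 * (norm v + norm w + 1))"
  have nn: "norm v + norm w + 1 > 0" by (simp add: add_nonneg_pos)
  have t: "t > 0" using d d3 nn by (simp add: t_def d_def)
  have near: "dist (x + a *\<^sub>R v + b *\<^sub>R w) x < d" if "0 \<le> a" "a \<le> t" "0 \<le> b" "b \<le> t" for a b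
  proof -
    have "dist (x + a *\<^sub>R v + b *\<^sub>R w) x = norm (a *\<^sub>R v + b *\<^sub>R w)" by (simp add: dist_norm)
    also have "\<dots> \<le> a * norm v + b * norm w"
      using norm_triangle_ineq[of "a *\<^sub>R v" "b *\<^sub>R w"] that by simp
    also have "\<dots> \<le> t * norm v + t * norm w"
      using that by (intro add_mono mult_right_mono) auto
    also have "\<dots> < t * (2 * (norm v + norm w + 1))"
      using t by (simp add: algebra_simps add_pos_nonneg add_strict_increasing2)
    also have "\<dots> = d" using nn by (simp add: t_def)
    finally show ?thesis .
  qed
  have inS: "x + a *\<^sub>R v + b *\<^sub>R w \<in> S" "x + a *\<^sub>R w + b *\<^sub>R v \<in> S"
    if "0 \<le> a" "a \<le> t" "0 \<le> b" "b \<le> t" for a b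
    using near[of a b] near[of b a] that d3(2) by (auto simp: d_def dist_commute subset_iff add.commute add.left_commute)
  obtain a b where ab: "0 < a" "a < t" "0 < b" "b < t"
    "f (x + t *\<^sub>R v + t *\<^sub>R w) - f (x + t *\<^sub>R v) - f (x + t *\<^sub>R w) + f x = t * t * ?A (x + a *\<^sub>R v + b *\<^sub>R w)"
    using second_difference_mean_value[OF t assms(2), of x v w] inS(1) by blast
  obtain a' b' where ab': "0 < a'" "a' < t" "0 < b'" "b' < t"
    "f (x + t *\<^sub>R w + t *\<^sub>R v) - f (x + t *\<^sub>R w) - f (x + t *\<^sub>R v) + f x = t * t * ?B (x + a' *\<^sub>R w + b' *\<^sub>R v)"
    using second_difference_mean_value[OF t assms(2), of x w v] inS(2) by blast
  have "x + t *\<^sub>R w + t *\<^sub>R v = x + t *\<^sub>R v + t *\<^sub>R w" "x + a' *\<^sub>R w + b' *\<^sub>R v = x + b' *\<^sub>R v + a' *\<^sub>R w"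
    by simp_all
  note ab'(5)[unfolded this]
  with ab(5) have "t * t * ?A (x + a *\<^sub>R v + b *\<^sub>R w) = t * t * ?B (x + b' *\<^sub>R v + a' *\<^sub>R w)"
    by linarith
  then have eq: "?A (x + a *\<^sub>R v + b *\<^sub>R w) = ?B (x + b' *\<^sub>R v + a' *\<^sub>R w)"
    using t by (metis mult_cancel_left mult_eq_0_iff less_irrefl)
  have "dist (?A (x + a *\<^sub>R v + b *\<^sub>R w)) (?A x) < e"
    using d(3) near[of a b] ab by (simp add: d_def)
  moreover have "dist (?B (x + b' *\<^sub>R v + a' *\<^sub>R w)) (?B x) < e"
    using d(4) near[of b' a'] ab' by (simp add: d_def)
  ultimately show False
    using dist_triangle_half_r[of "?B (x + b' *\<^sub>R v + a' *\<^sub>R w)" "?A x" "2 * e" "?B x"] eq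
    by (simp add: dist_real_def e_def)
qed

lemma fder_symmetric:
  fixes f :: "'a::real_normed_vector \<Rightarrow> 'b::euclidean_space"
  assumes "open S" "smooth_on S f" "x \<in> S"
  shows "fder (\<lambda>y. fder f y v) x w = fder (\<lambda>y. fder f y w) x v"
proof (rule euclidean_eqI)
  fix b :: 'b assume "b \<in> Basis"
  have inn: "fder (\<lambda>y. g y \<bullet> b) y h = fder g y h \<bullet> b" if "smooth_on S g" "y \<in> S" for g :: "'a \<Rightarrow> 'b" and y h
    using fder_eq[OF bounded_linear.has_derivative[OF bounded_linear_inner_left[of b] smooth_on_has_derivative[OF that]]]
    by simp
  have "fder (\<lambda>y. fder (\<lambda>y. f y \<bullet> b) y v) x w = fder (\<lambda>y. fder f y v) x w \<bullet> b" for v w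
    using inn[OF smooth_on_fder[OF assms(2)] assms(3)] inn[OF assms(2)]
      fder_cong_open[OF assms(1,3), of "\<lambda>y. fder (\<lambda>y. f y \<bullet> b) y v" "\<lambda>y. fder f y v \<bullet> b"] by simp
  then show "fder (\<lambda>y. fder f y v) x w \<bullet> b = fder (\<lambda>y. fder f y w) x v \<bullet> b"
    using fder_symmetric_real[OF assms(1) smooth_on_linear_compose[OF bounded_linear_inner_left[of b] assms(1,2)] assms(3), of v w]
    by simp
qed

text \<open>A product rule for a moving linear map evaluated at a moving vector; expanding over
  \<open>Basis\<close> separates the two effects. The first term is the second derivative of f, the
  part that has to cancel in a bracket.\<close>

lemma fder_fder_apply:
  fixes f :: "'a::euclidean_space \<Rightarrow> 'b::real_normed_vector"
  assumes "open S" "smooth_on S f" "x \<in> S" "Y differentiable (at x)"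
  shows "fder (\<lambda>y. fder f y (Y y)) x w = fder (\<lambda>y. fder f y (Y x)) x w + fder f x (fder Y x w)"
proof -
  have "((\<lambda>y. \<Sum>b\<in>Basis. (Y y \<bullet> b) *\<^sub>R fder f y b) has_derivative
      (\<lambda>w. \<Sum>b\<in>Basis. (Y x \<bullet> b) *\<^sub>R fder (\<lambda>y. fder f y b) x w + (fder Y x w \<bullet> b) *\<^sub>R fder f x b)) (at x)"
    by (intro has_derivative_sum has_derivative_scaleR has_derivative_inner_left
        has_derivative_fder assms(4) smooth_on_has_derivative[OF smooth_on_fder[OF assms(2)] assms(3)])
  from fder_eq[OF this]
  have "fder (\<lambda>y. \<Sum>b\<in>Basis. (Y y \<bullet> b) *\<^sub>R fder f y b) x w =
     (\<Sum>b\<in>Basis. (Y x \<bullet> b) *\<^sub>R fder (\<lambda>y. fder f y b) x w + (fder Y x w \<bullet> b) *\<^sub>R fder f x b)"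
    by simp
  moreover have *: "fder f y v = (\<Sum>b\<in>Basis. (v \<bullet> b) *\<^sub>R fder f y b)" if "y \<in> S" for y v
    using smooth_on_linear_fder[OF assms(2) that] by (rule linear_eq_sum_Basis)
  ultimately have 1: "fder (\<lambda>y. fder f y (Y y)) x w =
     (\<Sum>b\<in>Basis. (Y x \<bullet> b) *\<^sub>R fder (\<lambda>y. fder f y b) x w) + fder f x (fder Y x w)"
    using fder_cong_open[OF assms(1,3), of "\<lambda>y. fder f y (Y y)" "\<lambda>y. \<Sum>b\<in>Basis. (Y y \<bullet> b) *\<^sub>R fder f y b"]
      *[OF assms(3), of "fder Y x w"] by (simp add: sum.distrib)
  have "((\<lambda>y. \<Sum>b\<in>Basis. (Y x \<bullet> b) *\<^sub>R fder f y b) has_derivative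
      (\<lambda>w. \<Sum>b\<in>Basis. (Y x \<bullet> b) *\<^sub>R fder (\<lambda>y. fder f y b) x w)) (at x)"
    by (intro has_derivative_sum has_derivative_scaleR_right
        smooth_on_has_derivative[OF smooth_on_fder[OF assms(2)] assms(3)])
  from fder_eq[OF this]
  have "fder (\<lambda>y. fder f y (Y x)) x w = (\<Sum>b\<in>Basis. (Y x \<bullet> b) *\<^sub>R fder (\<lambda>y. fder f y b) x w)"
    using fder_cong_open[OF assms(1,3), of "\<lambda>y. fder f y (Y x)" "\<lambda>y. \<Sum>b\<in>Basis. (Y x \<bullet> b) *\<^sub>R fder f y b"]
      *[of _ "Y x"] by simp
  with 1 show ?thesis by simp
qed

text \<open>The second derivative of \<open>\<tau>\<close> drops out of the difference because it is symmetric.\<close>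

lemma related_bracket:
  fixes \<tau> :: "'a::euclidean_space \<Rightarrow> 'b::euclidean_space"
  assumes "open S" "smooth_on S \<tau>" "u \<in> S"
    and X: "X differentiable (at u)" and Y: "Y differentiable (at u)"
    and A: "A differentiable (at (\<tau> u))" and B: "B differentiable (at (\<tau> u))"
    and rel: "\<And>y. y \<in> S \<Longrightarrow> A (\<tau> y) = fder \<tau> y (X y)" "\<And>y. y \<in> S \<Longrightarrow> B (\<tau> y) = fder \<tau> y (Y y)"
  shows "fder B (\<tau> u) (A (\<tau> u)) - fder A (\<tau> u) (B (\<tau> u)) = fder \<tau> u (fder Y u (X u) - fder X u (Y u))"
proof -
  have main: "fder B (\<tau> u) (A (\<tau> u)) = fder (\<lambda>y. fder \<tau> y (Y u)) u (X u) + fder \<tau> u (fder Y u (X u))"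
    if "Y differentiable (at u)" "B differentiable (at (\<tau> u))"
      "\<And>y. y \<in> S \<Longrightarrow> A (\<tau> y) = fder \<tau> y (X y)" "\<And>y. y \<in> S \<Longrightarrow> B (\<tau> y) = fder \<tau> y (Y y)" for A B X Y
  proof -
    have "fder (\<lambda>y. B (\<tau> y)) u = (\<lambda>h. fder B (\<tau> u) (fder \<tau> u h))"
      using that by (intro fder_eq has_derivative_compose[where f=\<tau> and g=B] has_derivative_fder
        smooth_on_differentiable[OF assms(2,3)])
    then have "fder B (\<tau> u) (A (\<tau> u)) = fder (\<lambda>y. B (\<tau> y)) u (X u)"
      using that(3)[OF assms(3)] by simp
    also have "\<dots> = fder (\<lambda>y. fder \<tau> y (Y y)) u (X u)"
      using fder_cong_open[OF assms(1,3), of "\<lambda>y. B (\<tau> y)" "\<lambda>y. fder \<tau> y (Y y)"] that(4) by simp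
    also have "\<dots> = fder (\<lambda>y. fder \<tau> y (Y u)) u (X u) + fder \<tau> u (fder Y u (X u))"
      using fder_fder_apply[OF assms(1-3) that(1)] by simp
    finally show ?thesis .
  qed
  show ?thesis
    using main[OF Y B rel] main[OF X A rel(2) rel(1)] fder_symmetric[OF assms(1-3), of "Y u" "X u"]
      linear_diff[OF smooth_on_linear_fder[OF assms(2,3)]] by simp
qed

section \<open>Manifolds covered by SU(2)\<close>

lemma SU2_norm: "h \<in> SU2 \<longleftrightarrow> norm h = 1"
  by (cases h) (simp add: SU2_def norm_Pair real_sqrt_eq_1_iff)

text \<open>\<open>s\<close> lifts the inverse of the chart \<open>c\<close> along \<open>\<rho>\<close>, and the chart has locally a smooth
  extension \<open>f\<close> to the ambient space.\<close>

definition lift :: "(C2 \<Rightarrow> 'a) \<Rightarrow> ('a, real^3) chart \<Rightarrow> (real^3 \<Rightarrow> C2) \<Rightarrow> bool" where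
  "lift \<rho> c s \<longleftrightarrow> open (snd c ` fst c) \<and> inj_on (snd c) (fst c) \<and> smooth_on (snd c ` fst c) s \<and>
    (\<forall>u\<in>snd c ` fst c. s u \<in> SU2 \<and> \<rho> (s u) \<in> fst c \<and> snd c (\<rho> (s u)) = u \<and>
      (\<exists>W f. open W \<and> s u \<in> W \<and> smooth_on W f \<and>
        (\<forall>z\<in>W \<inter> SU2. \<rho> z \<in> fst c \<and> f z = snd c (\<rho> z) \<and> s (f z) = z)))"

lemma liftD:
  assumes "lift \<rho> c s"
  shows "open (snd c ` fst c)" "inj_on (snd c) (fst c)" "smooth_on (snd c ` fst c) s"
    and "u \<in> snd c ` fst c \<Longrightarrow> s u \<in> SU2" "u \<in> snd c ` fst c \<Longrightarrow> \<rho> (s u) \<in> fst c"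
    and "u \<in> snd c ` fst c \<Longrightarrow> snd c (\<rho> (s u)) = u"
    and "u \<in> snd c ` fst c \<Longrightarrow> inv_into (fst c) (snd c) u = \<rho> (s u)"
proof -
  show *: "open (snd c ` fst c)" "inj_on (snd c) (fst c)" "smooth_on (snd c ` fst c) s"
    "u \<in> snd c ` fst c \<Longrightarrow> s u \<in> SU2" "u \<in> snd c ` fst c \<Longrightarrow> \<rho> (s u) \<in> fst c"
    "u \<in> snd c ` fst c \<Longrightarrow> snd c (\<rho> (s u)) = u" for u
    using assms unfolding lift_def by auto
  show "inv_into (fst c) (snd c) u = \<rho> (s u)" if "u \<in> snd c ` fst c"
    using inv_into_f_f[OF *(2) *(5)[OF that]] *(6)[OF that] by simp
qed

lemma lift_extension:
  assumes "lift \<rho> c s" "u \<in> snd c ` fst c"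
  obtains W f where "open W" "s u \<in> W" "smooth_on W f"
    "\<forall>z\<in>W \<inter> SU2. \<rho> z \<in> fst c \<and> f z = snd c (\<rho> z) \<and> s (f z) = z"
  using assms unfolding lift_def by blast

lemma open_lift_vimage:
  assumes "lift \<rho> c s" "open W" shows "open {u \<in> snd c ` fst c. s u \<in> W}"
  using continuous_open_preimage[OF smooth_on_continuous_on[OF liftD(3)] liftD(1) assms(2), OF assms(1) assms(1)]
  by (simp add: vimage_def Int_def)

text \<open>The equation \<open>t w = s u\<close> puts both lifts through the same point of the
  sphere. Near it the chart d has an ambient extension f, and
  \<open>snd d \<circ> \<sigma> \<circ> s\<close> agrees with the smooth map
  \<open>f \<circ> s\<close>. Two projections are allowed in order to serve chart changes and maps
  between manifolds at once.\<close>

lemma lift_transition: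
  assumes s: "lift \<rho> c s" and t: "lift \<sigma> d t"
    and u: "u \<in> snd c ` fst c" and w: "w \<in> snd d ` fst d" and eq: "t w = s u"
  obtains T where "open T" "u \<in> T" "T \<subseteq> snd c ` fst c" "smooth_on T (\<lambda>u. snd d (\<sigma> (s u)))"
    "snd d (\<sigma> (s u)) = w" "\<forall>u\<in>T. \<sigma> (s u) \<in> fst d \<and> t (snd d (\<sigma> (s u))) = s u"
proof -
  obtain W f where W: "open W" "t w \<in> W" "smooth_on W f"
    "\<forall>z\<in>W \<inter> SU2. \<sigma> z \<in> fst d \<and> f z = snd d (\<sigma> z) \<and> t (f z) = z"
    by (rule lift_extension[OF t w])
  define T where "T = {u \<in> snd c ` fst c. s u \<in> W}"
  have T: "open T" "u \<in> T" "T \<subseteq> snd c ` fst c"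
    using open_lift_vimage[OF s W(1)] u W(2) eq by (auto simp: T_def)
  have fs: "\<sigma> (s u) \<in> fst d \<and> f (s u) = snd d (\<sigma> (s u)) \<and> t (f (s u)) = s u" if "u \<in> T" for u
    using bspec[OF W(4), of "s u"] liftD(4)[OF s, of u] that by (auto simp: T_def)
  have "smooth_on T (\<lambda>u. f (s u))"
    by (rule smooth_on_compose[OF T(1) W(1) smooth_on_subset[OF liftD(3)[OF s] T(3)] W(3)]) (auto simp: T_def)
  then have "smooth_on T (\<lambda>u. snd d (\<sigma> (s u)))"
    using smooth_on_cong[OF T(1), of "\<lambda>u. f (s u)" "\<lambda>u. snd d (\<sigma> (s u))"] fs by blast
  moreover have "snd d (\<sigma> (s u)) = w"
    using liftD(6)[OF t w] eq by simp
  moreover have "\<forall>u\<in>T. \<sigma> (s u) \<in> fst d \<and> t (snd d (\<sigma> (s u))) = s u"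
    by (intro ballI) (use fs in metis)
  ultimately show thesis by (rule that[OF T])
qed

text \<open>Near u the chart change followed by t is s, so the chain rule applies. This is why the
  ambient vector of a tangent vector does not depend on the chart.\<close>

lemma lift_fder_transition:
  assumes s: "lift \<rho> c s" and t: "lift \<sigma> d t"
    and u: "u \<in> snd c ` fst c" and w: "w \<in> snd d ` fst d" and eq: "t w = s u"
  shows "fder t w (fder (\<lambda>u. snd d (\<sigma> (s u))) u a) = fder s u a"
proof -
  obtain T where T: "open T" "u \<in> T" "T \<subseteq> snd c ` fst c" "smooth_on T (\<lambda>u. snd d (\<sigma> (s u)))"
    "snd d (\<sigma> (s u)) = w" "\<forall>u\<in>T. \<sigma> (s u) \<in> fst d \<and> t (snd d (\<sigma> (s u))) = s u"
    by (rule lift_transition[OF assms])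
  have "((\<lambda>u. t (snd d (\<sigma> (s u)))) has_derivative (\<lambda>a. fder t w (fder (\<lambda>u. snd d (\<sigma> (s u))) u a))) (at u)"
    using has_derivative_compose[OF smooth_on_has_derivative[OF T(4,2)], of t]
      smooth_on_has_derivative[OF liftD(3)[OF t] w] T(5) by simp
  from fder_eq[OF this] show ?thesis
    using fder_cong_open[OF T(1,2), of "\<lambda>u. t (snd d (\<sigma> (s u)))" s] T(6) by simp
qed

text \<open>The ambient extension f of the chart satisfies \<open>f (s v) = v\<close> near u;
  differentiate. As this holds on a whole neighbourhood with one smooth f, it later recovers
  coordinate fields from ambient ones.\<close>

lemma lift_left_inverse:
  assumes s: "lift \<rho> c s" and u: "u \<in> snd c ` fst c"
  obtains W f T where "open W" "smooth_on W f" "open T" "u \<in> T" "T \<subseteq> snd c ` fst c"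
    "\<forall>v\<in>T. s v \<in> W" "\<forall>v\<in>T. \<forall>a. fder f (s v) (fder s v a) = a"
proof -
  obtain W f where W: "open W" "s u \<in> W" "smooth_on W f"
    "\<forall>z\<in>W \<inter> SU2. \<rho> z \<in> fst c \<and> f z = snd c (\<rho> z) \<and> s (f z) = z"
    by (rule lift_extension[OF s u])
  define T where "T = {u \<in> snd c ` fst c. s u \<in> W}"
  have T: "open T" "u \<in> T" "T \<subseteq> snd c ` fst c"
    using open_lift_vimage[OF s W(1)] u W(2) by (auto simp: T_def)
  have "f (s v) = v" if "v \<in> T" for v
    using W(4) liftD(4,6)[OF s] that by (auto simp: T_def)
  note eq = fder_cong_open[OF T(1) _ this]
  have "fder f (s v) (fder s v a) = a" if v: "v \<in> T" for v a
  proof -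
    have "s v \<in> W" "v \<in> snd c ` fst c" using v by (auto simp: T_def)
    then have "((\<lambda>u. f (s u)) has_derivative (\<lambda>a. fder f (s v) (fder s v a))) (at v)"
      by (intro has_derivative_compose[where f=s and g=f] smooth_on_has_derivative[OF W(3)]
          smooth_on_has_derivative[OF liftD(3)[OF s]])
    from fder_eq[OF this] show ?thesis using eq[OF v, of "\<lambda>x. x"] by (simp add: fun_eq_iff)
  qed
  then show thesis by (intro that[OF W(1,3) T]) (auto simp: T_def)
qed

lemma lift_fder_linear: "lift \<rho> c s \<Longrightarrow> u \<in> snd c ` fst c \<Longrightarrow> linear (fder s u)"
  by (rule smooth_on_linear_fder[OF liftD(3)])

lemma lift_fder_inj:
  assumes "lift \<rho> c s" "u \<in> snd c ` fst c" shows "inj (fder s u)"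
proof (rule lift_left_inverse[OF assms])
  fix W f T
  assume "u \<in> T" "\<forall>v\<in>T. \<forall>a. fder f (s v) (fder s v a) = a"
  then show ?thesis by (intro inj_on_inverseI[where g="fder f (s u)"]) blast
qed

text \<open>Differentiate \<open>s u \<bullet> s u = 1\<close>, valid because s maps into the unit
  sphere.\<close>

lemma lift_fder_orthogonal:
  assumes s: "lift \<rho> c s" and u: "u \<in> snd c ` fst c"
  shows "fder s u a \<bullet> s u = 0"
proof -
  note hd = smooth_on_has_derivative[OF liftD(3)[OF s] u]
  have "fder (\<lambda>u. s u \<bullet> s u) u = (\<lambda>a. s u \<bullet> fder s u a + fder s u a \<bullet> s u)"
    by (rule fder_eq[OF has_derivative_inner[OF hd hd]])
  moreover have "s v \<bullet> s v = 1" if "v \<in> snd c ` fst c" for v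
    using liftD(4)[OF s that] by (simp add: SU2_norm dot_square_norm)
  then have "fder (\<lambda>u. s u \<bullet> s u) u = fder (\<lambda>u. 1) u"
    using fder_cong_open[OF liftD(1)[OF s] u, of "\<lambda>u. s u \<bullet> s u" "\<lambda>u. 1"] by simp
  ultimately show ?thesis by (simp add: fun_eq_iff inner_commute)
qed

text \<open>An injective linear image of the three-dimensional coordinate space inside the
  three-dimensional orthogonal complement of \<open>s u\<close> is all of it.\<close>

lemma lift_fder_surj:
  assumes s: "lift \<rho> c s" and u: "u \<in> snd c ` fst c" and A: "A \<bullet> s u = 0"
  obtains a where "fder s u a = A"
proof -
  have "range (fder s u) = {A. s u \<bullet> A = 0}"
  proof (rule subspace_dim_equal)
    have "s u \<noteq> 0" using liftD(4)[OF s u] SU2_norm[of "s u"] by auto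
    then show "dim {A. s u \<bullet> A = 0} \<le> dim (range (fder s u))"
      using dim_hyperplane[of "s u"]
        dim_image_eq[OF lift_fder_linear[OF s u], of UNIV] lift_fder_inj[OF s u]
      by simp
    show "range (fder s u) \<subseteq> {A. s u \<bullet> A = 0}"
      using lift_fder_orthogonal[OF s u] by (auto simp: inner_commute)
    show "subspace (range (fder s u))"
      using linear_subspace_image[OF lift_fder_linear[OF s u] subspace_UNIV] .
  qed (rule subspace_hyperplane)
  then have "A \<in> range (fder s u)" using A by (simp add: inner_commute)
  then show thesis using that by auto
qed

text \<open>\<open>openin_M\<close> is the quotient topology, and \<open>lift_exists\<close>
  provides a lift through every prescribed point over the chart, that is, on every sheet of the
  covering \<open>\<rho>\<close>.\<close>

locale covered_manifold =
  fixes M :: "('a, real^3) manifold" and \<rho> :: "C2 \<Rightarrow> 'a"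
  assumes openin_M: "openin (mtop M) V \<longleftrightarrow> V \<subseteq> \<rho> ` SU2 \<and> openin (top_of_set SU2) {x \<in> SU2. \<rho> x \<in> V}"
    and openin_chart: "c \<in> charts M \<Longrightarrow> openin (mtop M) (fst c)"
    and lift_exists: "\<lbrakk>c \<in> charts M; h \<in> SU2; \<rho> h \<in> fst c\<rbrakk> \<Longrightarrow> \<exists>s. lift \<rho> c s \<and> s (snd c (\<rho> h)) = h"
    and chart_exists: "h \<in> SU2 \<Longrightarrow> \<exists>c\<in>charts M. \<rho> h \<in> fst c"
begin

lemma topspace_M: "topspace (mtop M) = \<rho> ` SU2"
proof -
  have "{x \<in> SU2. \<rho> x \<in> \<rho> ` SU2} = SU2" by auto
  then have "openin (mtop M) (\<rho> ` SU2)" by (simp add: openin_M)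
  moreover have "topspace (mtop M) \<subseteq> \<rho> ` SU2"
    using openin_topspace[of "mtop M"] openin_M by blast
  ultimately show ?thesis using openin_subset by blast
qed

lemma chart_point_lift:
  assumes c: "c \<in> charts M" and x: "x \<in> fst c"
  obtains h s where "h \<in> SU2" "\<rho> h = x" "lift \<rho> c s" "s (snd c x) = h"
proof -
  have "x \<in> \<rho> ` SU2" using openin_chart[OF c] openin_M x by blast
  then show thesis using that lift_exists[OF c] x by blast
qed

lemma chart_nhd:
  assumes U: "openin (mtop M) U" and s: "lift \<rho> c s" and u: "u \<in> snd c ` fst c" "\<rho> (s u) \<in> U"
  obtains T where "open T" "u \<in> T" "T \<subseteq> snd c ` (U \<inter> fst c)" "T \<subseteq> snd c ` fst c" "\<forall>v\<in>T. \<rho> (s v) \<in> U"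
proof -
  have "openin (top_of_set SU2) {x \<in> SU2. \<rho> x \<in> U}" using U by (simp add: openin_M)
  then obtain Q where Q: "open Q" "{x \<in> SU2. \<rho> x \<in> U} = SU2 \<inter> Q"
    unfolding openin_open by blast
  let ?T = "{u \<in> snd c ` fst c. s u \<in> Q}"
  have *: "\<rho> (s v) \<in> U" if "v \<in> ?T" for v using Q(2) liftD(4)[OF s] that by blast
  have "v \<in> snd c ` (U \<inter> fst c)" if "v \<in> ?T" for v
    using *[OF that] liftD(5,6)[OF s, of v] that by (intro image_eqI[of v "snd c" "\<rho> (s v)"]) auto
  then show thesis
    using that[of ?T] open_lift_vimage[OF s Q(1)] Q(2) u liftD(4)[OF s] * by blast
qed

lemma open_chart_image:
  assumes c: "c \<in> charts M" and U: "openin (mtop M) U"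
  shows "open (snd c ` (U \<inter> fst c))"
proof (subst open_subopen, intro ballI)
  fix u assume "u \<in> snd c ` (U \<inter> fst c)"
  then obtain x where x: "x \<in> U" "x \<in> fst c" "u = snd c x" by blast
  obtain h s where hs: "h \<in> SU2" "\<rho> h = x" "lift \<rho> c s" "s u = h"
    using chart_point_lift[OF c x(2)] unfolding x(3) by blast
  have "u \<in> snd c ` fst c" "\<rho> (s u) \<in> U" using x hs by auto
  from chart_nhd[OF U hs(3) this] show "\<exists>T. open T \<and> u \<in> T \<and> T \<subseteq> snd c ` (U \<inter> fst c)"
    by metis
qed

lemma inv_into_chart:
  assumes c: "c \<in> charts M" and x: "x \<in> fst c"
  shows "inv_into (fst c) (snd c) (snd c x) = x"
proof -
  obtain h s where "h \<in> SU2" "\<rho> h = x" and s: "lift \<rho> c s" and "s (snd c x) = h"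
    by (rule chart_point_lift[OF assms])
  show ?thesis by (rule inv_into_f_f[OF liftD(2)[OF s] x])
qed

text \<open>A chart change is \<open>snd d \<circ> \<rho> \<circ> s\<close> for a lift s of c
  through some h; taking the lift of d through the same h makes \<open>lift_transition\<close>
  applicable.\<close>

lemma transition_smooth:
  assumes c: "c \<in> charts M" and d: "d \<in> charts M"
  shows "smooth_on (snd c ` (fst c \<inter> fst d)) (in_chart (snd d) c)"
proof (rule smooth_on_local)
  fix u assume "u \<in> snd c ` (fst c \<inter> fst d)"
  then obtain x where x: "x \<in> fst c" "x \<in> fst d" "u = snd c x" by blast
  obtain h s where hs: "h \<in> SU2" "\<rho> h = x" "lift \<rho> c s" "s u = h"
    using chart_point_lift[OF c x(1)] unfolding x(3) by blast
  obtain t where t: "lift \<rho> d t" "t (snd d x) = h"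
    using lift_exists[OF d hs(1)] x(2) unfolding hs(2) by blast
  obtain T where T: "open T" "u \<in> T" "T \<subseteq> snd c ` fst c" "smooth_on T (\<lambda>u. snd d (\<rho> (s u)))"
    by (rule lift_transition[OF hs(3) t(1), of u "snd d x"]) (use x hs(4) t(2) in auto)
  have "in_chart (snd d) c v = snd d (\<rho> (s v))" if "v \<in> T" for v
    using liftD(7)[OF hs(3), of v] T(3) that by (auto simp: in_chart_def)
  then show "\<exists>T. open T \<and> u \<in> T \<and> smooth_on T (in_chart (snd d) c)"
    using T smooth_on_cong[OF T(1), of "in_chart (snd d) c" "\<lambda>u. snd d (\<rho> (s u))"] by blast
qed

subsection \<open>Tangent vectors as ambient vectors\<close>

text \<open>The inverse of the differential of \<open>\<rho>\<close> at h, read in C^2. It depends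
  on h and not just on \<open>\<rho> h\<close>: a tangent vector has one ambient vector per
  preimage. By \<open>emb_eq\<close> the two choices do not affect the value on tangent
  vectors.\<close>

definition emb :: "C2 \<Rightarrow> ('a, real^3) tvec \<Rightarrow> C2" where
  "emb h v = (let c = (SOME c. c \<in> charts_at M (\<rho> h));
                  s = (SOME s. lift \<rho> c s \<and> s (snd c (\<rho> h)) = h)
              in fder s (snd c (\<rho> h)) (v c))"

lemma charts_atD: "c \<in> charts_at M x \<Longrightarrow> c \<in> charts M" "c \<in> charts_at M x \<Longrightarrow> x \<in> fst c"
  by (auto simp: charts_at_def)

lemma fder_in_chart:
  assumes s: "lift \<rho> c s" and u: "u \<in> snd c ` fst c"
  shows "fder (in_chart F c) u = fder (\<lambda>u. F (\<rho> (s u))) u"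
  by (rule fder_cong_open[OF liftD(1)[OF s] u]) (simp add: in_chart_def liftD(7)[OF s])

lemma some_chart:
  assumes "h \<in> SU2"
  obtains c s where "c = (SOME c. c \<in> charts_at M (\<rho> h))" "c \<in> charts_at M (\<rho> h)"
    "lift \<rho> c s" "s (snd c (\<rho> h)) = h" "\<forall>v. emb h v = fder s (snd c (\<rho> h)) (v c)"
proof -
  define c where "c = (SOME c. c \<in> charts_at M (\<rho> h))"
  define s where "s = (SOME s. lift \<rho> c s \<and> s (snd c (\<rho> h)) = h)"
  have "\<exists>c. c \<in> charts_at M (\<rho> h)" using chart_exists[OF assms(1)] by (auto simp: charts_at_def)
  then have c: "c \<in> charts_at M (\<rho> h)" unfolding c_def by (rule someI_ex)
  have "lift \<rho> c s \<and> s (snd c (\<rho> h)) = h"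
    unfolding s_def by (rule someI_ex[OF lift_exists[OF charts_atD(1)[OF c] assms(1) charts_atD(2)[OF c]]])
  moreover have "emb h v = fder s (snd c (\<rho> h)) (v c)" for v
    by (simp add: emb_def c_def[symmetric] s_def[symmetric] Let_def)
  ultimately show thesis using that[OF c_def c] by blast
qed

lemma tangent_transition:
  "\<lbrakk>v \<in> tangent_space M x; c \<in> charts_at M x; d \<in> charts_at M x\<rbrakk>
    \<Longrightarrow> v d = fder (in_chart (snd d) c) (snd c x) (v c)"
  unfolding tangent_space_def by blast

lemma tangent_zero: "\<lbrakk>v \<in> tangent_space M x; c \<notin> charts_at M x\<rbrakk> \<Longrightarrow> v c = 0"
  unfolding tangent_space_def by blast

lemma emb_eq:
  assumes h: "h \<in> SU2" and v: "v \<in> tangent_space M (\<rho> h)" and c: "c \<in> charts_at M (\<rho> h)"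
    and s: "lift \<rho> c s" "s (snd c (\<rho> h)) = h"
  shows "emb h v = fder s (snd c (\<rho> h)) (v c)"
proof -
  obtain d t where "d = (SOME c. c \<in> charts_at M (\<rho> h))" and d: "d \<in> charts_at M (\<rho> h)"
    and t: "lift \<rho> d t" "t (snd d (\<rho> h)) = h" and e: "\<forall>v. emb h v = fder t (snd d (\<rho> h)) (v d)"
    by (rule some_chart[OF h])
  have "v d = fder (in_chart (snd d) c) (snd c (\<rho> h)) (v c)"
    by (rule tangent_transition[OF v c d])
  also have "fder (in_chart (snd d) c) (snd c (\<rho> h)) = fder (\<lambda>u. snd d (\<rho> (s u))) (snd c (\<rho> h))"
    using fder_in_chart[OF s(1)] charts_atD(2)[OF c] by blast
  finally show ?thesis
    using lift_fder_transition[OF s(1) t(1), of "snd c (\<rho> h)" "snd d (\<rho> h)" "v c"]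
      charts_atD(2)[OF c] charts_atD(2)[OF d] s(2) t(2) e by simp
qed

text \<open>Coordinates that all lift to the same A are compatible: the derivative of the lift of d
  sends both \<open>v d\<close> and the transformed \<open>v c\<close> to A, and it is
  injective.\<close>

lemma tangentI:
  assumes h: "h \<in> SU2" and v0: "\<And>c. c \<notin> charts_at M (\<rho> h) \<Longrightarrow> v c = 0"
    and ex: "\<And>c. c \<in> charts_at M (\<rho> h) \<Longrightarrow>
      \<exists>s. lift \<rho> c s \<and> s (snd c (\<rho> h)) = h \<and> fder s (snd c (\<rho> h)) (v c) = A"
  shows "v \<in> tangent_space M (\<rho> h)" "emb h v = A"
proof -
  have "v d = fder (in_chart (snd d) c) (snd c (\<rho> h)) (v c)"
    if c: "c \<in> charts_at M (\<rho> h)" and d: "d \<in> charts_at M (\<rho> h)" for c d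
  proof -
    obtain s where s: "lift \<rho> c s" "s (snd c (\<rho> h)) = h" "fder s (snd c (\<rho> h)) (v c) = A" using ex[OF c] by blast
    obtain t where t: "lift \<rho> d t" "t (snd d (\<rho> h)) = h" "fder t (snd d (\<rho> h)) (v d) = A" using ex[OF d] by blast
    have "fder t (snd d (\<rho> h)) (fder (\<lambda>u. snd d (\<rho> (s u))) (snd c (\<rho> h)) (v c)) = A"
      using lift_fder_transition[OF s(1) t(1), of "snd c (\<rho> h)" "snd d (\<rho> h)" "v c"]
        charts_atD(2)[OF c] charts_atD(2)[OF d] s t by simp
    then have "v d = fder (\<lambda>u. snd d (\<rho> (s u))) (snd c (\<rho> h)) (v c)"
      using lift_fder_inj[OF t(1), of "snd d (\<rho> h)"] charts_atD(2)[OF d] t(3) by (auto dest: injD)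
    then show ?thesis
      using fder_in_chart[OF s(1), of "snd c (\<rho> h)" "snd d"] charts_atD(2)[OF c] by simp
  qed
  then show v: "v \<in> tangent_space M (\<rho> h)" using v0 unfolding tangent_space_def by blast
  obtain c where c: "c \<in> charts_at M (\<rho> h)" using some_chart[OF h] by blast
  show "emb h v = A" using ex[OF c] emb_eq[OF h v c] by blast
qed

lemma subspace_tangent:
  assumes h: "h \<in> SU2" shows "subspace (tangent_space M (\<rho> h))"
proof -
  have lin: "linear (fder (in_chart (snd d) c) (snd c (\<rho> h)))"
    if "c \<in> charts_at M (\<rho> h)" "d \<in> charts_at M (\<rho> h)" for c d
  proof (rule smooth_on_linear_fder)
    show "smooth_on (snd c ` (fst c \<inter> fst d)) (in_chart (snd d) c)"
      using that by (intro transition_smooth charts_atD(1))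
    show "snd c (\<rho> h) \<in> snd c ` (fst c \<inter> fst d)"
      using that by (intro imageI IntI charts_atD(2))
  qed
  show ?thesis
  proof (rule subspaceI)
    show "0 \<in> tangent_space M (\<rho> h)"
      unfolding tangent_space_def
    proof (intro CollectI conjI allI ballI impI)
      fix c d assume cd: "c \<in> charts_at M (\<rho> h)" "d \<in> charts_at M (\<rho> h)"
      show "0 d = fder (in_chart (snd d) c) (snd c (\<rho> h)) (0 c)"
        using linear_0[OF lin[OF cd]] by simp
    qed simp
    show "v + w \<in> tangent_space M (\<rho> h)"
      if "v \<in> tangent_space M (\<rho> h)" "w \<in> tangent_space M (\<rho> h)" for v w
      unfolding tangent_space_def
    proof (intro CollectI conjI allI ballI impI)
      fix c d assume cd: "c \<in> charts_at M (\<rho> h)" "d \<in> charts_at M (\<rho> h)"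
      then show "(v + w) d = fder (in_chart (snd d) c) (snd c (\<rho> h)) ((v + w) c)"
        using tangent_transition[OF that(1) cd] tangent_transition[OF that(2) cd]
          linear_add[OF lin[OF cd], of "v c" "w c"] by simp
    qed (use tangent_zero[OF that(1)] tangent_zero[OF that(2)] in simp)
    show "r *\<^sub>R v \<in> tangent_space M (\<rho> h)" if "v \<in> tangent_space M (\<rho> h)" for r v
      unfolding tangent_space_def
    proof (intro CollectI conjI allI ballI impI)
      fix c d assume cd: "c \<in> charts_at M (\<rho> h)" "d \<in> charts_at M (\<rho> h)"
      then show "(r *\<^sub>R v) d = fder (in_chart (snd d) c) (snd c (\<rho> h)) ((r *\<^sub>R v) c)"
        using tangent_transition[OF that cd] linear_scale[OF lin[OF cd], of r "v c"] by (simp add: scaleR_fun_def)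
    qed (use tangent_zero[OF that] in \<open>simp add: scaleR_fun_def\<close>)
  qed
qed

lemma linear_emb: "h \<in> SU2 \<Longrightarrow> linear (emb h)"
proof -
  assume h: "h \<in> SU2"
  obtain c s where c: "c = (SOME c. c \<in> charts_at M (\<rho> h))" "c \<in> charts_at M (\<rho> h)"
    and s: "lift \<rho> c s" "s (snd c (\<rho> h)) = h" and e: "\<forall>v. emb h v = fder s (snd c (\<rho> h)) (v c)"
    by (rule some_chart[OF h])
  have lin: "linear (fder s (snd c (\<rho> h)))" using lift_fder_linear[OF s(1)] charts_atD(2)[OF c(2)] by blast
  show ?thesis
    by (rule linearI) (simp_all add: e scaleR_fun_def linear_add[OF lin] linear_scale[OF lin])
qed

lemma emb_orthogonal:
  assumes h: "h \<in> SU2" shows "emb h v \<bullet> h = 0"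
proof -
  obtain c s where "c = (SOME c. c \<in> charts_at M (\<rho> h))" and c: "c \<in> charts_at M (\<rho> h)"
    and s: "lift \<rho> c s" "s (snd c (\<rho> h)) = h" and e: "\<forall>v. emb h v = fder s (snd c (\<rho> h)) (v c)"
    by (rule some_chart[OF h])
  show ?thesis
    using lift_fder_orthogonal[OF s(1) imageI[OF charts_atD(2)[OF c]], of "v c"] s(2) e by simp
qed

text \<open>Each chart around the point has a lift through h with injective derivative, so every
  coordinate of v is recovered from A. With \<open>emb_surj\<close> this identifies the tangent
  space with the orthogonal complement of h.\<close>

lemma emb_inj:
  assumes h: "h \<in> SU2" and v: "v \<in> tangent_space M (\<rho> h)" and w: "w \<in> tangent_space M (\<rho> h)"
    and eq: "emb h v = emb h w"
  shows "v = w"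
proof
  fix c
  show "v c = w c"
  proof (cases "c \<in> charts_at M (\<rho> h)")
    case True
    then obtain s where s: "lift \<rho> c s" "s (snd c (\<rho> h)) = h"
      using lift_exists[OF charts_atD(1)[OF True] h charts_atD(2)[OF True]] by blast
    show ?thesis
      using emb_eq[OF h v True s] emb_eq[OF h w True s] eq
        injD[OF lift_fder_inj[OF s(1) imageI[OF charts_atD(2)[OF True]]]] by simp
  qed (use tangent_zero[OF v] tangent_zero[OF w] in simp)
qed

lemma emb_surj:
  assumes h: "h \<in> SU2" and A: "A \<bullet> h = 0"
  obtains v where "v \<in> tangent_space M (\<rho> h)" "emb h v = A"
proof -
  have "\<exists>a s. lift \<rho> c s \<and> s (snd c (\<rho> h)) = h \<and> fder s (snd c (\<rho> h)) a = A"
    if c: "c \<in> charts_at M (\<rho> h)" for c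
  proof -
    obtain s where s: "lift \<rho> c s" "s (snd c (\<rho> h)) = h"
      using lift_exists[OF charts_atD(1)[OF c] h charts_atD(2)[OF c]] by blast
    have "A \<bullet> s (snd c (\<rho> h)) = 0" using A s(2) by simp
    then obtain a where "fder s (snd c (\<rho> h)) a = A"
      by (rule lift_fder_surj[OF s(1) imageI[OF charts_atD(2)[OF c]]])
    with s show ?thesis by blast
  qed
  then have "\<forall>c\<in>charts_at M (\<rho> h). \<exists>a s. lift \<rho> c s \<and> s (snd c (\<rho> h)) = h \<and> fder s (snd c (\<rho> h)) a = A"
    by blast
  \<comment> \<open>Coordinates are chosen chart by chart; having the same ambient vector A already
    makes them compatible.\<close>
  from bchoice[OF this] obtain a where a: "\<exists>s. lift \<rho> c s \<and> s (snd c (\<rho> h)) = h \<and> fder s (snd c (\<rho> h)) (a c) = A"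
    if "c \<in> charts_at M (\<rho> h)" for c
    by blast
  let ?v = "\<lambda>c. if c \<in> charts_at M (\<rho> h) then a c else 0"
  have "?v \<in> tangent_space M (\<rho> h) \<and> emb h ?v = A"
    by (intro conjI tangentI[OF h, of ?v A]) (simp_all add: a)
  then show thesis using that by blast
qed

text \<open>Lifts take values in the sphere, so along a lift F can be replaced by the ambient G and
  the chain rule applies. The intended G is the matrix embedding.\<close>

lemma differential_emb:
  assumes h: "h \<in> SU2" and v: "v \<in> tangent_space M (\<rho> h)"
    and F: "\<And>z. z \<in> SU2 \<Longrightarrow> F (\<rho> z) = G z" and G: "G differentiable (at h)"
  shows "differential M F (\<rho> h) v = fder G h (emb h v)"
proof -
  obtain c s where c_def: "c = (SOME c. c \<in> charts_at M (\<rho> h))" and c: "c \<in> charts_at M (\<rho> h)"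
    and s: "lift \<rho> c s" "s (snd c (\<rho> h)) = h" and e: "\<forall>v. emb h v = fder s (snd c (\<rho> h)) (v c)"
    by (rule some_chart[OF h])
  let ?u = "snd c (\<rho> h)"
  have u: "?u \<in> snd c ` fst c" using charts_atD(2)[OF c] by blast
  have "((\<lambda>u. G (s u)) has_derivative (\<lambda>a. fder G h (fder s ?u a))) (at ?u)"
    using has_derivative_compose[OF smooth_on_has_derivative[OF liftD(3)[OF s(1)] u], of G] has_derivative_fder[OF G]
    by (simp add: s(2))
  from fder_eq[OF this]
  have "fder (\<lambda>u. F (\<rho> (s u))) ?u = (\<lambda>a. fder G h (fder s ?u a))"
    using fder_cong_open[OF liftD(1)[OF s(1)] u, of "\<lambda>u. F (\<rho> (s u))" "\<lambda>u. G (s u)"] F liftD(4)[OF s(1)] by simp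
  then show ?thesis
    unfolding differential_def Let_def c_def[symmetric] fder_in_chart[OF s(1) u] by (simp add: e)
qed

subsection \<open>Vector fields\<close>

lemma vf_coord_lift:
  assumes s: "lift \<rho> c s" and u: "u \<in> snd c ` fst c"
  shows "vf_coord X c u = X (\<rho> (s u)) c"
  by (simp add: vf_coord_def in_chart_def liftD(7)[OF s u])

lemma fder_lift_vf:
  assumes c: "c \<in> charts M" and s: "lift \<rho> c s" and u: "u \<in> snd c ` fst c"
    and X: "X (\<rho> (s u)) \<in> tangent_space M (\<rho> (s u))"
  shows "fder s u (vf_coord X c u) = emb (s u) (X (\<rho> (s u)))"
proof -
  have "c \<in> charts_at M (\<rho> (s u))" using c liftD(5)[OF s u] by (simp add: charts_at_def)
  from emb_eq[OF liftD(4)[OF s u] X this s] show ?thesis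
    by (simp add: liftD(6)[OF s u] vf_coord_lift[OF s u])
qed

text \<open>The coordinates of X are recovered as \<open>fder f (s v) (A (s v))\<close>, with f the
  local left inverse of the lift s, and this expression is smooth in v.\<close>

lemma smooth_vfI:
  assumes U: "openin (mtop M) U" and X: "\<And>x. x \<in> U \<Longrightarrow> X x \<in> tangent_space M x"
    and A: "smooth_on UNIV A" "\<And>h. h \<in> SU2 \<Longrightarrow> \<rho> h \<in> U \<Longrightarrow> emb h (X (\<rho> h)) = A h"
  shows "smooth_vf_on M U X"
  unfolding smooth_vf_on_def
proof (intro conjI ballI X smooth_on_local)
  fix c u assume c: "c \<in> charts M" and "u \<in> snd c ` (U \<inter> fst c)"
  then obtain x where x: "x \<in> U" "x \<in> fst c" "u = snd c x" by blast
  obtain h s where hs: "h \<in> SU2" "\<rho> h = x" "lift \<rho> c s" "s u = h"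
    using chart_point_lift[OF c x(2)] unfolding x(3) by blast
  note s = hs(3)
  have u: "u \<in> snd c ` fst c" using x by blast
  obtain W f T where T: "open W" "smooth_on W f" "open T" "u \<in> T" "T \<subseteq> snd c ` fst c"
    "\<forall>v\<in>T. s v \<in> W" "\<forall>v\<in>T. \<forall>a. fder f (s v) (fder s v a) = a"
    by (rule lift_left_inverse[OF s u])
  have "\<rho> (s u) \<in> U" using x(1) hs(2,4) by simp
  then obtain R where R: "open R" "u \<in> R" "R \<subseteq> snd c ` (U \<inter> fst c)" "R \<subseteq> snd c ` fst c"
    "\<forall>v\<in>R. \<rho> (s v) \<in> U"
    by (rule chart_nhd[OF U s u])
  have op: "open (T \<inter> R)" using T R by blast
  have sm: "smooth_on (T \<inter> R) s"
    by (rule smooth_on_subset[OF liftD(3)[OF s]]) (use T(5) in blast)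
  have "smooth_on W (\<lambda>z. fder f z (A z))"
    by (rule smooth_on_fder_apply[OF T(1,2) smooth_on_subset[OF A(1) subset_UNIV]])
  then have "smooth_on (T \<inter> R) (\<lambda>v. fder f (s v) (A (s v)))"
    by (rule smooth_on_compose[OF op T(1) sm]) (use T(6) in blast)
  moreover have "vf_coord X c v = fder f (s v) (A (s v))" if "v \<in> T \<inter> R" for v
  proof -
    have "v \<in> snd c ` fst c" using that T(5) by blast
    moreover have "\<rho> (s v) \<in> U" using R(5) that by blast
    ultimately have "fder s v (vf_coord X c v) = A (s v)"
      using fder_lift_vf[OF c s, of v X] X[of "\<rho> (s v)"] A(2)[OF liftD(4)[OF s, of v]] by simp
    moreover have "fder f (s v) (fder s v (vf_coord X c v)) = vf_coord X c v" using T(7) that by blast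
    ultimately show ?thesis by simp
  qed
  ultimately show "\<exists>T. open T \<and> u \<in> T \<and> smooth_on T (vf_coord X c)"
    using op T(4) R(2) smooth_on_cong[OF op, of "vf_coord X c" "\<lambda>v. fder f (s v) (A (s v))"] by blast
qed

lemma lie_bracket_coord:
  assumes c: "c \<in> charts M" and x: "x \<in> fst c"
  shows "lie_bracket M X Y x c = fder (vf_coord Y c) (snd c x) (vf_coord X c (snd c x))
     - fder (vf_coord X c) (snd c x) (vf_coord Y c (snd c x))"
proof -
  have "vf_coord X c (snd c x) = X x c" for X
    by (simp add: vf_coord_def in_chart_def inv_into_chart[OF assms])
  then show ?thesis using assms by (simp add: lie_bracket_def charts_at_def)
qed

text \<open>The chart change relates the two coordinate forms of each field, so
  \<open>related_bracket\<close> yields compatibility. Smoothness is read off the coordinate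
  formula.\<close>

lemma smooth_vf_lie_bracket:
  assumes U: "openin (mtop M) U" and X: "smooth_vf_on M U X" and Y: "smooth_vf_on M U Y"
  shows "smooth_vf_on M U (lie_bracket M X Y)"
  unfolding smooth_vf_on_def
proof (intro conjI ballI)
  fix x assume x: "x \<in> U"
  have "lie_bracket M X Y x d = fder (in_chart (snd d) c) (snd c x) (lie_bracket M X Y x c)"
    if cd: "c \<in> charts_at M x" "d \<in> charts_at M x" for c d
  proof -
    have c: "c \<in> charts M" "x \<in> fst c" and d: "d \<in> charts M" "x \<in> fst d"
      using cd by (auto simp: charts_at_def)
    let ?S = "snd c ` (U \<inter> fst d \<inter> fst c)" and ?\<tau> = "in_chart (snd d) c"
    have op: "open ?S"
      using open_chart_image[OF c(1) openin_Int[OF U openin_chart[OF d(1)]]] .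
    have sm: "smooth_on ?S ?\<tau>"
      by (rule smooth_on_subset[OF transition_smooth[OF c(1) d(1)]]) blast
    have u: "snd c x \<in> ?S" using x c d by blast
    have \<tau>: "?\<tau> (snd c y) = snd d y" if "y \<in> fst c" for y
      using inv_into_chart[OF c(1) that] by (simp add: in_chart_def)
    have diff: "vf_coord Z e differentiable (at (snd e x))" if "smooth_vf_on M U Z" "e \<in> charts M" "x \<in> fst e" for Z e
      using smooth_on_differentiable[of "snd e ` (U \<inter> fst e)"] that x by (auto simp: smooth_vf_on_def)
    have rel: "vf_coord Z d (?\<tau> v) = fder ?\<tau> v (vf_coord Z c v)" if Z: "smooth_vf_on M U Z" and "v \<in> ?S" for Z v
    proof -
      obtain y where y: "y \<in> U" "y \<in> fst d" "y \<in> fst c" "v = snd c y" using \<open>v \<in> ?S\<close> by blast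
      have "Z y \<in> tangent_space M y" using Z y by (simp add: smooth_vf_on_def)
      then have "Z y d = fder ?\<tau> (snd c y) (Z y c)"
        using c(1) d(1) y by (intro tangent_transition) (simp_all add: charts_at_def)
      then show ?thesis
        using y(4) \<tau>[OF y(3)] inv_into_chart[OF c(1) y(3)] inv_into_chart[OF d(1) y(2)]
        by (simp add: vf_coord_def in_chart_def)
    qed
    show ?thesis
      using related_bracket[OF op sm u diff[OF X c] diff[OF Y c] _ _ rel[OF X] rel[OF Y]]
        diff[OF X d] diff[OF Y d] \<tau>[OF c(2)] lie_bracket_coord[OF c] lie_bracket_coord[OF d] by simp
  qed
  moreover have "lie_bracket M X Y x c = 0" if "c \<notin> charts_at M x" for c
    using that by (simp add: lie_bracket_def)
  ultimately show "lie_bracket M X Y x \<in> tangent_space M x"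
    unfolding tangent_space_def by blast
next
  fix c assume c: "c \<in> charts M"
  let ?S = "snd c ` (U \<inter> fst c)"
  have op: "open ?S" by (rule open_chart_image[OF c U])
  have sX: "smooth_on ?S (vf_coord X c)" and sY: "smooth_on ?S (vf_coord Y c)"
    using X Y c by (auto simp: smooth_vf_on_def)
  have "vf_coord (lie_bracket M X Y) c u
      = fder (vf_coord Y c) u (vf_coord X c u) - fder (vf_coord X c) u (vf_coord Y c u)" if u: "u \<in> ?S" for u
  proof -
    obtain x where "x \<in> U" "x \<in> fst c" "u = snd c x" using u by blast
    then show ?thesis
      using lie_bracket_coord[OF c] inv_into_chart[OF c, of x]
      by (simp add: vf_coord_def[of "lie_bracket M X Y"] in_chart_def)
  qed
  then show "smooth_on ?S (vf_coord (lie_bracket M X Y) c)"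
    using smooth_on_cong[OF op, of "vf_coord (lie_bracket M X Y) c" "\<lambda>u. fder (vf_coord Y c) u (vf_coord X c u)
        - fder (vf_coord X c) u (vf_coord Y c u)"]
      smooth_on_diff[OF op smooth_on_fder_apply[OF op sY sX] smooth_on_fder_apply[OF op sX sY]]
    by blast
qed

text \<open>A lift s relates the coordinate fields to the ambient fields A and B, so
  \<open>related_bracket\<close> for s turns the bracket on the manifold into the ordinary bracket
  on C^2 at h.\<close>

lemma emb_lie_bracket:
  assumes U: "openin (mtop M) U" and X: "smooth_vf_on M U X" and Y: "smooth_vf_on M U Y"
    and A: "smooth_on UNIV A" "\<And>h. h \<in> SU2 \<Longrightarrow> \<rho> h \<in> U \<Longrightarrow> emb h (X (\<rho> h)) = A h"
    and B: "smooth_on UNIV B" "\<And>h. h \<in> SU2 \<Longrightarrow> \<rho> h \<in> U \<Longrightarrow> emb h (Y (\<rho> h)) = B h"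
    and h: "h \<in> SU2" "\<rho> h \<in> U"
  shows "emb h (lie_bracket M X Y (\<rho> h)) = fder B h (A h) - fder A h (B h)"
proof -
  obtain c where c: "c \<in> charts M" "\<rho> h \<in> fst c" using chart_exists[OF h(1)] by blast
  obtain s where s: "lift \<rho> c s" "s (snd c (\<rho> h)) = h" using lift_exists[OF c(1) h(1) c(2)] by blast
  let ?u = "snd c (\<rho> h)"
  have u: "?u \<in> snd c ` fst c" using c by blast
  have "\<rho> (s ?u) \<in> U" using s(2) h(2) by simp
  then obtain T where T: "open T" "?u \<in> T" "T \<subseteq> snd c ` (U \<inter> fst c)" "T \<subseteq> snd c ` fst c"
    "\<forall>v\<in>T. \<rho> (s v) \<in> U"
    by (rule chart_nhd[OF U s(1) u])
  have diff: "vf_coord Z c differentiable (at ?u)" if "smooth_vf_on M U Z" for Z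
    using smooth_on_differentiable[of "snd c ` (U \<inter> fst c)"] that c h by (auto simp: smooth_vf_on_def)
  have rel: "C (s v) = fder s v (vf_coord Z c v)"
    if "smooth_vf_on M U Z" "\<And>h. h \<in> SU2 \<Longrightarrow> \<rho> h \<in> U \<Longrightarrow> emb h (Z (\<rho> h)) = C h" "v \<in> T" for Z C v
  proof -
    have v: "v \<in> snd c ` fst c" "\<rho> (s v) \<in> U" using T(4,5) that(3) by auto
    then have "Z (\<rho> (s v)) \<in> tangent_space M (\<rho> (s v))" using that(1) by (simp add: smooth_vf_on_def)
    then show ?thesis using fder_lift_vf[OF c(1) s(1) v(1), of Z] that(2)[OF liftD(4)[OF s(1) v(1)] v(2)] by simp
  qed
  have "fder B h (A h) - fder A h (B h) = fder s ?u (lie_bracket M X Y (\<rho> h) c)"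
    using related_bracket[OF T(1) smooth_on_subset[OF liftD(3)[OF s(1)] T(4)] T(2) diff[OF X] diff[OF Y],
        of A B] smooth_on_differentiable[OF A(1)] smooth_on_differentiable[OF B(1)]
      rel[OF X A(2)] rel[OF Y B(2)] s(2) lie_bracket_coord[OF c] by simp
  moreover have "lie_bracket M X Y (\<rho> h) \<in> tangent_space M (\<rho> h)"
    using smooth_vf_lie_bracket[OF U X Y] h by (simp add: smooth_vf_on_def)
  ultimately show ?thesis using emb_eq[OF h(1) _ _ s] c by (simp add: charts_at_def)
qed

end

text \<open>With lifts through the same h on both sides, F reads
  \<open>snd d \<circ> \<sigma> \<circ> s\<close> in coordinates, and
  \<open>lift_fder_transition\<close> says that its derivative leaves the ambient vector
  unchanged.\<close>

lemma pushforward_emb: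
  assumes "covered_manifold N \<rho>" "covered_manifold M \<sigma>"
    and F: "\<And>z. z \<in> SU2 \<Longrightarrow> F (\<rho> z) = \<sigma> z"
    and h: "h \<in> SU2" and v: "v \<in> tangent_space N (\<rho> h)"
  shows "pushforward N M F (\<rho> h) v \<in> tangent_space M (\<sigma> h)"
    and "covered_manifold.emb M \<sigma> h (pushforward N M F (\<rho> h) v) = covered_manifold.emb N \<rho> h v"
proof -
  interpret N: covered_manifold N \<rho> by (rule assms(1))
  interpret M: covered_manifold M \<sigma> by (rule assms(2))
  let ?w = "pushforward N M F (\<rho> h) v"
  obtain c s where c_def: "c = (SOME c. c \<in> charts_at N (\<rho> h))" and c: "c \<in> charts_at N (\<rho> h)"
    and s: "lift \<rho> c s" "s (snd c (\<rho> h)) = h" and e: "\<forall>v. N.emb h v = fder s (snd c (\<rho> h)) (v c)"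
    by (rule N.some_chart[OF h])
  let ?u = "snd c (\<rho> h)"
  have u: "?u \<in> snd c ` fst c" using N.charts_atD(2)[OF c] by blast
  have "\<exists>t. lift \<sigma> d t \<and> t (snd d (\<sigma> h)) = h \<and> fder t (snd d (\<sigma> h)) (?w d) = N.emb h v"
    if d: "d \<in> charts_at M (\<sigma> h)" for d
  proof -
    obtain t where t: "lift \<sigma> d t" "t (snd d (\<sigma> h)) = h"
      using M.lift_exists[OF M.charts_atD(1)[OF d] h M.charts_atD(2)[OF d]] by blast
    have "?w d = fder (in_chart (snd d \<circ> F) c) ?u (v c)"
      using d F[OF h] by (simp add: pushforward_def differential_def c_def[symmetric])
    also have "fder (in_chart (snd d \<circ> F) c) ?u = fder (\<lambda>u. snd d (\<sigma> (s u))) ?u"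
      unfolding N.fder_in_chart[OF s(1) u]
      by (rule fder_cong_open[OF liftD(1)[OF s(1)] u]) (simp add: F liftD(4)[OF s(1)])
    finally show ?thesis
      using lift_fder_transition[OF s(1) t(1) u, of "snd d (\<sigma> h)" "v c"] s(2) t e M.charts_atD(2)[OF d]
      by (intro exI[of _ t]) simp
  qed
  moreover have "?w d = 0" if "d \<notin> charts_at M (\<sigma> h)" for d
    using that F[OF h] by (simp add: pushforward_def)
  ultimately have "?w \<in> tangent_space M (\<sigma> h) \<and> M.emb h ?w = N.emb h v"
    using M.tangentI[OF h, of ?w "N.emb h v"] by blast
  then show "?w \<in> tangent_space M (\<sigma> h)" "M.emb h ?w = N.emb h v" by auto
qed

context covered_manifold
begin

subsection \<open>Topology\<close>

lemma openin_chart_vimage: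
  assumes c: "c \<in> charts M" and W: "open W"
  shows "openin (mtop M) {y \<in> fst c. snd c y \<in> W}"
  unfolding openin_M
proof
  show "{y \<in> fst c. snd c y \<in> W} \<subseteq> \<rho> ` SU2"
    using openin_subset[OF openin_chart[OF c]] topspace_M by auto
  let ?S = "{x \<in> SU2. \<rho> x \<in> {y \<in> fst c. snd c y \<in> W}}"
  show "openin (top_of_set SU2) ?S"
  proof (subst openin_subopen, intro ballI)
    fix z assume "z \<in> ?S"
    then have z: "z \<in> SU2" "\<rho> z \<in> fst c" "snd c (\<rho> z) \<in> W" by auto
    obtain s where s: "lift \<rho> c s" "s (snd c (\<rho> z)) = z" using lift_exists[OF c z(1,2)] by blast
    obtain Q f where Q: "open Q" "s (snd c (\<rho> z)) \<in> Q" "smooth_on Q f"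
      "\<forall>z\<in>Q \<inter> SU2. \<rho> z \<in> fst c \<and> f z = snd c (\<rho> z) \<and> s (f z) = z"
      by (rule lift_extension[OF s(1) imageI[OF z(2)]])
    have "open (Q \<inter> f -` W)"
      by (rule continuous_open_preimage[OF smooth_on_continuous_on[OF Q(3)] Q(1) W])
    then have "openin (top_of_set SU2) (SU2 \<inter> (Q \<inter> f -` W))" by (rule openin_open_Int)
    moreover have "f z = snd c (\<rho> z)" using Q(2,4) z(1) s(2) by auto
    then have "z \<in> SU2 \<inter> (Q \<inter> f -` W)" using z Q(2) s(2) by auto
    moreover have "SU2 \<inter> (Q \<inter> f -` W) \<subseteq> ?S" using Q(4) by auto
    ultimately show "\<exists>T. openin (top_of_set SU2) T \<and> z \<in> T \<and> T \<subseteq> ?S" by blast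
  qed
qed

text \<open>Around the image of z, the points whose lift lies in Z form a neighbourhood by
  \<open>openin_chart_vimage\<close>, and each of them is the projection of its lift.\<close>

lemma openin_projection_image:
  assumes Z: "openin (top_of_set SU2) Z" shows "openin (mtop M) (\<rho> ` Z)"
proof (subst openin_subopen, intro ballI)
  fix y assume "y \<in> \<rho> ` Z"
  then obtain z where z: "z \<in> Z" "y = \<rho> z" by blast
  have zS: "z \<in> SU2" using z(1) openin_subset[OF Z] by auto
  obtain O' where O': "open O'" "Z = SU2 \<inter> O'" using Z unfolding openin_open by blast
  obtain c where c: "c \<in> charts M" "\<rho> z \<in> fst c" using chart_exists[OF zS] by blast
  obtain s where s: "lift \<rho> c s" "s (snd c (\<rho> z)) = z" using lift_exists[OF c(1) zS c(2)] by blast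
  let ?T = "{u \<in> snd c ` fst c. s u \<in> O'}"
  have "openin (mtop M) {y \<in> fst c. snd c y \<in> ?T}"
    by (rule openin_chart_vimage[OF c(1) open_lift_vimage[OF s(1) O'(1)]])
  moreover have "y \<in> {y \<in> fst c. snd c y \<in> ?T}" using z c(2) s(2) O'(2) by auto
  moreover have "{y \<in> fst c. snd c y \<in> ?T} \<subseteq> \<rho> ` Z"
  proof
    fix x assume "x \<in> {y \<in> fst c. snd c y \<in> ?T}"
    then have x: "x \<in> fst c" "s (snd c x) \<in> O'" by auto
    have "\<rho> (s (snd c x)) = x"
      using liftD(7)[OF s(1) imageI[OF x(1)]] inv_into_chart[OF c(1) x(1)] by simp
    moreover have "s (snd c x) \<in> Z" using O'(2) x(2) liftD(4)[OF s(1) imageI[OF x(1)]] by blast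
    ultimately show "x \<in> \<rho> ` Z" by force
  qed
  ultimately show "\<exists>T. openin (mtop M) T \<and> y \<in> T \<and> T \<subseteq> \<rho> ` Z" by blast
qed

lemma chart_homeomorphic:
  assumes c: "c \<in> charts M"
  shows "homeomorphic_map (subtopology (mtop M) (fst c)) (top_of_set (snd c ` fst c)) (snd c)"
proof (rule bijective_open_imp_homeomorphic_map)
  have V: "fst c \<subseteq> topspace (mtop M)" using openin_subset[OF openin_chart[OF c]] .
  then have top: "topspace (subtopology (mtop M) (fst c)) = fst c" by auto
  have op: "open (snd c ` fst c)" using open_chart_image[OF c openin_chart[OF c]] by simp
  show "continuous_map (subtopology (mtop M) (fst c)) (top_of_set (snd c ` fst c)) (snd c)"
    unfolding continuous_map_def top
  proof (intro conjI allI impI)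
    fix W assume "openin (top_of_set (snd c ` fst c)) W"
    then have "open W" using op openin_open_eq by blast
    from openin_chart_vimage[OF c this]
    show "openin (subtopology (mtop M) (fst c)) {x \<in> fst c. snd c x \<in> W}"
      unfolding openin_open_subtopology[OF openin_chart[OF c]] by blast
  qed auto
  show "open_map (subtopology (mtop M) (fst c)) (top_of_set (snd c ` fst c)) (snd c)"
    unfolding open_map_def
  proof (intro allI impI)
    fix U assume "openin (subtopology (mtop M) (fst c)) U"
    then have "openin (mtop M) U" "U \<subseteq> fst c"
      using openin_open_subtopology[OF openin_chart[OF c]] by auto
    then show "openin (top_of_set (snd c ` fst c)) (snd c ` U)"
      using open_chart_image[OF c, of U] op by (simp add: openin_open_eq image_mono Int_absorb2)
  qed
  show "snd c ` topspace (subtopology (mtop M) (fst c)) = topspace (top_of_set (snd c ` fst c))"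
    unfolding top by simp
  show "inj_on (snd c) (topspace (subtopology (mtop M) (fst c)))"
    unfolding top using inv_into_chart[OF c] by (metis inj_onI)
qed

lemma Union_charts: "\<Union> (fst ` charts M) = topspace (mtop M)"
  using openin_subset[OF openin_chart] chart_exists unfolding topspace_M by fastforce

text \<open>The projection is continuous and open, so it carries a countable basis of the sphere to
  one of the quotient.\<close>

lemma second_countable:
  "\<exists>B. countable B \<and> openin (mtop M) = arbitrary union_of (\<lambda>U. U \<in> B)"
proof -
  obtain B0 :: "C2 set set" where B0: "countable B0" "topological_basis B0"
    using ex_countable_basis by blast
  let ?B = "(\<lambda>Q. \<rho> ` (SU2 \<inter> Q)) ` B0"
  have B: "openin (mtop M) b" if "b \<in> ?B" for b
    using that B0(2) topological_basis_open by (auto intro!: openin_projection_image openin_open_Int)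
  have "openin (mtop M) V \<longleftrightarrow> (arbitrary union_of (\<lambda>U. U \<in> ?B)) V" for V
  proof
    assume V: "openin (mtop M) V"
    have "\<exists>b\<in>?B. y \<in> b \<and> b \<subseteq> V" if y: "y \<in> V" for y
    proof -
      obtain z where z: "z \<in> SU2" "y = \<rho> z" using V y openin_M by blast
      obtain Q where Q: "open Q" "{x \<in> SU2. \<rho> x \<in> V} = SU2 \<inter> Q"
        using V unfolding openin_M openin_open by blast
      have "z \<in> Q" using Q(2) z y by blast
      then obtain b where b: "b \<in> B0" "z \<in> b" "b \<subseteq> Q" using topological_basisE[OF B0(2) Q(1)] by metis
      then have "\<rho> ` (SU2 \<inter> b) \<subseteq> V" using Q(2) by blast
      then show ?thesis using b z by blast
    qed
    then have "\<Union> {b \<in> ?B. b \<subseteq> V} = V" by blast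
    then show "(arbitrary union_of (\<lambda>U. U \<in> ?B)) V"
      unfolding union_of_def arbitrary_def by (intro exI[of _ "{b \<in> ?B. b \<subseteq> V}"]) blast
  next
    assume "(arbitrary union_of (\<lambda>U. U \<in> ?B)) V"
    then show "openin (mtop M) V"
      unfolding union_of_def using B by (auto intro!: openin_Union)
  qed
  then show ?thesis using B0(1) by (intro exI[of _ ?B]) blast
qed

lemma smooth_manifoldI: "Hausdorff_space (mtop M) \<Longrightarrow> smooth_manifold M"
  unfolding smooth_manifold_def split_beta
  using second_countable Union_charts openin_chart chart_homeomorphic transition_smooth
    open_chart_image[OF _ openin_chart, of c c for c]
  by (intro conjI ballI) simp_all

end

text \<open>Having only \<open>F \<circ> \<rho> = \<sigma>\<close> on an open part Z of the sphere
  as condition on F, this covers the projection to the lens space as well as its local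
  inverses.\<close>

lemma smooth_map_onI:
  assumes "covered_manifold N \<rho>" "covered_manifold M \<sigma>"
    and Z: "openin (top_of_set SU2) Z" and F: "\<And>z. z \<in> Z \<Longrightarrow> F (\<rho> z) = \<sigma> z"
  shows "smooth_map_on N (\<rho> ` Z) M F"
  unfolding smooth_map_on_def
proof (intro conjI ballI)
  interpret N: covered_manifold N \<rho> by (rule assms(1))
  interpret M: covered_manifold M \<sigma> by (rule assms(2))
  have ZS: "Z \<subseteq> SU2" using openin_subset[OF Z] by simp
  have top: "topspace (subtopology (mtop N) (\<rho> ` Z)) = \<rho> ` Z"
    using ZS by (auto simp: N.topspace_M)
  show "continuous_map (subtopology (mtop N) (\<rho> ` Z)) (mtop M) F"
    unfolding continuous_map_def top M.topspace_M
  proof (intro conjI allI impI)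
    show "F \<in> \<rho> ` Z \<rightarrow> \<sigma> ` SU2" using F ZS by auto
    fix W assume W: "openin (mtop M) W"
    have eq: "{x \<in> \<rho> ` Z. F x \<in> W} = \<rho> ` (Z \<inter> {z \<in> SU2. \<sigma> z \<in> W})" using F ZS by auto
    have "openin (top_of_set SU2) (Z \<inter> {z \<in> SU2. \<sigma> z \<in> W})"
      using W by (intro openin_Int Z) (simp add: M.openin_M)
    then have "openin (mtop N) (\<rho> ` (Z \<inter> {z \<in> SU2. \<sigma> z \<in> W}))"
      by (rule N.openin_projection_image)
    then show "openin (subtopology (mtop N) (\<rho> ` Z)) {x \<in> \<rho> ` Z. F x \<in> W}"
      unfolding eq openin_open_subtopology[OF N.openin_projection_image[OF Z]] by blast
  qed
  fix c d assume c: "c \<in> charts N" and d: "d \<in> charts M"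
  show "smooth_on (snd c ` {x \<in> \<rho> ` Z \<inter> fst c. F x \<in> fst d}) (in_chart (snd d \<circ> F) c)"
  proof (rule smooth_on_local)
    fix u assume "u \<in> snd c ` {x \<in> \<rho> ` Z \<inter> fst c. F x \<in> fst d}"
    then obtain z where z: "z \<in> Z" "\<rho> z \<in> fst c" "F (\<rho> z) \<in> fst d" "u = snd c (\<rho> z)" by auto
    have zS: "z \<in> SU2" using z(1) ZS by blast
    obtain s where s: "lift \<rho> c s" "s u = z" using N.lift_exists[OF c zS z(2)] z(4) by blast
    have d': "\<sigma> z \<in> fst d" using F[OF z(1)] z(3) by simp
    obtain t where t: "lift \<sigma> d t" "t (snd d (\<sigma> z)) = z" using M.lift_exists[OF d zS d'] by blast
    have u: "u \<in> snd c ` fst c" using z by blast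
    have "t (snd d (\<sigma> z)) = s u" using t(2) s(2) by simp
    then obtain T where T: "open T" "u \<in> T" "T \<subseteq> snd c ` fst c" "smooth_on T (\<lambda>u. snd d (\<sigma> (s u)))"
      "snd d (\<sigma> (s u)) = snd d (\<sigma> z)" "\<forall>u\<in>T. \<sigma> (s u) \<in> fst d \<and> t (snd d (\<sigma> (s u))) = s u"
      by (rule lift_transition[OF s(1) t(1) u imageI[OF d']])
    obtain Q where Q: "open Q" "Z = SU2 \<inter> Q" using Z unfolding openin_open by blast
    let ?R = "T \<inter> {u \<in> snd c ` fst c. s u \<in> Q}"
    have R: "open ?R" using T(1) open_lift_vimage[OF s(1) Q(1)] by blast
    have uR: "u \<in> ?R" using T(2) u s(2) z(1) Q(2) by blast
    have "in_chart (snd d \<circ> F) c v = snd d (\<sigma> (s v))" if v: "v \<in> ?R" for v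
    proof -
      have "v \<in> snd c ` fst c" "s v \<in> Z" using v Q(2) liftD(4)[OF s(1), of v] by auto
      then show ?thesis using liftD(7)[OF s(1), of v] F by (simp add: in_chart_def)
    qed
    moreover have "smooth_on ?R (\<lambda>u. snd d (\<sigma> (s u)))" by (rule smooth_on_subset[OF T(4)]) blast
    ultimately have "smooth_on ?R (in_chart (snd d \<circ> F) c)"
      using smooth_on_cong[OF R, of "in_chart (snd d \<circ> F) c" "\<lambda>u. snd d (\<sigma> (s u))"] by blast
    then show "\<exists>T. open T \<and> u \<in> T \<and> smooth_on T (in_chart (snd d \<circ> F) c)" using R uR by blast
  qed
qed

section \<open>The manifold structure of SU(2)\<close>

lemma SU2_chartD:
  assumes "c \<in> charts SU2_mfd"
  shows "openin (top_of_set SU2) (fst c)" "inj_on (snd c) (fst c)" "open (snd c ` fst c)"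
    "smooth_on (snd c ` fst c) (inv_into (fst c) (snd c))"
    "x \<in> fst c \<Longrightarrow> \<exists>W f. open W \<and> x \<in> W \<and> smooth_on W f \<and> (\<forall>y\<in>W \<inter> fst c. f y = snd c y)"
  using assms by (auto simp: SU2_mfd_def submanifold_def)

lemma SU2_chartI:
  assumes "openin (top_of_set SU2) U" "inj_on \<phi> U" "open (\<phi> ` U)" "smooth_on (\<phi> ` U) (inv_into U \<phi>)"
    "\<And>x. x \<in> U \<Longrightarrow> \<exists>W f. open W \<and> x \<in> W \<and> smooth_on W f \<and> (\<forall>y\<in>W \<inter> U. f y = \<phi> y)"
  shows "(U, \<phi>) \<in> charts SU2_mfd"
  using assms by (auto simp: SU2_mfd_def submanifold_def)

text \<open>Stereographic projection from the antipode of \<open>h\<close>.\<close>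

lemma SU2_chart_exists:
  assumes h: "h \<in> SU2" shows "\<exists>c\<in>charts SU2_mfd. h \<in> fst c"
proof -
  have hh: "h \<bullet> h = 1" using h by (simp add: SU2_norm dot_square_norm)
  then have "h \<noteq> 0" by auto
  then have "dim (UNIV :: (real^3) set) = dim {x. h \<bullet> x = 0}" using dim_hyperplane[of h] by simp
  \<comment> \<open>The isometry L, with inverse g, replaces the hyperplane orthogonal to h by
    \<open>real^3\<close>, the model space of the charts.\<close>
  then obtain L :: "real^3 \<Rightarrow> C2" and g where Lg: "linear L" "linear g" "L ` UNIV = {x. h \<bullet> x = 0}"
    "g ` {x. h \<bullet> x = 0} = UNIV" "\<And>x. x \<in> UNIV \<Longrightarrow> norm (L x) = norm x"
    "\<And>x. x \<in> {x. h \<bullet> x = 0} \<Longrightarrow> norm (g x) = norm x" "\<And>x. x \<in> UNIV \<Longrightarrow> g (L x) = x"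
    "\<And>x. x \<in> {x. h \<bullet> x = 0} \<Longrightarrow> L (g x) = x"
    using isometries_subspaces[OF subspace_UNIV subspace_hyperplane[of h]] by blast
  \<comment> \<open>\<open>\<psi> u\<close> is the second point in which the line from
    \<open>- h\<close> through \<open>L u\<close> meets the sphere.\<close>
  define \<phi> where "\<phi> y = inverse (1 + y \<bullet> h) *\<^sub>R g (y - (y \<bullet> h) *\<^sub>R h)" for y
  define \<psi> where "\<psi> u = inverse (1 + u \<bullet> u) *\<^sub>R ((1 - u \<bullet> u) *\<^sub>R h + 2 *\<^sub>R L u)" for u
  let ?U = "SU2 - {- h}"
  have pos: "1 + u \<bullet> u > 0" for u :: "real^3" by (simp add: add_pos_nonneg)
  have Lh: "L u \<bullet> h = 0" for u
  proof -
    have "L u \<in> {x. h \<bullet> x = 0}" using Lg(3) by blast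
    then show ?thesis by (simp add: inner_commute)
  qed
  have LL: "L u \<bullet> L u = u \<bullet> u" for u using Lg(5)[of u] by (simp add: dot_square_norm)
  have \<psi>h: "\<psi> u \<bullet> h = (1 - u \<bullet> u) / (1 + u \<bullet> u)" for u
    by (simp add: \<psi>_def inner_add_left Lh hh divide_inverse)
  have "\<psi> u \<bullet> \<psi> u = 1" for u
  proof -
    have "\<psi> u \<bullet> \<psi> u = (inverse (1 + u \<bullet> u))\<^sup>2 * ((1 - u \<bullet> u)\<^sup>2 + 4 * (u \<bullet> u))"
      by (simp add: \<psi>_def inner_add_left inner_add_right Lh LL hh inner_commute[of h "L u"] power2_eq_square distrib_left
          mult.left_commute)
    also have "(1 - u \<bullet> u)\<^sup>2 + 4 * (u \<bullet> u) = (1 + u \<bullet> u)\<^sup>2" by (simp add: power2_eq_square algebra_simps)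
    finally show ?thesis using pos[of u] by (simp add: power_mult_distrib[symmetric])
  qed
  then have \<psi>S: "\<psi> u \<in> SU2" for u by (simp add: SU2_norm norm_eq_1)
  have t1: "1 + \<psi> u \<bullet> h = 2 / (1 + u \<bullet> u)" for u
    using pos[of u] by (simp add: \<psi>h field_simps)
  have "\<psi> u \<noteq> - h" for u
  proof
    assume "\<psi> u = - h"
    then have "1 + \<psi> u \<bullet> h = 0" by (simp add: hh)
    then show False using t1[of u] pos[of u] by simp
  qed
  then have \<psi>U: "\<psi> u \<in> ?U" for u using \<psi>S by simp
  have \<phi>\<psi>: "\<phi> (\<psi> u) = u" for u
  proof -
    have "\<psi> u - (\<psi> u \<bullet> h) *\<^sub>R h = (2 / (1 + u \<bullet> u)) *\<^sub>R L u"
      unfolding \<psi>h by (simp add: \<psi>_def divide_inverse scaleR_add_right mult.commute)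
    then have "g (\<psi> u - (\<psi> u \<bullet> h) *\<^sub>R h) = (2 / (1 + u \<bullet> u)) *\<^sub>R u"
      using linear_scale[OF Lg(2)] Lg(7) by simp
    moreover have "inverse (2 / (1 + u \<bullet> u)) * (2 / (1 + u \<bullet> u)) = 1"
      using pos[of u] by (intro left_inverse) simp
    ultimately show ?thesis unfolding \<phi>_def t1 by (simp only: scaleR_scaleR scaleR_one)
  qed
  \<comment> \<open>On the sphere
    \<open>(y + h) \<bullet> (y + h) = 2 * (1 + y \<bullet> h)\<close>, so the denominator of
    \<open>\<phi>\<close> vanishes only at the centre \<open>- h\<close>.\<close>
  have ne: "1 + y \<bullet> h \<noteq> 0" if "y \<in> ?U" for y
  proof
    assume "1 + y \<bullet> h = 0"
    moreover have "y \<bullet> y = 1" using that by (simp add: SU2_norm dot_square_norm)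
    ultimately have "(y + h) \<bullet> (y + h) = 0"
      using hh by (simp add: inner_add_left inner_add_right inner_commute[of h y])
    then show False using that by (simp add: eq_neg_iff_add_eq_0)
  qed
  have \<psi>\<phi>: "\<psi> (\<phi> y) = y" if y: "y \<in> ?U" for y
  proof -
    let ?t = "y \<bullet> h" and ?w = "y - (y \<bullet> h) *\<^sub>R h"
    have yy: "y \<bullet> y = 1" using y by (simp add: SU2_norm dot_square_norm)
    have w: "?w \<in> {x. h \<bullet> x = 0}" using hh by (simp add: inner_diff_right inner_commute[of h y])
    have ww: "?w \<bullet> ?w = 1 - ?t\<^sup>2"
      using hh yy by (simp add: inner_diff_left inner_diff_right inner_commute[of h y] power2_eq_square)
    have "g ?w \<bullet> g ?w = 1 - ?t\<^sup>2" using Lg(6)[OF w] ww by (metis dot_square_norm)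
    then have "\<phi> y \<bullet> \<phi> y = (inverse (1 + ?t))\<^sup>2 * (1 - ?t\<^sup>2)" by (simp add: \<phi>_def power2_eq_square)
    also have "1 - ?t\<^sup>2 = (1 + ?t) * (1 - ?t)" by (simp add: power2_eq_square algebra_simps)
    also have "(inverse a)\<^sup>2 * (a * b) = b / a" if "a \<noteq> 0" for a b :: real
      using that by (simp add: power2_eq_square divide_inverse)
    note this[OF ne[OF y]]
    finally have r: "\<phi> y \<bullet> \<phi> y = (1 - ?t) / (1 + ?t)" .
    have r1: "1 + \<phi> y \<bullet> \<phi> y = 2 / (1 + ?t)" "1 - \<phi> y \<bullet> \<phi> y = 2 * ?t / (1 + ?t)"
      unfolding r using ne[OF y] by (simp_all add: field_simps)
    have L: "L (\<phi> y) = inverse (1 + ?t) *\<^sub>R ?w"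
      unfolding \<phi>_def using linear_scale[OF Lg(1)] Lg(8)[OF w] by simp
    have "inverse (2 / a) * (2 * b / a) = b" "inverse (2 / a) * (2 * inverse a) = 1" if "a \<noteq> 0" for a b :: real
      using that by (simp_all add: field_simps)
    note this[OF ne[OF y]]
    then have "\<psi> (\<phi> y) = ?t *\<^sub>R h + ?w"
      unfolding \<psi>_def r1 L by (simp only: scaleR_add_right scaleR_scaleR scaleR_one)
    then show ?thesis by simp
  qed
  have im: "\<phi> ` ?U = UNIV" using \<phi>\<psi> \<psi>U by (metis UNIV_eq_I image_eqI)
  have inj: "inj_on \<phi> ?U" by (rule inj_on_inverseI[where g=\<psi>]) (rule \<psi>\<phi>)
  have inv: "inv_into ?U \<phi> = \<psi>"
    by (intro ext inv_into_f_eq inj \<psi>U \<phi>\<psi>)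
  have sm\<psi>: "smooth_on UNIV \<psi>"
  proof -
    have "smooth_on UNIV (\<lambda>u::real^3. inverse (1 + u \<bullet> u))"
      by (rule smooth_on_compose[OF open_UNIV _ _ smooth_on_inverse_real])
        (use pos in \<open>auto simp: open_Collect_neq less_imp_neq[symmetric] intro!: smooth_on_add smooth_on_inner smooth_on_bounded_linear[OF bounded_linear_ident]\<close>)
    then show ?thesis unfolding \<psi>_def
      by (intro smooth_on_scaleR smooth_on_add smooth_on_diff smooth_on_inner smooth_on_const open_UNIV
          smooth_on_bounded_linear[OF bounded_linear_ident]
          smooth_on_bounded_linear[OF linear_conv_bounded_linear[THEN iffD1, OF Lg(1)]])
  qed
  let ?W = "{y. 1 + y \<bullet> h \<noteq> 0}"
  have W: "open ?W" by (intro open_Collect_neq continuous_intros)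
  have sm\<phi>: "smooth_on ?W \<phi>"
  proof -
    have "smooth_on ?W (\<lambda>y. inverse (1 + y \<bullet> h))"
      by (rule smooth_on_compose[OF W _ _ smooth_on_inverse_real])
        (auto simp: open_Collect_neq W intro!: smooth_on_add smooth_on_inner smooth_on_bounded_linear[OF bounded_linear_ident])
    moreover have "smooth_on ?W (\<lambda>y. g (y - (y \<bullet> h) *\<^sub>R h))"
      by (intro smooth_on_linear_compose[OF linear_conv_bounded_linear[THEN iffD1, OF Lg(2)] W] smooth_on_diff W
          smooth_on_scaleR smooth_on_inner smooth_on_const smooth_on_bounded_linear[OF bounded_linear_ident])
    ultimately show ?thesis unfolding \<phi>_def by (rule smooth_on_scaleR[OF W])
  qed
  have "openin (top_of_set SU2) ?U" unfolding Diff_eq by (intro openin_open_Int open_Compl closed_singleton)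
  then have "(?U, \<phi>) \<in> charts SU2_mfd"
  proof (rule SU2_chartI[OF _ inj])
    show "open (\<phi> ` ?U)" "smooth_on (\<phi> ` ?U) (inv_into ?U \<phi>)" using im inv sm\<psi> by simp_all
    show "\<exists>W f. open W \<and> x \<in> W \<and> smooth_on W f \<and> (\<forall>y\<in>W \<inter> ?U. f y = \<phi> y)" if "x \<in> ?U" for x
      using W sm\<phi> ne[OF that] by blast
  qed
  moreover have "h \<noteq> - h"
  proof
    assume "h = - h"
    then have "h \<bullet> h = (- h) \<bullet> h" by (rule arg_cong)
    then show False using hh by simp
  qed
  then have "h \<in> ?U" using h by blast
  ultimately show ?thesis by force
qed

lemma SU2_lift:
  assumes c: "c \<in> charts SU2_mfd"
  shows "lift id c (inv_into (fst c) (snd c))"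
  unfolding lift_def
proof (intro conjI ballI SU2_chartD(2-4)[OF c])
  fix u assume "u \<in> snd c ` fst c"
  then obtain x where x: "x \<in> fst c" "u = snd c x" by blast
  note inv = inv_into_f_f[OF SU2_chartD(2)[OF c]]
  show "inv_into (fst c) (snd c) u \<in> SU2" "id (inv_into (fst c) (snd c) u) \<in> fst c"
    "snd c (id (inv_into (fst c) (snd c) u)) = u"
    using x inv openin_subset[OF SU2_chartD(1)[OF c]] by auto
  obtain W f where W: "open W" "x \<in> W" "smooth_on W f" "\<forall>y\<in>W \<inter> fst c. f y = snd c y"
    using SU2_chartD(5)[OF c x(1)] by blast
  obtain Q where Q: "open Q" "fst c = SU2 \<inter> Q" using SU2_chartD(1)[OF c] unfolding openin_open by blast
  show "\<exists>W f. open W \<and> inv_into (fst c) (snd c) u \<in> W \<and> smooth_on W f \<and>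
      (\<forall>z\<in>W \<inter> SU2. id z \<in> fst c \<and> f z = snd c (id z) \<and> inv_into (fst c) (snd c) (f z) = z)"
  proof (intro exI conjI ballI)
    \<comment> \<open>Intersecting with Q forces the sphere points of the neighbourhood into the
      chart domain, as \<open>lift\<close> demands.\<close>
    show "open (W \<inter> Q)" "smooth_on (W \<inter> Q) f" using W Q by (auto intro: smooth_on_subset)
    show "inv_into (fst c) (snd c) u \<in> W \<inter> Q" using x inv[OF x(1)] W(2) Q(2) by auto
    fix z assume z: "z \<in> W \<inter> Q \<inter> SU2"
    then have zc: "z \<in> fst c" using Q(2) by blast
    then show "id z \<in> fst c" "f z = snd c (id z)" "inv_into (fst c) (snd c) (f z) = z"
      using W(4) z inv[OF zc] by auto
  qed
qed

lemma covered_manifold_SU2: "covered_manifold SU2_mfd id"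
proof
  have m: "mtop SU2_mfd = top_of_set SU2" by (simp add: SU2_mfd_def submanifold_def)
  show "openin (mtop SU2_mfd) V \<longleftrightarrow> V \<subseteq> id ` SU2 \<and> openin (top_of_set SU2) {x \<in> SU2. id x \<in> V}" for V
  proof -
    have "{x \<in> SU2. id x \<in> V} = V" if "V \<subseteq> SU2" using that by auto
    then show ?thesis unfolding m using openin_subset[of "top_of_set SU2" V] by auto
  qed
  show "openin (mtop SU2_mfd) (fst c)" if "c \<in> charts SU2_mfd" for c
    unfolding m using SU2_chartD(1)[OF that] .
  show "\<exists>s. lift id c s \<and> s (snd c (id h)) = h" if "c \<in> charts SU2_mfd" "h \<in> SU2" "id h \<in> fst c" for c h
    using SU2_lift[OF that(1)] inv_into_f_f[OF SU2_chartD(2)[OF that(1)], of h] that(3) by auto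
  show "\<exists>c\<in>charts SU2_mfd. id h \<in> fst c" if "h \<in> SU2" for h
    using SU2_chart_exists[OF that] by simp
qed

interpretation SU2: covered_manifold SU2_mfd id
  by (rule covered_manifold_SU2)

text \<open>Charts of the quotient come from charts on whose domain the projection is injective;
  restriction makes a chart small enough for that.\<close>

lemma SU2_chart_restrict:
  assumes c: "c \<in> charts SU2_mfd" and V: "openin (top_of_set SU2) V"
  shows "(V \<inter> fst c, snd c) \<in> charts SU2_mfd"
proof (rule SU2_chartI)
  show "openin (top_of_set SU2) (V \<inter> fst c)" using V SU2_chartD(1)[OF c] by blast
  show inj: "inj_on (snd c) (V \<inter> fst c)" using SU2_chartD(2)[OF c] by (rule inj_on_subset) blast
  have "openin (mtop SU2_mfd) V" using V by (simp add: SU2_mfd_def submanifold_def)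
  then show op: "open (snd c ` (V \<inter> fst c))" by (rule SU2.open_chart_image[OF c])
  have "inv_into (V \<inter> fst c) (snd c) u = inv_into (fst c) (snd c) u" if "u \<in> snd c ` (V \<inter> fst c)" for u
    using that inv_into_f_f[OF inj] inv_into_f_f[OF SU2_chartD(2)[OF c]] by auto
  moreover have "smooth_on (snd c ` (V \<inter> fst c)) (inv_into (fst c) (snd c))"
    by (rule smooth_on_subset[OF SU2_chartD(4)[OF c]]) blast
  ultimately show "smooth_on (snd c ` (V \<inter> fst c)) (inv_into (V \<inter> fst c) (snd c))"
    using smooth_on_cong[OF op, of "inv_into (V \<inter> fst c) (snd c)" "inv_into (fst c) (snd c)"] by blast
  show "\<exists>W f. open W \<and> x \<in> W \<and> smooth_on W f \<and> (\<forall>y\<in>W \<inter> (V \<inter> fst c). f y = snd c y)"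
    if "x \<in> V \<inter> fst c" for x
    using SU2_chartD(5)[OF c, of x] that by blast
qed

section \<open>Lens spaces\<close>

definition unity_roots :: "int \<Rightarrow> complex set" where
  "unity_roots p = {w. w powi p = 1}"

text \<open>For a root of unity w this is a deck transformation. It is taken on all of C^2 so that
  it is linear and can be composed with ambient extensions.\<close>

definition lens_act :: "int \<Rightarrow> complex \<Rightarrow> C2 \<Rightarrow> C2" where
  "lens_act q w h = (w * fst h, w powi q * snd h)"

locale lens =
  fixes p q :: int
  assumes p_nonzero: "p \<noteq> 0" and coprime: "coprime p q"
begin

abbreviation "\<pi> \<equiv> lens_proj p q"
abbreviation "\<mu> \<equiv> unity_roots p"
abbreviation "act \<equiv> lens_act q"
abbreviation "L \<equiv> lens_space p q"

section \<open>Roots of unity and their action on the sphere\<close>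

lemma root_iff: "w \<in> \<mu> \<longleftrightarrow> w ^ nat \<bar>p\<bar> = 1"
  by (auto simp: unity_roots_def power_int_def power_inverse)

lemma nat_p_pos: "nat \<bar>p\<bar> > 0"
  using p_nonzero by simp

lemma finite_roots: "finite \<mu>"
proof -
  have "\<mu> = {w. w ^ nat \<bar>p\<bar> = 1}" using root_iff by blast
  then show ?thesis using finite_roots_unity[of "nat \<bar>p\<bar>"] nat_p_pos by simp
qed

lemma root_norm: "w \<in> \<mu> \<Longrightarrow> norm w = 1"
  using power_eq_1_iff[of w "nat \<bar>p\<bar>"] nat_p_pos by (simp add: root_iff)

lemma root_nonzero: "w \<in> \<mu> \<Longrightarrow> w \<noteq> 0"
  using root_norm by fastforce

lemma root_one: "1 \<in> \<mu>" by (simp add: unity_roots_def)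

lemma root_inverse: "w \<in> \<mu> \<Longrightarrow> inverse w \<in> \<mu>"
  by (simp add: unity_roots_def power_int_inverse)

lemma root_mult: "w \<in> \<mu> \<Longrightarrow> v \<in> \<mu> \<Longrightarrow> w * v \<in> \<mu>"
  by (simp add: unity_roots_def power_int_mult_distrib)

lemma root_powi: "w \<in> \<mu> \<Longrightarrow> w powi m \<in> \<mu>"
  by (metis (mono_tags, lifting) mem_Collect_eq mult.commute power_int_1_left power_int_mult unity_roots_def)

text \<open>Only the class of the exponent modulo p matters. A natural exponent allows functions of
  prescribed weight to be ordinary powers, smooth on all of C^2.\<close>

lemma root_power_mod: assumes w: "w \<in> \<mu>" shows "w ^ nat (m mod \<bar>p\<bar>) = w powi m"
proof -
  have "w powi \<bar>p\<bar> = 1" using w by (simp add: root_iff power_int_def)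
  have "w powi m = w powi (\<bar>p\<bar> * (m div \<bar>p\<bar>) + m mod \<bar>p\<bar>)" by simp
  also have "\<dots> = (w powi \<bar>p\<bar>) powi (m div \<bar>p\<bar>) * w powi (m mod \<bar>p\<bar>)"
    by (subst power_int_add) (use root_nonzero[OF w] in \<open>simp_all add: power_int_mult\<close>)
  also have "\<dots> = w powi (m mod \<bar>p\<bar>)" using \<open>w powi \<bar>p\<bar> = 1\<close> by simp
  also have "\<dots> = w ^ nat (m mod \<bar>p\<bar>)" using p_nonzero by (simp add: power_int_def)
  finally show ?thesis by simp
qed

lemma linear_act: "linear (act w)"
  by (intro linearI) (auto simp: lens_act_def algebra_simps)

lemma bounded_linear_act: "bounded_linear (act w)"
  using linear_act linear_conv_bounded_linear by blast

lemma act_norm: "w \<in> \<mu> \<Longrightarrow> norm (act w h) = norm h"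
  by (cases h) (simp add: lens_act_def norm_Pair norm_mult norm_power_int root_norm)

lemma act_SU2: "w \<in> \<mu> \<Longrightarrow> act w h \<in> SU2 \<longleftrightarrow> h \<in> SU2"
  by (simp add: SU2_norm act_norm)

lemma act_inner: "w \<in> \<mu> \<Longrightarrow> act w A \<bullet> act w B = A \<bullet> B"
  using orthogonal_transformation[of "act w"] linear_act act_norm
  unfolding orthogonal_transformation_def by blast

lemma act_dist: "w \<in> \<mu> \<Longrightarrow> dist (act w x) (act w y) = dist x y"
  by (simp add: dist_norm linear_diff[OF linear_act, symmetric] act_norm)

lemma act_act: "act w (act v h) = act (w * v) h"
  by (simp add: lens_act_def power_int_mult_distrib mult.assoc)

lemma act_one [simp]: "act 1 h = h"
  by (simp add: lens_act_def)

lemma act_inverse: "w \<in> \<mu> \<Longrightarrow> act (inverse w) (act w h) = h" "w \<in> \<mu> \<Longrightarrow> act w (act (inverse w) h) = h"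
  by (simp_all add: act_act root_nonzero)

text \<open>A nonzero first coordinate forces w = 1 at once. Otherwise the second one gives
  \<open>w powi q = 1\<close>, and Bezout combines this with \<open>w powi p = 1\<close>.\<close>

lemma act_free:
  assumes w: "w \<in> \<mu>" and h: "h \<in> SU2" and eq: "act w h = h" shows "w = 1"
proof (cases "fst h = 0")
  case False
  then show ?thesis using eq by (cases h) (simp add: lens_act_def)
next
  case True
  have "snd h \<noteq> 0" using h True by (cases h) (auto simp: SU2_def)
  then have wq: "w powi q = 1" using eq by (cases h) (simp add: lens_act_def)
  have wp: "w powi p = 1" using w by (simp add: unity_roots_def)
  obtain u v where "u * p + v * q = 1" using bezout_int[of p q] coprime by (auto simp: coprime_iff_gcd_eq_1)
  then have "w = w powi (p * u + q * v)" by (simp add: mult.commute)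
  also have "\<dots> = (w powi p) powi u * (w powi q) powi v"
    by (subst power_int_add) (use root_nonzero[OF w] in \<open>simp_all add: power_int_mult\<close>)
  finally show ?thesis using wp wq by simp
qed

lemma proj_eq_orbit:
  assumes "x \<in> SU2" shows "\<pi> x = (\<lambda>w. act w x) ` \<mu>"
proof -
  have "y \<in> \<pi> x \<longleftrightarrow> (\<exists>w\<in>\<mu>. y = act w x)" for y
    using assms act_SU2[of _ x]
    by (cases x; cases y) (auto simp: lens_proj_def lens_rel_def unity_roots_def lens_act_def)
  then show ?thesis by auto
qed

lemma proj_eq_iff:
  assumes x: "x \<in> SU2" and y: "y \<in> SU2" shows "\<pi> x = \<pi> y \<longleftrightarrow> (\<exists>w\<in>\<mu>. y = act w x)"
proof
  assume "\<pi> x = \<pi> y"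
  moreover have "y \<in> \<pi> y" unfolding proj_eq_orbit[OF y] using root_one by force
  ultimately show "\<exists>w\<in>\<mu>. y = act w x" unfolding proj_eq_orbit[OF x] by auto
next
  assume "\<exists>w\<in>\<mu>. y = act w x"
  then obtain w where w: "w \<in> \<mu>" "y = act w x" by blast
  have "act v y = act (v * w) x" "act v x = act (v * inverse w) y" for v
    using w(1) by (simp_all add: w(2) act_act root_nonzero mult.assoc)
  then show "\<pi> x = \<pi> y"
    unfolding proj_eq_orbit[OF x] proj_eq_orbit[OF y]
    using root_mult[OF _ w(1)] root_mult[OF _ root_inverse[OF w(1)]] by (auto simp: image_iff) blast+
qed

lemma proj_act: "w \<in> \<mu> \<Longrightarrow> x \<in> SU2 \<Longrightarrow> \<pi> (act w x) = \<pi> x"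
  using proj_eq_iff[of x "act w x"] act_SU2 by metis

text \<open>The other points of the finite orbit of h have distance at least \<open>\<delta>\<close>
  from h. The action is isometric, so if x and \<open>act w x\<close> are both within
  \<open>\<delta> / 2\<close> of h, then \<open>act w h\<close> is closer than
  \<open>\<delta>\<close>, hence equal to h, and freeness gives w = 1.\<close>

lemma inj_nhd_exists:
  assumes h: "h \<in> SU2"
  obtains V where "openin (top_of_set SU2) V" "h \<in> V" "inj_on \<pi> V"
proof -
  obtain \<delta> where \<delta>: "\<delta> > 0" "\<And>x. x \<in> (\<lambda>w. act w h) ` \<mu> \<Longrightarrow> x \<noteq> h \<Longrightarrow> \<delta> \<le> dist h x"
    using finite_set_avoid[OF finite_imageI[OF finite_roots, of "\<lambda>w. act w h"], of h] by blast
  let ?V = "SU2 \<inter> ball h (\<delta> / 2)"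
  have "inj_on \<pi> ?V"
  proof (rule inj_onI)
    fix x y assume x: "x \<in> ?V" and y: "y \<in> ?V" and "\<pi> x = \<pi> y"
    then obtain w where w: "w \<in> \<mu>" "y = act w x" using proj_eq_iff[of x y] by blast
    have "dist h (act w h) \<le> dist h y + dist y (act w h)" by (rule dist_triangle)
    also have "dist y (act w h) = dist x h" using w by (simp add: act_dist)
    also have "dist h y + dist x h < \<delta>" using x y by (simp add: dist_commute)
    finally have "act w h = h" using \<delta>(2)[of "act w h"] w(1) by force
    then have "w = 1" using act_free[OF w(1) h] by blast
    then show "x = y" using w(2) by simp
  qed
  then show thesis using that[of ?V] h \<delta>(1) by (simp add: openin_open_Int)
qed

section \<open>Topology and charts of the quotient\<close>

lemma charts_L: "charts L = {(\<pi> ` U, \<phi> \<circ> inv_into U \<pi>) | U \<phi>. (U, \<phi>) \<in> charts SU2_mfd \<and> inj_on \<pi> U}"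
  by (simp add: lens_space_def quotient_manifold_def)

lemma openin_L: "openin (mtop L) V \<longleftrightarrow> V \<subseteq> \<pi> ` SU2 \<and> openin (top_of_set SU2) {x \<in> SU2. \<pi> x \<in> V}"
  by (simp add: lens_space_def quotient_manifold_def openin_quotient_top SU2_mfd_def submanifold_def)

text \<open>Points have the same class exactly when a root moves one to the other. In this form the
  saturation of an open set is visibly open, so \<open>\<pi>\<close> is an open map.\<close>

lemma saturation:
  assumes "U \<subseteq> SU2"
  shows "{x \<in> SU2. \<pi> x \<in> \<pi> ` U} = (\<Union>w\<in>\<mu>. {x \<in> SU2. act w x \<in> U})"
proof (intro set_eqI iffI)
  fix x assume "x \<in> {x \<in> SU2. \<pi> x \<in> \<pi> ` U}"
  then obtain y where "x \<in> SU2" "y \<in> U" "\<pi> x = \<pi> y" by blast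
  then show "x \<in> (\<Union>w\<in>\<mu>. {x \<in> SU2. act w x \<in> U})"
    using proj_eq_iff[of x y] assms by blast
next
  fix x assume "x \<in> (\<Union>w\<in>\<mu>. {x \<in> SU2. act w x \<in> U})"
  then obtain w where "w \<in> \<mu>" "x \<in> SU2" "act w x \<in> U" by blast
  then have "x \<in> SU2" "\<pi> x \<in> \<pi> ` U" using proj_act[of w x] imageI[of "act w x" U \<pi>] by auto
  then show "x \<in> {x \<in> SU2. \<pi> x \<in> \<pi> ` U}" by blast
qed

lemma openin_act_vimage:
  assumes U: "openin (top_of_set SU2) U" and w: "w \<in> \<mu>"
  shows "openin (top_of_set SU2) {x \<in> SU2. act w x \<in> U}"
proof -
  obtain Q where Q: "open Q" "U = SU2 \<inter> Q" using U unfolding openin_open by blast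
  have "open (act w -` Q)"
    by (rule open_vimage[OF Q(1) linear_continuous_on[OF bounded_linear_act]])
  moreover have "{x \<in> SU2. act w x \<in> U} = SU2 \<inter> act w -` Q"
    using Q(2) act_SU2[OF w] by auto
  ultimately show ?thesis by (simp add: openin_open_Int)
qed

lemma openin_L_image:
  assumes U: "openin (top_of_set SU2) U" shows "openin (mtop L) (\<pi> ` U)"
proof -
  have US: "U \<subseteq> SU2" using openin_subset[OF U] by simp
  have "openin (top_of_set SU2) (\<Union>w\<in>\<mu>. {x \<in> SU2. act w x \<in> U})"
    by (intro openin_Union ballI) (use openin_act_vimage[OF U] in auto)
  then show ?thesis unfolding openin_L saturation[OF US] using US by blast
qed

text \<open>The sheets over a quotient chart are the translates of U, so each root gives one lift.
  Its ambient chart extension is that of \<open>\<phi>\<close>, precomposed with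
  \<open>act (inverse w)\<close>.\<close>

lemma lift_act:
  assumes U: "(U, \<phi>) \<in> charts SU2_mfd" and inj: "inj_on \<pi> U" and w: "w \<in> \<mu>"
  shows "lift \<pi> (\<pi> ` U, \<phi> \<circ> inv_into U \<pi>) (\<lambda>u. act w (inv_into U \<phi> u))"
proof -
  define c where "c = (U, \<phi>)"
  define s where "s = inv_into U \<phi>"
  have s: "lift id c s" using SU2_lift[OF U] by (simp add: c_def s_def)
  have US: "U \<subseteq> SU2" using openin_subset[OF SU2_chartD(1)[OF U]] by simp
  have im: "(\<phi> \<circ> inv_into U \<pi>) ` \<pi> ` U = \<phi> ` U" using inj by (force simp: image_iff)
  have inv: "inv_into U \<pi> (\<pi> x) = x" if "x \<in> U" for x using inv_into_f_f[OF inj that] .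
  have injc: "inj_on (\<phi> \<circ> inv_into U \<pi>) (\<pi> ` U)"
    using inv SU2_chartD(2)[OF U] by (auto simp: inj_on_def)
  have sU: "s u \<in> U" "\<phi> (s u) = u" if "u \<in> \<phi> ` U" for u
    using liftD(5,6)[OF s, of u] that by (simp_all add: c_def)
  have \<pi>s: "\<pi> (act w (s u)) = \<pi> (s u)" if "u \<in> \<phi> ` U" for u
    using proj_act[OF w] sU(1)[OF that] US by blast
  have "\<exists>W f. open W \<and> act w (s u) \<in> W \<and> smooth_on W f \<and>
      (\<forall>z\<in>W \<inter> SU2. \<pi> z \<in> \<pi> ` U \<and> f z = \<phi> (inv_into U \<pi> (\<pi> z)) \<and> act w (s (f z)) = z)"
    if u: "u \<in> \<phi> ` U" for u
  proof -
    have "u \<in> snd c ` fst c" using u by (simp add: c_def)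
    then obtain W f where W: "open W" "s u \<in> W" "smooth_on W f"
      "\<forall>z\<in>W \<inter> SU2. id z \<in> fst c \<and> f z = snd c (id z) \<and> s (f z) = z"
      by (rule lift_extension[OF s])
    let ?a = "act (inverse w)"
    have op: "open (?a -` W)"
      by (rule open_vimage[OF W(1) linear_continuous_on[OF bounded_linear_act]])
    show ?thesis
    proof (intro exI conjI ballI)
      show "open (?a -` W)" by (rule op)
      show "act w (s u) \<in> ?a -` W" using W(2) act_inverse(1)[OF w] by simp
      show "smooth_on (?a -` W) (\<lambda>z. f (?a z))"
        by (rule smooth_on_compose[OF op W(1) smooth_on_bounded_linear[OF bounded_linear_act] W(3)]) auto
      fix z assume z: "z \<in> ?a -` W \<inter> SU2"
      have az: "?a z \<in> SU2" using z act_SU2[OF root_inverse[OF w]] by blast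
      then have f: "?a z \<in> U" "f (?a z) = \<phi> (?a z)" "s (f (?a z)) = ?a z"
        using bspec[OF W(4), of "?a z"] z by (auto simp: c_def)
      have "\<pi> (?a z) = \<pi> z" using proj_act[OF root_inverse[OF w]] z by blast
      with f show "\<pi> z \<in> \<pi> ` U" "f (?a z) = \<phi> (inv_into U \<pi> (\<pi> z))"
        using inv[OF f(1)] by (auto simp: image_iff intro: bexI[of _ "?a z"])
      show "act w (s (f (?a z))) = z" unfolding f(3) by (rule act_inverse(2)[OF w])
    qed
  qed
  moreover have "smooth_on (\<phi> ` U) (\<lambda>u. act w (s u))"
    using smooth_on_linear_compose[OF bounded_linear_act liftD(1,3)[OF s]] by (simp add: c_def)
  moreover have "act w (s u) \<in> SU2" if "u \<in> \<phi> ` U" for u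
    using act_SU2[OF w] sU(1)[OF that] US by blast
  moreover have "\<phi> (inv_into U \<pi> (\<pi> (s u))) = u" "\<pi> (s u) \<in> \<pi> ` U" if "u \<in> \<phi> ` U" for u
    using sU[OF that] inv[of "s u"] by auto
  ultimately show ?thesis
    unfolding lift_def s_def[symmetric] fst_conv snd_conv im
    using injc SU2_chartD(3)[OF U] \<pi>s by simp
qed

lemma covered_manifold_L: "covered_manifold L \<pi>"
proof
  show "openin (mtop L) V \<longleftrightarrow> V \<subseteq> \<pi> ` SU2 \<and> openin (top_of_set SU2) {x \<in> SU2. \<pi> x \<in> V}" for V
    by (rule openin_L)
next
  fix c assume "c \<in> charts L"
  then obtain U \<phi> where c: "c = (\<pi> ` U, \<phi> \<circ> inv_into U \<pi>)" "(U, \<phi>) \<in> charts SU2_mfd" "inj_on \<pi> U"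
    by (auto simp: charts_L)
  show "openin (mtop L) (fst c)" using openin_L_image SU2_chartD(1)[OF c(2)] by (simp add: c(1))
  fix h assume h: "h \<in> SU2" "\<pi> h \<in> fst c"
  then obtain x where x: "x \<in> U" "\<pi> x = \<pi> h" by (auto simp: c(1))
  have "x \<in> SU2" using x(1) openin_subset[OF SU2_chartD(1)[OF c(2)]] by auto
  \<comment> \<open>The prescribed point h may lie outside U; w selects the sheet that contains
    it.\<close>
  then obtain w where w: "w \<in> \<mu>" "h = act w x" using proj_eq_iff[OF _ h(1)] x(2) by blast
  have "snd c (\<pi> h) = \<phi> x" using inv_into_f_f[OF c(3) x(1)] x(2) by (simp add: c(1))
  then have "act w (inv_into U \<phi> (snd c (\<pi> h))) = h"
    using inv_into_f_f[OF SU2_chartD(2)[OF c(2)], of x] x(1) w(2) by simp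
  then show "\<exists>s. lift \<pi> c s \<and> s (snd c (\<pi> h)) = h"
    using lift_act[OF c(2,3) w(1)] c(1) by (intro exI[of _ "\<lambda>u. act w (inv_into U \<phi> u)"]) simp
next
  fix h assume h: "h \<in> SU2"
  obtain V where V: "openin (top_of_set SU2) V" "h \<in> V" "inj_on \<pi> V" by (rule inj_nhd_exists[OF h])
  obtain c where c: "c \<in> charts SU2_mfd" "h \<in> fst c" using SU2_chart_exists[OF h] by blast
  have "inj_on \<pi> (V \<inter> fst c)" using V(3) by (rule inj_on_subset) blast
  then have "(\<pi> ` (V \<inter> fst c), snd c \<circ> inv_into (V \<inter> fst c) \<pi>) \<in> charts L"
    using SU2_chart_restrict[OF c(1) V(1)] unfolding charts_L by blast
  then show "\<exists>c\<in>charts L. \<pi> h \<in> fst c"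
    using V(2) c(2) by (intro bexI[of _ "(\<pi> ` (V \<inter> fst c), snd c \<circ> inv_into (V \<inter> fst c) \<pi>)"]) auto
qed

end

sublocale lens \<subseteq> L: covered_manifold "lens_space p q" "lens_proj p q"
  by (rule covered_manifold_L)

context lens
begin

text \<open>The finite orbit of x has a positive distance \<open>\<delta>\<close> from x'. By
  isometry, equivalent points in the two balls of radius \<open>\<delta> / 2\<close> would produce
  an orbit point of x closer than that to x'.\<close>

lemma Hausdorff_L: "Hausdorff_space (mtop L)"
  unfolding Hausdorff_space_def
proof (intro allI impI, elim conjE)
  fix y y' assume "y \<in> topspace (mtop L)" "y' \<in> topspace (mtop L)" and ne: "y \<noteq> y'"
  then obtain x x' where x: "x \<in> SU2" "y = \<pi> x" and x': "x' \<in> SU2" "y' = \<pi> x'"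
    unfolding L.topspace_M by blast
  have "x' \<noteq> z" if "z \<in> \<pi> x" for z
    using ne x x' proj_eq_iff[OF x(1) x'(1)] that unfolding proj_eq_orbit[OF x(1)] by blast
  moreover have "finite (\<pi> x)" unfolding proj_eq_orbit[OF x(1)] using finite_roots by blast
  ultimately obtain \<delta> where \<delta>: "\<delta> > 0" "\<And>z. z \<in> \<pi> x \<Longrightarrow> \<delta> \<le> dist x' z"
    using finite_set_avoid[of "\<pi> x" x'] by metis
  let ?U = "\<pi> ` (SU2 \<inter> ball x (\<delta> / 2))" and ?V = "\<pi> ` (SU2 \<inter> ball x' (\<delta> / 2))"
  have "openin (mtop L) ?U" "openin (mtop L) ?V" by (intro openin_L_image openin_open_Int open_ball)+
  moreover have "y \<in> ?U" "y' \<in> ?V" using x x' \<delta>(1) by auto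
  moreover have "disjnt ?U ?V"
  proof (rule ccontr)
    assume "\<not> disjnt ?U ?V"
    then obtain a b where a: "a \<in> SU2" "dist x a < \<delta> / 2" and b: "b \<in> SU2" "dist x' b < \<delta> / 2"
      and "\<pi> a = \<pi> b" by (auto simp: disjnt_def)
    then obtain w where w: "w \<in> \<mu>" "b = act w a" using proj_eq_iff[OF a(1) b(1)] by blast
    have "dist x' (act w x) \<le> dist x' b + dist b (act w x)" by (rule dist_triangle)
    also have "dist b (act w x) = dist x a" using w by (simp add: act_dist dist_commute)
    finally have "dist x' (act w x) < \<delta>" using a(2) b(2) by linarith
    moreover have "act w x \<in> \<pi> x" unfolding proj_eq_orbit[OF x(1)] using w(1) by blast
    ultimately show False using \<delta>(2)[of "act w x"] by linarith
  qed
  ultimately show "\<exists>U V. openin (mtop L) U \<and> openin (mtop L) V \<and> y \<in> U \<and> y' \<in> V \<and> disjnt U V" by blast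
qed

text \<open>On an open V where \<open>\<pi>\<close> is injective, both \<open>\<pi>\<close> and its
  inverse lift to the identity of V, so \<open>smooth_map_onI\<close> handles both
  directions.\<close>

lemma local_diffeomorphism_proj: "local_diffeomorphism SU2_mfd L \<pi>"
  unfolding local_diffeomorphism_def
proof
  have m: "mtop SU2_mfd = top_of_set SU2" by (simp add: SU2_mfd_def submanifold_def)
  fix x assume "x \<in> topspace (mtop SU2_mfd)"
  then have "x \<in> SU2" by (simp add: m)
  then obtain V where V: "openin (top_of_set SU2) V" "x \<in> V" "inj_on \<pi> V" by (rule inj_nhd_exists)
  have "smooth_map_on SU2_mfd (id ` V) L \<pi>"
    by (rule smooth_map_onI[OF covered_manifold_SU2 covered_manifold_L V(1)]) simp
  moreover have "smooth_map_on L (\<pi> ` V) SU2_mfd (inv_into V \<pi>)"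
    by (rule smooth_map_onI[OF covered_manifold_L covered_manifold_SU2 V(1)]) (simp add: inv_into_f_f[OF V(3)])
  ultimately show "\<exists>U. openin (mtop SU2_mfd) U \<and> x \<in> U \<and> openin (mtop L) (\<pi> ` U) \<and>
        inj_on \<pi> U \<and> smooth_map_on SU2_mfd U L \<pi> \<and> smooth_map_on L (\<pi> ` U) SU2_mfd (inv_into U \<pi>)"
    using V openin_L_image[OF V(1)] m by (intro exI[of _ V]) simp
qed

end

section \<open>Horizontal vectors\<close>

text \<open>The ambient vector of the tangent vector \<open>h (f1 p1 + f2 p2)\<close>, for \<open>F = (f1 + i f2) / 2\<close>.\<close>

definition hor :: "complex \<Rightarrow> C2 \<Rightarrow> C2" where
  "hor F h = (- snd h * cnj F, fst h * F)"

text \<open>The matrix h times diag(\<i>, -\<i>), the left-invariant direction of k. In the Lie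
  algebra the bracket of p1 and p2 is diag(\<i>, -\<i>) / 2.\<close>

definition vert :: "C2 \<Rightarrow> C2" where
  "vert h = (\<i> * fst h, - \<i> * snd h)"

lemma hor_add: "hor (F + G) h = hor F h + hor G h"
  by (simp add: hor_def algebra_simps)

lemma hor_scaleR: "hor (r *\<^sub>R F) h = r *\<^sub>R hor F h"
  by (simp add: hor_def scaleR_conv_of_real algebra_simps)

lemma SU2_cmod: "h \<in> SU2 \<Longrightarrow> (Re (fst h))\<^sup>2 + (Im (fst h))\<^sup>2 + (Re (snd h))\<^sup>2 + (Im (snd h))\<^sup>2 = 1"
  by (cases h) (simp add: SU2_def cmod_power2)

lemma inner_hor: assumes "h \<in> SU2" shows "hor F h \<bullet> hor G h = F \<bullet> G"
proof -
  have "hor F h \<bullet> hor G h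
      = ((Re (fst h))\<^sup>2 + (Im (fst h))\<^sup>2 + (Re (snd h))\<^sup>2 + (Im (snd h))\<^sup>2) * (F \<bullet> G)"
    by (simp add: hor_def inner_prod_def inner_complex_def power2_eq_square algebra_simps)
  then show ?thesis using SU2_cmod[OF assms] by simp
qed

lemma hor_orthogonal: "hor F h \<bullet> h = 0"
  by (simp add: hor_def inner_prod_def inner_complex_def algebra_simps)

lemma hor_eq_0: assumes "h \<in> SU2" "hor F h = 0" shows "F = 0"
  using inner_hor[OF assms(1), of F F] assms(2) by simp

text \<open>Translate back to the identity: \<open>(z, F)\<close> is the first row of the inverse of
  the matrix of h times the matrix of A. Orthogonality makes z imaginary, as
  \<open>Re z = A \<bullet> h\<close>, and \<open>Im z\<close> is the vertical coefficient.\<close>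

lemma orthogonal_decomposition:
  assumes h: "h \<in> SU2" and A: "A \<bullet> h = 0"
  obtains r F where "A = r *\<^sub>R vert h + hor F h"
proof -
  define a b where "a = fst h" and "b = snd h"
  define F where "F = cnj a * snd A - b * cnj (fst A)"
  define z where "z = cnj a * fst A + b * cnj (snd A)"
  have n: "a * cnj a + b * cnj b = 1"
    using SU2_cmod[OF h] by (simp add: a_def b_def complex_eq_iff power2_eq_square)
  have "Re z = A \<bullet> h"
    by (simp add: z_def a_def b_def inner_prod_def inner_complex_def algebra_simps)
  then have z: "z = \<i> * of_real (Im z)" using A by (simp add: complex_eq_iff)
  have 1: "fst A = a * z - b * cnj F"
  proof -
    have "a * z - b * cnj F = (a * cnj a + b * cnj b) * fst A"
      by (simp add: z_def F_def algebra_simps)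
    then show ?thesis using n by simp
  qed
  have 2: "snd A = b * cnj z + a * F"
  proof -
    have "b * cnj z + a * F = (a * cnj a + b * cnj b) * snd A"
      by (simp add: z_def F_def algebra_simps)
    then show ?thesis using n by simp
  qed
  have "cnj z = - \<i> * of_real (Im z)" by (subst z) simp
  then have "A = Im z *\<^sub>R vert h + hor F h"
    using 1 2 z by (intro prod_eqI) (simp_all add: vert_def hor_def a_def b_def scaleR_conv_of_real mult.commute mult.left_commute)
  then show thesis by (rule that)
qed

subsection \<open>Horizontal vector fields on the ambient space\<close>

lemma smooth_on_Pair:
  fixes f :: "'x::real_normed_vector \<Rightarrow> 'y::euclidean_space" and g :: "'x \<Rightarrow> 'z::euclidean_space"
  assumes "open S" "smooth_on S f" "smooth_on S g" shows "smooth_on S (\<lambda>x. (f x, g x))"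
proof -
  have "bounded_linear (\<lambda>x::'y. (x, 0::'z))" "bounded_linear (\<lambda>x::'z. (0::'y, x))"
    by (auto intro!: bounded_linear_Pair bounded_linear_ident bounded_linear_zero)
  then have "smooth_on S (\<lambda>x. (f x, 0::'z) + (0::'y, g x))"
    by (intro smooth_on_add assms(1) smooth_on_linear_compose[of "\<lambda>x. (x, 0)"] smooth_on_linear_compose[of "\<lambda>x. (0, x)"] assms)
  then show ?thesis by simp
qed

lemma smooth_on_hor:
  assumes F: "smooth_on UNIV F" shows "smooth_on UNIV (\<lambda>h. hor (F h) h)"
  unfolding hor_def
  by (intro smooth_on_Pair smooth_on_mult open_UNIV F smooth_on_linear_compose[OF bounded_linear_cnj]
      smooth_on_bounded_linear bounded_linear_minus bounded_linear_fst bounded_linear_snd)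

lemma fder_hor:
  assumes F: "smooth_on UNIV F"
  shows "fder (\<lambda>h. hor (F h) h) h v
    = (- (snd v * cnj (F h) + snd h * cnj (fder F h v)), fst v * F h + fst h * fder F h v)"
proof -
  have "((\<lambda>h. hor (F h) h) has_derivative
      (\<lambda>v. (- snd h * cnj (fder F h v) + - snd v * cnj (F h), fst h * fder F h v + fst v * F h))) (at h)"
    unfolding hor_def
    by (intro has_derivative_Pair has_derivative_mult has_derivative_minus has_derivative_cnj
        has_derivative_fst has_derivative_snd has_derivative_ident smooth_on_has_derivative[OF F] UNIV_I)
  from fder_eq[OF this] show ?thesis by (simp add: algebra_simps)
qed

text \<open>Terms that differentiate F add up to a horizontal vector, with
  \<open>G = \<i> * fder F h (A h) - fder F h (B h)\<close>. Terms that differentiate the explicit h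
  give the multiple of \<open>vert h\<close>.\<close>

lemma bracket_hor:
  assumes F: "smooth_on UNIV F"
  defines "A \<equiv> \<lambda>h. hor (F h) h" and "B \<equiv> \<lambda>h. hor (\<i> * F h) h"
  shows "\<exists>G. fder B h (A h) - fder A h (B h) = (2 * (cmod (F h))\<^sup>2) *\<^sub>R vert h + hor G h"
proof -
  have iF: "smooth_on UNIV (\<lambda>h. \<i> * F h)"
    by (intro smooth_on_mult open_UNIV F smooth_on_const)
  have "((\<lambda>h. \<i> * F h) has_derivative (\<lambda>v. \<i> * fder F h v)) (at h)"
    by (intro has_derivative_mult_right smooth_on_has_derivative[OF F] UNIV_I)
  note i = fder_eq[OF this]
  have sq: "(of_real (cmod (F h)))\<^sup>2 = F h * cnj (F h)"
    using complex_norm_square[of "F h"] by simp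
  have "fder B h (A h) - fder A h (B h)
      = (2 * (cmod (F h))\<^sup>2) *\<^sub>R vert h + hor (\<i> * fder F h (A h) - fder F h (B h)) h"
    unfolding A_def B_def fder_hor[OF F] fder_hor[OF iF] i
    by (intro prod_eqI) (simp_all add: hor_def vert_def scaleR_conv_of_real sq algebra_simps)
  then show ?thesis by blast
qed

section \<open>The structure on SU(2) in ambient terms\<close>

lemma linear_su2_mat: "linear su2_mat"
  by (intro linearI)
    (auto simp: su2_mat_def vec_eq_iff forall_2 complex_eq_iff split: prod.splits)

lemma su2_mat_inj: "su2_mat x = su2_mat y \<longleftrightarrow> x = y"
  by (cases x; cases y) (auto simp: su2_mat_def vec_eq_iff forall_2)

text \<open>Exhibits \<open>hor F h\<close> as the left translate of an element of p, which turns
  membership in \<open>SU2_dist\<close> into a condition on ambient vectors.\<close>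

lemma su2_mat_mult_hor: "su2_mat h ** su2_mat (0, F) = su2_mat (hor F h)"
  by (cases h) (simp add: su2_mat_def hor_def matrix_matrix_mult_def vec_eq_iff forall_2 sum_2 mult.commute)

lemma p_eq_su2_mat: "p1 = su2_mat (0, 1 / 2)" "p2 = su2_mat (0, \<i> / 2)"
  by (simp_all add: p1_def p2_def su2_mat_def vec_eq_iff forall_2 complex_eq_iff)

lemma su2_mat_p: "su2_mat (0, F) = (2 * Re F) *\<^sub>R p1 + (2 * Im F) *\<^sub>R p2"
proof -
  have "(0, F) = (2 * Re F) *\<^sub>R (0, 1 / 2) + (2 * Im F) *\<^sub>R (0::complex, \<i> / 2)"
    by (simp add: complex_eq_iff)
  then show ?thesis
    unfolding p_eq_su2_mat by (metis linear_add[OF linear_su2_mat] linear_scale[OF linear_su2_mat])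
qed

lemma p_space_eq: "p_space = range (\<lambda>F. su2_mat (0, F))"
proof (intro equalityI subsetI)
  fix x assume "x \<in> p_space"
  then obtain a b where "x = a *\<^sub>R p1 + b *\<^sub>R p2"
    unfolding p_space_def span_insert by (auto simp: span_singleton algebra_simps)
  then have "x = su2_mat (0, Complex (a / 2) (b / 2))" by (simp add: su2_mat_p)
  then show "x \<in> range (\<lambda>F. su2_mat (0, F))" by blast
next
  fix x assume "x \<in> range (\<lambda>F. su2_mat (0, F))"
  then obtain F where "x = (2 * Re F) *\<^sub>R p1 + (2 * Im F) *\<^sub>R p2" by (auto simp: su2_mat_p)
  then show "x \<in> p_space"
    unfolding p_space_def by (simp only:) (intro span_add span_scale span_base insertI1 insertI2)
qed

text \<open>In the basis p1, p2 the matrix of \<open>(0, F)\<close> has the coordinates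
  \<open>2 * Re F\<close> and \<open>2 * Im F\<close>, whence the factor 4.\<close>

lemma p_inner_su2_mat: "p_inner (su2_mat (0, F)) (su2_mat (0, G)) = 4 * (F \<bullet> G)"
proof -
  have ne: "p1 \<noteq> p2" "p2 \<noteq> 0" "p1 \<notin> span {p2}"
  proof -
    show "p1 \<noteq> p2" unfolding p_eq_su2_mat by (simp add: su2_mat_inj complex_eq_iff)
    show "p2 \<noteq> 0"
      unfolding p_eq_su2_mat using su2_mat_inj[of "(0, \<i> / 2)" 0] linear_0[OF linear_su2_mat]
      by (auto simp: zero_prod_def)
    show "p1 \<notin> span {p2}"
    proof
      assume "p1 \<in> span {p2}"
      then obtain r where "p1 = r *\<^sub>R p2" by (auto simp: span_singleton)
      then have "su2_mat (0, 1 / 2) = su2_mat (r *\<^sub>R (0, \<i> / 2))"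
        unfolding p_eq_su2_mat linear_scale[OF linear_su2_mat] .
      then have "(0, 1 / 2) = r *\<^sub>R (0 :: complex, \<i> / 2)" by (simp only: su2_mat_inj)
      then show False by (simp add: complex_eq_iff)
    qed
  qed
  then have ind: "independent {p1, p2}" by (simp add: independent_insert)
  have rep: "representation {p1, p2} (su2_mat (0, F)) p1 = 2 * Re F"
    "representation {p1, p2} (su2_mat (0, F)) p2 = 2 * Im F" for F
    unfolding su2_mat_p using ne(1)
    by (simp_all add: representation_add[OF ind] representation_scale[OF ind] representation_basis[OF ind]
        span_scale span_base)
  show ?thesis
    using ne(1) by (simp add: p_inner_def rep inner_complex_def)
qed

lemma matrix_inv_su2_mat:
  assumes "h \<in> SU2" shows "matrix_inv (su2_mat h) ** (su2_mat h ** X) = X"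
proof -
  obtain a b where h: "h = (a, b)" by force
  have n: "a * cnj a + b * cnj b = 1"
    using SU2_cmod[OF assms] by (simp add: h complex_eq_iff power2_eq_square)
  \<comment> \<open>On SU(2) the inverse is the conjugate transpose, which corresponds to
    \<open>(cnj a, - b)\<close>.\<close>
  have "su2_mat h ** su2_mat (cnj a, - b) = mat 1 \<and> su2_mat (cnj a, - b) ** su2_mat h = mat 1"
    using n by (simp add: h su2_mat_def matrix_matrix_mult_def mat_def vec_eq_iff forall_2 sum_2 mult.commute add.commute)
  then have "su2_mat h ** matrix_inv (su2_mat h) = mat 1 \<and> matrix_inv (su2_mat h) ** su2_mat h = mat 1"
    unfolding matrix_inv_def by (rule someI)
  then show ?thesis by (simp add: matrix_mul_assoc)
qed

text \<open>Being linear on C^2, \<open>su2_mat\<close> is its own ambient extension and its own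
  derivative.\<close>

lemma tvec_mat_emb:
  assumes h: "h \<in> SU2" and v: "v \<in> tangent_space SU2_mfd h"
  shows "tvec_mat h v = su2_mat (SU2.emb h v)"
proof -
  have bl: "bounded_linear su2_mat" using linear_su2_mat linear_conv_bounded_linear by blast
  have "differential SU2_mfd su2_mat (id h) v = fder su2_mat h (SU2.emb h v)"
    using h v by (intro SU2.differential_emb bounded_linear_imp_differentiable[OF bl]) simp_all
  then show ?thesis
    by (simp add: tvec_mat_def fder_eq[OF bounded_linear_imp_has_derivative[OF bl]])
qed

lemma SU2_dist_iff:
  assumes h: "h \<in> SU2"
  shows "v \<in> SU2_dist h \<longleftrightarrow> v \<in> tangent_space SU2_mfd h \<and> (\<exists>F. SU2.emb h v = hor F h)"
proof (cases "v \<in> tangent_space SU2_mfd h")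
  case True
  have "tvec_mat h v \<in> (\<lambda>a. su2_mat h ** a) ` p_space \<longleftrightarrow> (\<exists>F. su2_mat (SU2.emb h v) = su2_mat (hor F h))"
    unfolding tvec_mat_emb[OF h True] p_space_eq image_image su2_mat_mult_hor by blast
  then show ?thesis using True by (simp add: SU2_dist_def su2_mat_inj)
qed (simp add: SU2_dist_def)

lemma SU2_metric_eq:
  assumes h: "h \<in> SU2" and v: "v \<in> SU2_dist h" and w: "w \<in> SU2_dist h"
  shows "SU2_metric h v w = 4 * (SU2.emb h v \<bullet> SU2.emb h w)"
proof -
  obtain F G where F: "SU2.emb h v = hor F h" and G: "SU2.emb h w = hor G h"
    and t: "v \<in> tangent_space SU2_mfd h" "w \<in> tangent_space SU2_mfd h"
    using v w SU2_dist_iff[OF h] by blast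
  show ?thesis
    unfolding SU2_metric_def tvec_mat_emb[OF h t(1)] tvec_mat_emb[OF h t(2)] F G inner_hor[OF h]
    by (simp add: su2_mat_mult_hor[symmetric] matrix_inv_su2_mat[OF h] p_inner_su2_mat)
qed

section \<open>The sub-Riemannian structure on the lens space\<close>

context lens
begin

section \<open>Invariance under the action and descent to the quotient\<close>

lemma act_hor:
  assumes w: "w \<in> \<mu>" shows "hor (w powi (q - 1) * F) (act w h) = act w (hor F h)"
proof -
  have nz: "w \<noteq> 0" using root_nonzero[OF w] .
  have q: "w powi q = w powi (q - 1) * w" using power_int_add[of w "q - 1" 1] nz by simp
  \<comment> \<open>Roots have modulus 1, so the conjugate in the first coordinate of
    \<open>hor\<close> inverts the factor; this reduces \<omega>^q to \<omega>.\<close>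
  have "w powi (q - 1) * cnj (w powi (q - 1)) = 1"
    unfolding complex_norm_square[symmetric] root_norm[OF root_powi[OF w]] by simp
  then have q': "w powi q * cnj (w powi (q - 1)) = w" unfolding q by (metis mult.commute mult.left_commute mult_1_right)
  have "- (w powi q * snd h) * cnj (w powi (q - 1) * F) = (w powi q * cnj (w powi (q - 1))) * (- snd h * cnj F)"
    by (simp add: mult_ac)
  moreover have "w * fst h * (w powi (q - 1) * F) = w powi q * (fst h * F)" by (simp add: q mult_ac)
  ultimately show ?thesis unfolding hor_def lens_act_def fst_conv snd_conv q' by simp
qed

lemma horizontal_act:
  assumes w: "w \<in> \<mu>" shows "(\<exists>F. act w A = hor F (act w h)) \<longleftrightarrow> (\<exists>F. A = hor F h)"
proof
  assume "\<exists>F. act w A = hor F (act w h)"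
  then obtain F where F: "act w A = hor F (act w h)" by blast
  have "F = w powi (q - 1) * (F / w powi (q - 1))" using root_nonzero[OF w] by simp
  then have "act w A = act w (hor (F / w powi (q - 1)) h)" using F act_hor[OF w] by metis
  then show "\<exists>F. A = hor F h" using act_inverse(1)[OF w] by metis
next
  assume "\<exists>F. A = hor F h"
  then show "\<exists>F. act w A = hor F (act w h)" using act_hor[OF w] by metis
qed

text \<open>Over one chart, the lifts through h and through \<open>act w h\<close> differ by the
  deck transformation: the extension property of t forces \<open>t x = act w (s x)\<close> near the
  point. It remains to differentiate, with \<open>act w\<close> linear.\<close>

lemma emb_act:
  assumes h: "h \<in> SU2" and w: "w \<in> \<mu>" and v: "v \<in> tangent_space L (\<pi> h)"
  shows "L.emb (act w h) v = act w (L.emb h v)"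
proof -
  have h': "act w h \<in> SU2" using act_SU2[OF w] h by blast
  have \<pi>: "\<pi> (act w h) = \<pi> h" by (rule proj_act[OF w h])
  obtain c where "c \<in> charts L" "\<pi> h \<in> fst c" using L.chart_exists[OF h] by blast
  then have c: "c \<in> charts_at L (\<pi> h)" by (simp add: charts_at_def)
  obtain s where s: "lift \<pi> c s" "s (snd c (\<pi> h)) = h"
    using L.lift_exists[OF L.charts_atD(1)[OF c] h L.charts_atD(2)[OF c]] by blast
  obtain t where t: "lift \<pi> c t" "t (snd c (\<pi> h)) = act w h"
    using L.lift_exists[OF L.charts_atD(1)[OF c] h'] L.charts_atD(2)[OF c] unfolding \<pi> by blast
  let ?u = "snd c (\<pi> h)"
  have u: "?u \<in> snd c ` fst c" using L.charts_atD(2)[OF c] by blast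
  have s': "act w (s x) \<in> SU2" "\<pi> (act w (s x)) = \<pi> (s x)" if "x \<in> snd c ` fst c" for x
    using act_SU2[OF w] proj_act[OF w] liftD(4)[OF s(1) that] by blast+
  obtain W f where W: "open W" "t ?u \<in> W" "smooth_on W f"
    "\<forall>z\<in>W \<inter> SU2. \<pi> z \<in> fst c \<and> f z = snd c (\<pi> z) \<and> t (f z) = z"
    by (rule lift_extension[OF t(1) u])
  let ?T = "{x \<in> snd c ` fst c. s x \<in> act w -` W}"
  have T: "open ?T"
    by (rule open_lift_vimage[OF s(1) open_vimage[OF W(1) linear_continuous_on[OF bounded_linear_act]]])
  have uT: "?u \<in> ?T" using u W(2) s(2) t(2) by simp
  have eq: "t x = act w (s x)" if x: "x \<in> ?T" for x
  proof -
    have xc: "x \<in> snd c ` fst c" using x by blast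
    then have "f (act w (s x)) = snd c (\<pi> (act w (s x)))" "t (f (act w (s x))) = act w (s x)"
      using bspec[OF W(4), of "act w (s x)"] s'(1) x by auto
    then show ?thesis using s'(2)[OF xc] liftD(6)[OF s(1) xc] by simp
  qed
  have "fder t ?u = fder (\<lambda>x. act w (s x)) ?u" by (rule fder_cong_open[OF T uT eq])
  also have "\<dots> = (\<lambda>a. act w (fder s ?u a))"
    by (rule fder_eq[OF bounded_linear.has_derivative[OF bounded_linear_act
          smooth_on_has_derivative[OF liftD(3)[OF s(1)] u]]])
  finally have "fder t ?u (v c) = act w (fder s ?u (v c))" by simp
  then show ?thesis
    using L.emb_eq[OF h v c s] L.emb_eq[OF h' _ _ t(1), of v] v c t(2) by (simp add: \<pi>)
qed

text \<open>Testing all preimages avoids a choice; by \<open>lens_dist_iff\<close> the condition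
  holds at all of them as soon as it holds at one.\<close>

definition lens_dist :: "(C2 set, real^3) distribution" where
  "lens_dist y = {v \<in> tangent_space L y. \<forall>h\<in>SU2. \<pi> h = y \<longrightarrow> (\<exists>F. L.emb h v = hor F h)}"

text \<open>The ambient vectors at two preimages differ by an isometry \<open>act w\<close>, so the
  chosen h does not affect the value on tangent vectors.\<close>

definition lens_metric :: "(C2 set, real^3) metric" where
  "lens_metric y v w = (let h = (SOME h. h \<in> SU2 \<and> \<pi> h = y) in 4 * (L.emb h v \<bullet> L.emb h w))"

lemma lens_dist_iff:
  assumes h: "h \<in> SU2"
  shows "v \<in> lens_dist (\<pi> h) \<longleftrightarrow> v \<in> tangent_space L (\<pi> h) \<and> (\<exists>F. L.emb h v = hor F h)"
proof
  assume R: "v \<in> tangent_space L (\<pi> h) \<and> (\<exists>F. L.emb h v = hor F h)"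
  have "\<exists>F. L.emb h' v = hor F h'" if h': "h' \<in> SU2" "\<pi> h' = \<pi> h" for h'
  proof -
    obtain w where w: "w \<in> \<mu>" "h' = act w h" using proj_eq_iff[OF h h'(1)] h'(2) by auto
    then show ?thesis using R emb_act[OF h w(1)] horizontal_act[OF w(1)] by simp
  qed
  then show "v \<in> lens_dist (\<pi> h)" using R by (simp add: lens_dist_def)
qed (use h in \<open>simp add: lens_dist_def\<close>)

lemma lens_metric_eq:
  assumes h: "h \<in> SU2" and v: "v \<in> tangent_space L (\<pi> h)" and w: "w \<in> tangent_space L (\<pi> h)"
  shows "lens_metric (\<pi> h) v w = 4 * (L.emb h v \<bullet> L.emb h w)"
proof -
  define h' where "h' = (SOME h'. h' \<in> SU2 \<and> \<pi> h' = \<pi> h)"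
  have h': "h' \<in> SU2 \<and> \<pi> h' = \<pi> h" unfolding h'_def by (rule someI[of _ h]) (use h in simp)
  then obtain x where x: "x \<in> \<mu>" "h' = act x h" using proj_eq_iff[OF h, of h'] by auto
  show ?thesis
    unfolding lens_metric_def Let_def h'_def[symmetric] x(2) emb_act[OF h x(1) v] emb_act[OF h x(1) w]
    by (simp add: act_inner[OF x(1)])
qed

lemma lens_push:
  assumes h: "h \<in> SU2" and v: "v \<in> tangent_space SU2_mfd h"
  shows "lens_push p q h v \<in> tangent_space L (\<pi> h)" "L.emb h (lens_push p q h v) = SU2.emb h v"
proof -
  have v': "v \<in> tangent_space SU2_mfd (id h)" using v by simp
  have id: "\<pi> (id z) = \<pi> z" for z by simp
  note push = pushforward_emb[OF covered_manifold_SU2 covered_manifold_L id h v']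
  show "lens_push p q h v \<in> tangent_space L (\<pi> h)" "L.emb h (lens_push p q h v) = SU2.emb h v"
    using push unfolding lens_push_def id_apply by blast+
qed

lemma push_lens_dist_iff:
  assumes h: "h \<in> SU2" and v: "v \<in> tangent_space SU2_mfd h"
  shows "lens_push p q h v \<in> lens_dist (\<pi> h) \<longleftrightarrow> v \<in> SU2_dist h"
  unfolding lens_dist_iff[OF h] lens_push(2)[OF h v] SU2_dist_iff[OF h] using lens_push(1)[OF h v] v by blast

text \<open>Pushing preserves ambient vectors, and each vector orthogonal to h is the ambient vector
  of some tangent vector of SU(2); \<open>emb_surj\<close> upstairs and \<open>emb_inj\<close>
  downstairs produce the preimage.\<close>

lemma lens_dist_eq_push: assumes h: "h \<in> SU2" shows "lens_dist (\<pi> h) = lens_push p q h ` SU2_dist h"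
proof (intro equalityI subsetI)
  fix v assume v: "v \<in> lens_dist (\<pi> h)"
  then have t: "v \<in> tangent_space L (\<pi> h)" using lens_dist_iff[OF h] by blast
  obtain v' where v': "v' \<in> tangent_space SU2_mfd (id h)" "SU2.emb h v' = L.emb h v"
    by (rule SU2.emb_surj[OF h L.emb_orthogonal[OF h, of v]])
  then have v'': "v' \<in> tangent_space SU2_mfd h" by simp
  have eq: "lens_push p q h v' = v"
    using L.emb_inj[OF h lens_push(1)[OF h v''] t] lens_push(2)[OF h v''] v'(2) by simp
  then have "v' \<in> SU2_dist h" using push_lens_dist_iff[OF h v''] v by simp
  then show "v \<in> lens_push p q h ` SU2_dist h" using eq by blast
next
  fix v assume "v \<in> lens_push p q h ` SU2_dist h"
  then obtain v' where "v' \<in> SU2_dist h" "v = lens_push p q h v'" by blast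
  then show "v \<in> lens_dist (\<pi> h)" using push_lens_dist_iff[OF h, of v'] SU2_dist_iff[OF h] by blast
qed

text \<open>The equivariance under which the field \<open>h \<mapsto> hor (F h) h\<close> descends to the lens space.\<close>

definition equivariant :: "(C2 \<Rightarrow> complex) \<Rightarrow> bool" where
  "equivariant F \<longleftrightarrow> smooth_on UNIV F \<and> (\<forall>w\<in>\<mu>. \<forall>h. F (act w h) = w powi (q - 1) * F h)"

lemma equivariant_smooth: "equivariant F \<Longrightarrow> smooth_on UNIV F"
  by (simp add: equivariant_def)

lemma equivariant_mult: "equivariant F \<Longrightarrow> equivariant (\<lambda>h. c * F h)"
  unfolding equivariant_def by (auto intro!: smooth_on_mult)

section \<open>Equivariant functions and the fields they define\<close>

lemma equivariant_exists:
  assumes "h \<in> SU2" obtains F where "equivariant F" "F h \<noteq> 0"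
proof (cases "fst h = 0")
  case False
  \<comment> \<open>The first coordinate has weight 1, so the degree has to be q - 1 modulo
    p.\<close>
  let ?F = "\<lambda>h::C2. fst h ^ nat ((q - 1) mod \<bar>p\<bar>)"
  have "equivariant ?F"
    unfolding equivariant_def
    by (auto intro!: smooth_on_power smooth_on_bounded_linear[OF bounded_linear_fst]
        simp: lens_act_def power_mult_distrib root_power_mod)
  then show thesis using that False by simp
next
  case True
  have nz: "snd h \<noteq> 0" using assms True by (cases h) (auto simp: SU2_def)
  obtain u v where uv: "u * p + v * q = 1" using bezout_int[of p q] coprime by (auto simp: coprime_iff_gcd_eq_1)
  \<comment> \<open>The second coordinate has weight q. As \<open>v * q\<close> is 1 modulo p, the
    degree \<open>v * (q - 1)\<close> has the weight q - 1.\<close>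
  let ?F = "\<lambda>h::C2. snd h ^ nat ((v * (q - 1)) mod \<bar>p\<bar>)"
  have "(w powi q) ^ nat ((v * (q - 1)) mod \<bar>p\<bar>) = w powi (q - 1)" if w: "w \<in> \<mu>" for w
  proof -
    have "q - 1 = p * (u * (q - 1)) + q * (v * (q - 1))" using uv by algebra
    then have "w powi (q - 1) = (w powi p) powi (u * (q - 1)) * (w powi q) powi (v * (q - 1))"
      by (metis power_int_add power_int_mult root_nonzero[OF w])
    then show ?thesis
      using root_power_mod[OF root_powi[OF w]] w by (simp add: unity_roots_def)
  qed
  then have "equivariant ?F"
    unfolding equivariant_def
    by (auto intro!: smooth_on_power smooth_on_bounded_linear[OF bounded_linear_snd]
        simp: lens_act_def power_mult_distrib)
  then show thesis using that nz by simp
qed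

text \<open>For equivariant F the conditions at different preimages are consistent by
  \<open>emb_act\<close> and \<open>act_hor\<close>, so the vector exists; \<open>emb_inj\<close>
  makes it unique.\<close>

definition lens_field :: "(C2 \<Rightarrow> complex) \<Rightarrow> (C2 set, real^3) vfield" where
  "lens_field F y = (SOME v. v \<in> tangent_space L y \<and> (\<forall>h\<in>SU2. \<pi> h = y \<longrightarrow> L.emb h v = hor (F h) h))"

lemma lens_field:
  assumes F: "equivariant F" and h: "h \<in> SU2"
  shows "lens_field F (\<pi> h) \<in> tangent_space L (\<pi> h)" "L.emb h (lens_field F (\<pi> h)) = hor (F h) h"
proof -
  obtain v where v: "v \<in> tangent_space L (\<pi> h)" "L.emb h v = hor (F h) h"
    by (rule L.emb_surj[OF h hor_orthogonal])
  have "L.emb h' v = hor (F h') h'" if h': "h' \<in> SU2" "\<pi> h' = \<pi> h" for h'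
  proof -
    obtain w where w: "w \<in> \<mu>" "h' = act w h" using proj_eq_iff[OF h h'(1)] h'(2) by auto
    have "F h' = w powi (q - 1) * F h" using F w unfolding equivariant_def by blast
    then show ?thesis
      using emb_act[OF h w(1) v(1)] act_hor[OF w(1), of "F h" h] v(2) w(2) by simp
  qed
  then have "\<exists>v. v \<in> tangent_space L (\<pi> h) \<and> (\<forall>h'\<in>SU2. \<pi> h' = \<pi> h \<longrightarrow> L.emb h' v = hor (F h') h')"
    using v(1) by blast
  from someI_ex[OF this] show "lens_field F (\<pi> h) \<in> tangent_space L (\<pi> h)" "L.emb h (lens_field F (\<pi> h)) = hor (F h) h"
    using h by (simp_all add: lens_field_def)
qed

lemma lens_field_dist: "equivariant F \<Longrightarrow> h \<in> SU2 \<Longrightarrow> lens_field F (\<pi> h) \<in> lens_dist (\<pi> h)"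
  using lens_field lens_dist_iff by blast

lemma smooth_lens_field:
  assumes F: "equivariant F" and U: "openin (mtop L) U" shows "smooth_vf_on L U (lens_field F)"
proof (rule L.smooth_vfI[OF U])
  show "smooth_on UNIV (\<lambda>h. hor (F h) h)" by (rule smooth_on_hor[OF equivariant_smooth[OF F]])
  show "lens_field F y \<in> tangent_space L y" if "y \<in> U" for y
    using that openin_subset[OF U] lens_field(1)[OF F] by (auto simp: L.topspace_M)
  show "L.emb h (lens_field F (\<pi> h)) = hor (F h) h" if "h \<in> SU2" for h
    by (rule lens_field(2)[OF F that])
qed

lemma lens_field_span:
  assumes F: "equivariant F" and h: "h \<in> SU2" and nz: "F h \<noteq> 0" and v: "v \<in> lens_dist (\<pi> h)"
  obtains a b where "v = a *\<^sub>R lens_field F (\<pi> h) + b *\<^sub>R lens_field (\<lambda>h. \<i> * F h) (\<pi> h)"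
proof -
  let ?X = "lens_field F (\<pi> h)" and ?Y = "lens_field (\<lambda>h. \<i> * F h) (\<pi> h)"
  note iF = equivariant_mult[OF F, of \<i>]
  obtain G where t: "v \<in> tangent_space L (\<pi> h)" and G: "L.emb h v = hor G h" using v lens_dist_iff[OF h] by blast
  \<comment> \<open>The real and imaginary parts of the ratio are the coefficients of G in the real
    basis \<open>F h\<close>, \<open>\<i> * F h\<close> of the complex plane.\<close>
  define z where "z = G / F h"
  have "G = Re z *\<^sub>R F h + Im z *\<^sub>R (\<i> * F h)"
  proof -
    have "Re z *\<^sub>R F h + Im z *\<^sub>R (\<i> * F h) = z * F h"
      by (subst (3) complex_eq) (simp add: scaleR_conv_of_real algebra_simps)
    then show ?thesis using nz by (simp add: z_def)
  qed
  then have "L.emb h v = Re z *\<^sub>R L.emb h ?X + Im z *\<^sub>R L.emb h ?Y"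
    unfolding G lens_field(2)[OF F h] lens_field(2)[OF iF h] by (metis hor_add hor_scaleR)
  then have "L.emb h v = L.emb h (Re z *\<^sub>R ?X + Im z *\<^sub>R ?Y)"
    by (simp only: linear_add[OF L.linear_emb[OF h]] linear_scale[OF L.linear_emb[OF h]])
  moreover have "Re z *\<^sub>R ?X + Im z *\<^sub>R ?Y \<in> tangent_space L (\<pi> h)"
    by (intro subspace_add subspace_scale L.subspace_tangent h lens_field(1) F iF)
  ultimately have "v = Re z *\<^sub>R ?X + Im z *\<^sub>R ?Y" using L.emb_inj[OF h t] by blast
  then show thesis by (rule that)
qed

lemma subspace_lens_dist: assumes h: "h \<in> SU2" shows "subspace (lens_dist (\<pi> h))"
proof (rule subspaceI)
  note lin = L.linear_emb[OF h] and sub = L.subspace_tangent[OF h]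
  have "hor 0 h = 0" by (simp add: hor_def zero_prod_def)
  then show "0 \<in> lens_dist (\<pi> h)" using lens_dist_iff[OF h] linear_0[OF lin] subspace_0[OF sub] by metis
  show "x + y \<in> lens_dist (\<pi> h)" if "x \<in> lens_dist (\<pi> h)" "y \<in> lens_dist (\<pi> h)" for x y
    using that linear_add[OF lin, of x y] subspace_add[OF sub, of x y] hor_add unfolding lens_dist_iff[OF h] by metis
  show "c *\<^sub>R x \<in> lens_dist (\<pi> h)" if "x \<in> lens_dist (\<pi> h)" for c x
    using that linear_scale[OF lin, of c x] subspace_scale[OF sub, of x c] hor_scaleR unfolding lens_dist_iff[OF h] by metis
qed

lemma lens_dist_eq_span:
  assumes F: "equivariant F" and h: "h \<in> SU2" and nz: "F h \<noteq> 0"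
  shows "lens_dist (\<pi> h) = span {lens_field F (\<pi> h), lens_field (\<lambda>h. \<i> * F h) (\<pi> h)}"
proof
  show "lens_dist (\<pi> h) \<subseteq> span {lens_field F (\<pi> h), lens_field (\<lambda>h. \<i> * F h) (\<pi> h)}"
  proof
    fix v assume "v \<in> lens_dist (\<pi> h)"
    then obtain a b where "v = a *\<^sub>R lens_field F (\<pi> h) + b *\<^sub>R lens_field (\<lambda>h. \<i> * F h) (\<pi> h)"
      by (rule lens_field_span[OF F h nz])
    then show "v \<in> span {lens_field F (\<pi> h), lens_field (\<lambda>h. \<i> * F h) (\<pi> h)}"
      by (simp only:) (intro span_add span_scale span_base insertI1 insertI2)
  qed
  show "span {lens_field F (\<pi> h), lens_field (\<lambda>h. \<i> * F h) (\<pi> h)} \<subseteq> lens_dist (\<pi> h)"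
    using lens_field_dist[OF F h] lens_field_dist[OF equivariant_mult[OF F] h] by (intro span_minimal subspace_lens_dist h) auto
qed

lemma dim_lens_dist: assumes h: "h \<in> SU2" shows "dim (lens_dist (\<pi> h)) = 2"
proof -
  obtain F where F: "equivariant F" and nz: "F h \<noteq> 0" by (rule equivariant_exists[OF h])
  let ?X = "lens_field F (\<pi> h)" and ?Y = "lens_field (\<lambda>h. \<i> * F h) (\<pi> h)"
  note iF = equivariant_mult[OF F, of \<i>]
  have "?Y \<noteq> 0"
  proof
    assume "?Y = 0"
    then have "hor (\<i> * F h) h = 0" using lens_field(2)[OF iF h] linear_0[OF L.linear_emb[OF h]] by simp
    from hor_eq_0[OF h this] show False using nz by simp
  qed
  moreover have X: "?X \<notin> span {?Y}"
  proof
    assume "?X \<in> span {?Y}"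
    then obtain r where "?X = r *\<^sub>R ?Y" by (auto simp: span_singleton)
    then have "hor (F h) h = r *\<^sub>R hor (\<i> * F h) h"
      using lens_field(2)[OF F h] lens_field(2)[OF iF h] linear_scale[OF L.linear_emb[OF h], of r ?Y] by simp
    then have "hor (F h + (- r) *\<^sub>R (\<i> * F h)) h = 0" unfolding hor_add hor_scaleR by simp
    \<comment> \<open>A real multiple of \<i> is never 1, so the two frame vectors are independent
      over the reals.\<close>
    from hor_eq_0[OF h this] have "F h * (1 - of_real r * \<i>) = 0"
      by (simp add: scaleR_conv_of_real algebra_simps)
    then have "1 - of_real r * \<i> = 0" using nz by simp
    then show False by (simp add: complex_eq_iff)
  qed
  moreover have "?X \<noteq> ?Y" using X span_base by force
  ultimately have ind: "independent {?X, ?Y}" and card: "card {?X, ?Y} = 2" by (simp_all add: independent_insert)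
  show ?thesis unfolding lens_dist_eq_span[OF F h nz] using dim_span_eq_card_independent[OF ind] card by (rule trans)
qed

section \<open>The defining properties of a sub-Riemannian structure\<close>

lemma smooth_distribution_lens_dist: "smooth_distribution L 2 lens_dist"
  unfolding smooth_distribution_def L.topspace_M
proof (intro conjI ballI)
  fix y assume "y \<in> \<pi> ` SU2"
  then obtain h where h: "h \<in> SU2" and y: "y = \<pi> h" by blast
  show "subspace (lens_dist y)" "dim (lens_dist y) = 2" unfolding y by (rule subspace_lens_dist[OF h] dim_lens_dist[OF h])+
  show "lens_dist y \<subseteq> tangent_space L y" by (auto simp: lens_dist_def)
  obtain F where F: "equivariant F" and nz: "F h \<noteq> 0" by (rule equivariant_exists[OF h])
  \<comment> \<open>One F nonzero at h gives a frame on the image of the set where it does not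
    vanish; each class in this image has a representative to which \<open>lens_dist_eq_span\<close>
    applies.\<close>
  let ?Q = "{z. F z \<noteq> 0}" and ?X = "\<lambda>i::nat. if i = 0 then lens_field F else lens_field (\<lambda>h. \<i> * F h)"
  have "open ?Q"
    using smooth_on_continuous_on[OF equivariant_smooth[OF F]] by (intro open_Collect_neq continuous_on_const)
  then have U: "openin (mtop L) (\<pi> ` (SU2 \<inter> ?Q))" by (intro openin_L_image openin_open_Int)
  have yU: "y \<in> \<pi> ` (SU2 \<inter> ?Q)" using h nz y by blast
  have smooth: "\<forall>i<2::nat. smooth_vf_on L (\<pi> ` (SU2 \<inter> ?Q)) (?X i)"
    using smooth_lens_field[OF F U] smooth_lens_field[OF equivariant_mult[OF F] U] by simp
  have "{..<2::nat} = {0, 1}" by auto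
  then have span: "\<forall>z\<in>\<pi> ` (SU2 \<inter> ?Q). lens_dist z = span ((\<lambda>i. ?X i z) ` {..<2})"
    using lens_dist_eq_span[OF F] by auto
  show "\<exists>U X. openin (mtop L) U \<and> y \<in> U \<and> (\<forall>i<2::nat. smooth_vf_on L U (X i)) \<and>
      (\<forall>z\<in>U. lens_dist z = span ((\<lambda>i. X i z) ` {..<2}))"
    by (intro exI[of _ "\<pi> ` (SU2 \<inter> ?Q)"] exI[of _ ?X] conjI U yU smooth span)
qed

lemma openin_top: "openin (mtop L) (topspace (mtop L))"
  by simp

lemma iterated_brackets_smooth:
  "Z \<in> iterated_brackets L lens_dist \<Longrightarrow> smooth_vf_on L (topspace (mtop L)) Z"
proof (induction rule: iterated_brackets.induct)
  case (base X)
  then show ?case unfolding tangent_vfields_def by blast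
next
  case (bracket X Y)
  show ?case by (rule L.smooth_vf_lie_bracket[OF openin_top bracket.IH])
qed

lemma bracket_generating_lens_dist: "bracket_generating L lens_dist"
  unfolding bracket_generating_def
proof (intro ballI equalityI)
  let ?top = "topspace (mtop L)"
  fix y assume "y \<in> ?top"
  then obtain h where h: "h \<in> SU2" and y: "y = \<pi> h" by (auto simp: L.topspace_M)
  have top: "\<pi> x \<in> ?top" if "x \<in> SU2" for x using that by (auto simp: L.topspace_M)
  have "(\<lambda>Z. Z y) ` iterated_brackets L lens_dist \<subseteq> tangent_space L y"
    using iterated_brackets_smooth \<open>y \<in> ?top\<close> by (auto simp: smooth_vf_on_def)
  then show "span ((\<lambda>Z. Z y) ` iterated_brackets L lens_dist) \<subseteq> tangent_space L y"
    using L.subspace_tangent[OF h] unfolding y by (rule span_minimal)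
  obtain F where F: "equivariant F" and nz: "F h \<noteq> 0" by (rule equivariant_exists[OF h])
  note iF = equivariant_mult[OF F, of \<i>]
  let ?X = "lens_field F" and ?Y = "lens_field (\<lambda>h. \<i> * F h)"
  let ?S = "span ((\<lambda>Z. Z y) ` iterated_brackets L lens_dist)"
  \<comment> \<open>Equivariant fields live on the whole quotient, as the base case of
    \<open>iterated_brackets\<close> requires, even at points where G vanishes.\<close>
  have it: "lens_field G \<in> iterated_brackets L lens_dist" if G: "equivariant G" for G
    using smooth_lens_field[OF G openin_top] lens_field_dist[OF G]
    by (intro iterated_brackets.base) (auto simp: tangent_vfields_def L.topspace_M)
  let ?B = "lie_bracket L ?X ?Y"
  have B: "?B \<in> iterated_brackets L lens_dist" by (rule iterated_brackets.bracket[OF it[OF F] it[OF iF]])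
  obtain G where G: "L.emb h (?B (\<pi> h)) = (2 * (cmod (F h))\<^sup>2) *\<^sub>R vert h + hor G h"
    using L.emb_lie_bracket[OF openin_top smooth_lens_field[OF F openin_top] smooth_lens_field[OF iF openin_top]
        smooth_on_hor[OF equivariant_smooth[OF F]] lens_field(2)[OF F]
        smooth_on_hor[OF equivariant_smooth[OF iF]] lens_field(2)[OF iF] h top[OF h]]
      bracket_hor[OF equivariant_smooth[OF F], of h] by auto
  have Bt: "?B (\<pi> h) \<in> tangent_space L (\<pi> h)"
    using iterated_brackets_smooth[OF B] top[OF h] by (simp add: smooth_vf_on_def)
  show "tangent_space L y \<subseteq> ?S"
  proof
    fix v assume "v \<in> tangent_space L y"
    then have v: "v \<in> tangent_space L (\<pi> h)" by (simp add: y)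
    obtain r H where rH: "L.emb h v = r *\<^sub>R vert h + hor H h"
      by (rule orthogonal_decomposition[OF h L.emb_orthogonal[OF h, of v]])
    \<comment> \<open>Subtracting c times the bracket cancels the vertical part of v; the remainder
      is horizontal, hence a combination of the two frame fields.\<close>
    define c where "c = r / (2 * (cmod (F h))\<^sup>2)"
    have c: "c * (2 * (cmod (F h))\<^sup>2) = r" using nz by (simp add: c_def)
    let ?w = "v + (- c) *\<^sub>R ?B (\<pi> h)"
    have "L.emb h ?w = L.emb h v + (- c) *\<^sub>R L.emb h (?B (\<pi> h))"
      by (simp only: linear_add[OF L.linear_emb[OF h]] linear_scale[OF L.linear_emb[OF h]])
    also have "\<dots> = hor H h + (- c) *\<^sub>R hor G h"
      unfolding rH G using c by (simp add: scaleR_add_right)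
    also have "\<dots> = hor (H + (- c) *\<^sub>R G) h" unfolding hor_add hor_scaleR ..
    finally have "L.emb h ?w = hor (H + (- c) *\<^sub>R G) h" .
    moreover have "?w \<in> tangent_space L (\<pi> h)"
      by (intro subspace_add subspace_scale L.subspace_tangent h v Bt)
    ultimately have "?w \<in> lens_dist (\<pi> h)" using lens_dist_iff[OF h] by blast
    then obtain a b where "?w = a *\<^sub>R ?X (\<pi> h) + b *\<^sub>R ?Y (\<pi> h)" by (rule lens_field_span[OF F h nz])
    then have "v = a *\<^sub>R ?X y + b *\<^sub>R ?Y y + c *\<^sub>R ?B y" by (simp add: y algebra_simps)
    also have "\<dots> \<in> ?S" by (intro span_add span_scale span_base imageI it F iF B)
    finally show "v \<in> ?S" .
  qed
qed

text \<open>In a chart the metric is four times the inner product of the vectors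
  \<open>fder s v (vf_coord X c v)\<close> and \<open>fder s v (vf_coord Y c v)\<close>, smooth
  because s is. Positivity comes from the injectivity of \<open>emb h\<close>.\<close>

lemma smooth_metric_lens_metric: "smooth_metric L lens_dist lens_metric"
  unfolding smooth_metric_def L.topspace_M
proof (intro conjI ballI allI impI)
  fix y assume "y \<in> \<pi> ` SU2"
  then obtain h where h: "h \<in> SU2" and y: "y = \<pi> h" by blast
  note lin = L.linear_emb[OF h] and sub = L.subspace_tangent[OF h]
  have t: "u \<in> tangent_space L (\<pi> h)" if "u \<in> lens_dist y" for u using that lens_dist_iff[OF h] by (simp add: y)
  fix u assume u: "u \<in> lens_dist y"
  show "0 < lens_metric y u u" if "u \<noteq> 0"
  proof -
    have "L.emb h u \<noteq> 0"
      using L.emb_inj[OF h t[OF u] subspace_0[OF sub]] linear_0[OF lin] that by auto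
    then show ?thesis unfolding y lens_metric_eq[OF h t[OF u] t[OF u]] by simp
  qed
  fix v assume v: "v \<in> lens_dist y"
  show "lens_metric y u v = lens_metric y v u"
    unfolding y lens_metric_eq[OF h t[OF u] t[OF v]] lens_metric_eq[OF h t[OF v] t[OF u]] by (simp add: inner_commute)
  fix w a b assume w: "w \<in> lens_dist y"
  have ab: "a *\<^sub>R u + b *\<^sub>R v \<in> tangent_space L (\<pi> h)"
    by (intro subspace_add subspace_scale sub t u v)
  show "lens_metric y (a *\<^sub>R u + b *\<^sub>R v) w = a * lens_metric y u w + b * lens_metric y v w"
    unfolding y lens_metric_eq[OF h ab t[OF w]] lens_metric_eq[OF h t[OF u] t[OF w]] lens_metric_eq[OF h t[OF v] t[OF w]]
    by (simp add: linear_add[OF lin] linear_scale[OF lin] inner_add_left algebra_simps)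
next
  fix U X Y assume U: "openin (mtop L) U" and XY: "X \<in> tangent_vfields L lens_dist U" "Y \<in> tangent_vfields L lens_dist U"
  then have X: "smooth_vf_on L U X" and Y: "smooth_vf_on L U Y" by (auto simp: tangent_vfields_def)
  show "smooth_fun_on L U (\<lambda>x. lens_metric x (X x) (Y x))"
    unfolding smooth_fun_on_def
  proof (intro ballI smooth_on_local)
    fix c u assume c: "c \<in> charts L" and "u \<in> snd c ` (U \<inter> fst c)"
    then obtain x where x: "x \<in> U" "x \<in> fst c" "u = snd c x" by blast
    obtain h s where hs: "h \<in> SU2" "\<pi> h = x" "lift \<pi> c s" "s (snd c x) = h"
      by (rule L.chart_point_lift[OF c x(2)])
    have u: "u \<in> snd c ` fst c" "\<pi> (s u) \<in> U" using x hs by auto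
    obtain T where T: "open T" "u \<in> T" "T \<subseteq> snd c ` (U \<inter> fst c)" "T \<subseteq> snd c ` fst c" "\<forall>v\<in>T. \<pi> (s v) \<in> U"
      by (rule L.chart_nhd[OF U hs(3) u])
    have "in_chart (\<lambda>x. lens_metric x (X x) (Y x)) c v = 4 * (fder s v (vf_coord X c v) \<bullet> fder s v (vf_coord Y c v))"
      if v: "v \<in> T" for v
    proof -
      have vc: "v \<in> snd c ` fst c" using v T(4) by blast
      have t: "X (\<pi> (s v)) \<in> tangent_space L (\<pi> (s v))" "Y (\<pi> (s v)) \<in> tangent_space L (\<pi> (s v))"
        using X Y T(5) v by (auto simp: smooth_vf_on_def)
      show ?thesis
        using lens_metric_eq[OF liftD(4)[OF hs(3) vc] t] L.fder_lift_vf[OF c hs(3) vc, of X] L.fder_lift_vf[OF c hs(3) vc, of Y] t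
        by (simp add: in_chart_def liftD(7)[OF hs(3) vc])
    qed
    moreover have "smooth_on T (\<lambda>v. 4 * (fder s v (vf_coord X c v) \<bullet> fder s v (vf_coord Y c v)))"
      using X Y c
      by (intro smooth_on_mult smooth_on_const smooth_on_inner smooth_on_fder_apply T(1)
          smooth_on_subset[OF liftD(3)[OF hs(3)] T(4)] smooth_on_subset[OF _ T(3)])
        (auto simp: smooth_vf_on_def)
    ultimately show "\<exists>T. open T \<and> u \<in> T \<and> smooth_on T (in_chart (\<lambda>x. lens_metric x (X x) (Y x)) c)"
      using T(1,2) smooth_on_cong[OF T(1), of "in_chart (\<lambda>x. lens_metric x (X x) (Y x)) c"
          "\<lambda>v. 4 * (fder s v (vf_coord X c v) \<bullet> fder s v (vf_coord Y c v))"] by blast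
  qed
qed

lemma sub_riemannian_L: "sub_riemannian_structure L 2 lens_dist lens_metric"
  unfolding sub_riemannian_structure_def
  by (intro conjI L.smooth_manifoldI Hausdorff_L smooth_distribution_lens_dist bracket_generating_lens_dist smooth_metric_lens_metric)

end

text \<open>Well-definedness is expressed by one D and one g that satisfy the equations at every
  representative h of a class. The first conjunct certifies that the quotient charts give the
  intended smooth structure.\<close>

theorem proposition3:
  fixes p q :: int
  assumes "p \<noteq> 0" and "q \<noteq> 0" and "coprime p q"
  shows "local_diffeomorphism SU2_mfd (lens_space p q) (lens_proj p q) \<and>
    (\<exists>D g.
      (\<forall>h\<in>SU2. D (lens_proj p q h) = lens_push p q h ` SU2_dist h) \<and>
      (\<forall>h\<in>SU2. \<forall>v\<in>tangent_space SU2_mfd h. \<forall>w\<in>tangent_space SU2_mfd h.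
         lens_push p q h v \<in> D (lens_proj p q h) \<longrightarrow>
         lens_push p q h w \<in> D (lens_proj p q h) \<longrightarrow>
         v \<in> SU2_dist h \<and> w \<in> SU2_dist h \<and>
         g (lens_proj p q h) (lens_push p q h v) (lens_push p q h w) = SU2_metric h v w) \<and>
      sub_riemannian_structure (lens_space p q) 2 D g)"
proof -
  interpret lens p q using assms by unfold_locales
  have "v \<in> SU2_dist h \<and> w \<in> SU2_dist h \<and> lens_metric (\<pi> h) (lens_push p q h v) (lens_push p q h w) = SU2_metric h v w"
    if h: "h \<in> SU2" and v: "v \<in> tangent_space SU2_mfd h" and w: "w \<in> tangent_space SU2_mfd h"
      and push: "lens_push p q h v \<in> lens_dist (\<pi> h)" "lens_push p q h w \<in> lens_dist (\<pi> h)" for h v w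
  proof -
    have *: "v \<in> SU2_dist h" "w \<in> SU2_dist h" using push push_lens_dist_iff[OF h] v w by auto
    then show ?thesis
      using lens_metric_eq[OF h lens_push(1)[OF h v] lens_push(1)[OF h w]] lens_push(2)[OF h v] lens_push(2)[OF h w] SU2_metric_eq[OF h *] by simp
  qed
  then show ?thesis
    by (intro conjI exI[of _ lens_dist] exI[of _ lens_metric] ballI impI local_diffeomorphism_proj lens_dist_eq_push sub_riemannian_L)
      blast+
qed

end
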